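(* Consider the $N$-player game data described in the context. Assume the system is mean-square stabilizable and let $\boldsymbol K=(\boldsymbol K_1,\dots,\boldsymbol K_N)\in\mathcal K$. For every $i\in\mathcal I$ and all matrices $\boldsymbol Q_i\in\mathbb S^n_{++}$, $\boldsymbol R_{ii}\in\mathbb S^{m_i}_{++}$, $\boldsymbol R_{ij}\in\mathbb S^{m_j}_+$ ($j\in\mathcal I\setminus\{i\}$), with $$\boldsymbol\theta_i=\bigl[\operatorname{vec}(\boldsymbol Q_i)^\top\ \operatorname{vec}(\boldsymbol R_{i1})^\top\ \cdots\ \operatorname{vec}(\boldsymbol R_{iN})^\top\bigr]^\top\in\mathbb R^{p_i},\qquad p_i=n^2+\sum_{j\in\mathcal I}m_j^2,$$ the following are equivalent: (i) there exists $\boldsymbol P_i\in\mathbb S^n_{++}$ such that $$\boldsymbol 0=\boldsymbol P_i\boldsymbol A_{cl}(\boldsymbol K)+\boldsymbol A_{cl}(\boldsymbol K)^\top\boldsymbol P_i+\boldsymbol C_{cl}(\boldsymbol K)^\top\boldsymbol P_i\boldsymbol C_{cl}(\boldsymbol K)+\boldsymbol Q_i+\sum_{j\in\mathcal I}\boldsymbol K_j^\top\boldsymbol R_{ij}\boldsymbol K_j$$ and $$\boldsymbol K_i=\bigl(\boldsymbol R_{ii}+\boldsymbol D_i^\top\boldsymbol P_i\boldsymbol D_i\bigr)^{-1}\Bigl(\boldsymbol B_i^\top\boldsymbol P_i+\boldsymbol D_i^\top\boldsymbol P_i\boldsymbol C-\sum_{k\in\mathcal I\setminus\{i\}}\boldsymbol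 D_i^\top\boldsymbol P_i\boldsymbol D_k\boldsymbol K_k\Bigr);$$ (ii) $\boldsymbol M_i\boldsymbol\theta_i=\boldsymbol 0$, i.e. $\boldsymbol\theta_i\in\ker(\boldsymbol M_i)$. Here $$\boldsymbol M_i:=\bigl[\boldsymbol S_i\ \ \boldsymbol S_i\boldsymbol K_1^\otimes\ \cdots\ \boldsymbol S_i\boldsymbol K_{i-1}^\otimes\ \ \bigl((\boldsymbol K_i^\top\otimes\boldsymbol I_{m_i})+\boldsymbol S_i\boldsymbol K_i^\otimes\bigr)\ \ \boldsymbol S_i\boldsymbol K_{i+1}^\otimes\ \cdots\ \boldsymbol S_i\boldsymbol K_N^\otimes\bigr]\in\mathbb R^{nm_i\times p_i},$$ with $\boldsymbol K_j^\otimes:=\boldsymbol K_j^\top\otimes\boldsymbol K_j^\top\in\mathbb R^{n^2\times m_j^2}$ and $$\boldsymbol S_i:=\Bigl(\boldsymbol I_n\otimes\boldsymbol B_i^\top+\boldsymbol C^\top\otimes\boldsymbol D_i^\top-\sum_{k\in\mathcal I}\boldsymbol K_k^\top\boldsymbol D_k^\top\otimes\boldsymbol D_i^\top\Bigr)\Bigl(\boldsymbol A_{cl}(\boldsymbol K)^\top\otimes\boldsymbol I_n+\boldsymbol I_n\otimes\boldsymbol A_{cl}(\boldsymbol K)^\top+\boldsymbol C_{cl}(\boldsymbol K)^\top\otimes\boldsymbol C_{cl}(\boldsymbol K)^\top\Bigr)^{-1}\in\mathbb R^{nm_i\times n^2}.$$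
   Context: Players: $\mathcal I=\{1,\dots,N\}$. System matrices: $\boldsymbol A,\boldsymbol C\in\mathbb R^{n\times n}$, $\boldsymbol B_i,\boldsymbol D_i\in\mathbb R^{n\times m_i}$ for $i\in\mathcal I$. The dynamics are $d\boldsymbol x=(\boldsymbol A\boldsymbol x+\sum_{j}\boldsymbol B_j\boldsymbol u_j)dt+(\boldsymbol C\boldsymbol x+\sum_{j}\boldsymbol D_j\boldsymbol u_j)d\omega$, $\boldsymbol x(0)=\boldsymbol x_0\in\mathbb R^n$ deterministic, with $\omega$ a one-dimensional standard Wiener process, and feedback strategies $\boldsymbol u_i=-\boldsymbol K_i\boldsymbol x$, $\boldsymbol K_i\in\mathbb R^{m_i\times n}$. Put $\boldsymbol A_{cl}(\boldsymbol K)=\boldsymbol A-\sum_{j\in\mathcal I}\boldsymbol B_j\boldsymbol K_j$, $\boldsymbol C_{cl}(\boldsymbol K)=\boldsymbol C-\sum_{j\in\mathcal I}\boldsymbol D_j\boldsymbol K_j$. The closed-loop system $d\boldsymbol x=\boldsymbol A_{cl}(\boldsymbol K)\boldsymbol x\,dt+\boldsymbol C_{cl}(\boldsymbol K)\boldsymbol x\,d\omega$ is mean-square stable if $\lim_{t\to\infty}\mathbb E[\|\boldsymbol x(t)\|^2]=0$ for all $\boldsymbol x_0\in\mathbb R^n$; $\mathcal K$ is the set of tuples $\boldsymbol K=(\boldsymbol K_1,\dots,\boldsymbol K_N)$ for which this holds, and the system is mean-square stabilizable if $\mathcal K\ne\varnothing$. $\otimes$ is the Kronecker product, $\operatorname{vec}$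 the column-wise vectorization, and $\mathbb S^k_{++}$ (resp. $\mathbb S^k_+$) the symmetric positive definite (resp. positive semidefinite) real $k\times k$ matrices. In the problem, $\boldsymbol Q_i,\boldsymbol R_{ij}$ are the weight matrices of player $i$'s cost $J_i=\mathbb E[\int_0^\infty\boldsymbol x^\top\boldsymbol Q_i\boldsymbol x+\sum_j\boldsymbol u_j^\top\boldsymbol R_{ij}\boldsymbol u_j\,dt]$. *)

theory Defs
  imports
    "HOL-Probability.Probability"
    "Jordan_Normal_Form.Matrix"
    "Jordan_Normal_Form.Gauss_Jordan_Elimination"
begin

unbundle no vec_syntax

section \<open>Matrices\<close>

text \<open>The players may have control spaces of different dimensions, so matrices and vectors are the
  ones with dimensions given by terms (\<^term>\<open>carrier_mat\<close>, \<^term>\<open>carrier_vec\<close>).\<close>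

definition mat_sum :: "nat \<Rightarrow> nat \<Rightarrow> (nat \<Rightarrow> real mat) \<Rightarrow> nat set \<Rightarrow> real mat" where
  "mat_sum nr nc f I = mat nr nc (\<lambda>(a, b). \<Sum>j\<in>I. f j $$ (a, b))"

text \<open>Only meaningful for invertible matrices.\<close>

definition mat_inv :: "real mat \<Rightarrow> real mat" where
  "mat_inv A = the (mat_inverse A)"

definition kronecker :: "real mat \<Rightarrow> real mat \<Rightarrow> real mat" (infixl \<open>\<otimes>\<^sub>K\<close> 75) where
  "A \<otimes>\<^sub>K B = mat (dim_row A * dim_row B) (dim_col A * dim_col B)
     (\<lambda>(a, b). A $$ (a div dim_row B, b div dim_col B) * B $$ (a mod dim_row B, b mod dim_col B))"

text \<open>Column-wise vectorization.\<close>

definition vectorize :: "real mat \<Rightarrow> real vec" where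
  "vectorize A = vec (dim_row A * dim_col A) (\<lambda>k. A $$ (k mod dim_row A, k div dim_row A))"

text \<open>\<open>A @\<^sub>c B\<close> is the block row \<open>[A B]\<close>.\<close>

definition append_cols :: "real mat \<Rightarrow> real mat \<Rightarrow> real mat" (infixr \<open>@\<^sub>c\<close> 65) where
  "A @\<^sub>c B = four_block_mat A B (0\<^sub>m 0 (dim_col A)) (0\<^sub>m 0 (dim_col B))"

definition sym_pos_def :: "nat \<Rightarrow> real mat set" where
  "sym_pos_def k = {P \<in> carrier_mat k k. transpose_mat P = P \<and>
     (\<forall>v\<in>carrier_vec k. v \<noteq> 0\<^sub>v k \<longrightarrow> v \<bullet> (P *\<^sub>v v) > 0)}"

definition sym_pos_semidef :: "nat \<Rightarrow> real mat set" where
  "sym_pos_semidef k = {P \<in> carrier_mat k k. transpose_mat P = P \<and>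
     (\<forall>v\<in>carrier_vec k. v \<bullet> (P *\<^sub>v v) \<ge> 0)}"

lemma dim_kronecker [simp]:
  "dim_row (A \<otimes>\<^sub>K B) = dim_row A * dim_row B" "dim_col (A \<otimes>\<^sub>K B) = dim_col A * dim_col B"
  by (simp_all add: kronecker_def)

lemma dim_vectorize [simp]: "dim_vec (vectorize A) = dim_row A * dim_col A"
  by (simp add: vectorize_def)

lemma dim_append_cols [simp]:
  "dim_row (A @\<^sub>c B) = dim_row A" "dim_col (A @\<^sub>c B) = dim_col A + dim_col B"
  by (simp_all add: append_cols_def)

lemma dim_mat_sum [simp]: "dim_row (mat_sum nr nc f I) = nr" "dim_col (mat_sum nr nc f I) = nc"
  by (simp_all add: mat_sum_def)


section \<open>Wiener process and Ito integral\<close>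

text \<open>A standard one-dimensional Wiener process \<open>W\<close> with respect to a filtration \<open>F\<close> that contains
  the null sets. The time set is the nonnegative half-line; the values at negative times are
  irrelevant.\<close>

locale wiener_process = prob_space M + filtration "space M" F
  for M :: "'a measure" and F :: "real \<Rightarrow> 'a measure" and W :: "real \<Rightarrow> 'a \<Rightarrow> real" +
  assumes subalgebra_F: "\<And>t. subalgebra M (F t)"
    and null_sets_F: "null_sets M \<subseteq> sets (F 0)"
    and adapted: "\<And>t. 0 \<le> t \<Longrightarrow> W t \<in> borel_measurable (F t)"
    and starts_at_0: "AE w in M. W 0 w = 0"
    and continuous_paths: "AE w in M. continuous_on {0..} (\<lambda>t. W t w)"
    and normal_increments: "\<And>s t. 0 \<le> s \<Longrightarrow> s < t \<Longrightarrow>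
      distributed M lborel (\<lambda>w. W t w - W s w) (normal_density 0 (sqrt (t - s)))"
    and indep_increments: "\<And>s t. 0 \<le> s \<Longrightarrow> s < t \<Longrightarrow>
      indep_set (sets (F s)) {(\<lambda>w. W t w - W s w) -` U \<inter> space M | U. U \<in> sets borel}"

text \<open>Progressively measurable processes on \<open>[0, T]\<close> that are square-integrable over
  \<open>[0, T] \<times> \<Omega>\<close>.\<close>

definition square_integrable_process ::
  "'a measure \<Rightarrow> (real \<Rightarrow> 'a measure) \<Rightarrow> real \<Rightarrow> (real \<Rightarrow> 'a \<Rightarrow> real) \<Rightarrow> bool" where
  "square_integrable_process M F T f \<longleftrightarrow>
     (\<forall>t\<in>{0..T}. (\<lambda>(s, w). f s w) \<in> borel_measurable (restrict_space borel {0..t} \<Otimes>\<^sub>M F t)) \<and>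
     (\<integral>\<^sup>+w. (\<integral>\<^sup>+s\<in>{0..T}. ennreal ((f s w)\<^sup>2) \<partial>lborel) \<partial>M) < \<infinity>"

text \<open>The step process \<open>\<Sum>\<^sub>j \<xi> j \<cdot> indicator (\<tau> j, \<tau> (j + 1)]\<close>, with each coefficient \<open>\<xi> j\<close> bounded and
  known at time \<open>\<tau> j\<close>, and its integral.\<close>

definition step_coefficients ::
  "'a measure \<Rightarrow> (real \<Rightarrow> 'a measure) \<Rightarrow> real \<Rightarrow> nat \<Rightarrow> (nat \<Rightarrow> real) \<Rightarrow> (nat \<Rightarrow> 'a \<Rightarrow> real) \<Rightarrow> bool" where
  "step_coefficients M F T k \<tau> \<xi> \<longleftrightarrow>
     0 \<le> \<tau> 0 \<and> (\<forall>j<k. \<tau> j \<le> \<tau> (Suc j)) \<and> \<tau> k \<le> T \<and>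
     (\<forall>j<k. \<xi> j \<in> borel_measurable (F (\<tau> j)) \<and> (\<exists>c. \<forall>w\<in>space M. \<bar>\<xi> j w\<bar> \<le> c))"

definition step_process :: "nat \<Rightarrow> (nat \<Rightarrow> real) \<Rightarrow> (nat \<Rightarrow> 'a \<Rightarrow> real) \<Rightarrow> real \<Rightarrow> 'a \<Rightarrow> real" where
  "step_process k \<tau> \<xi> s w = (\<Sum>j<k. \<xi> j w * indicator {\<tau> j<..\<tau> (Suc j)} s)"

definition step_integral ::
  "(real \<Rightarrow> 'a \<Rightarrow> real) \<Rightarrow> nat \<Rightarrow> (nat \<Rightarrow> real) \<Rightarrow> (nat \<Rightarrow> 'a \<Rightarrow> real) \<Rightarrow> 'a \<Rightarrow> real" where
  "step_integral W k \<tau> \<xi> w = (\<Sum>j<k. \<xi> j w * (W (\<tau> (Suc j)) w - W (\<tau> j) w))"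

text \<open>\<open>J\<close> is (a version of) the Ito integral \<open>\<integral>\<^sub>0\<^sup>T f dW\<close>: the mean-square limit of the integrals of
  step processes that approximate \<open>f\<close> in \<open>L\<^sup>2([0, T] \<times> \<Omega>)\<close>. By the Ito isometry, \<open>J\<close> is almost
  surely unique.\<close>

definition has_ito_integral ::
  "'a measure \<Rightarrow> (real \<Rightarrow> 'a measure) \<Rightarrow> (real \<Rightarrow> 'a \<Rightarrow> real) \<Rightarrow> real \<Rightarrow>
   (real \<Rightarrow> 'a \<Rightarrow> real) \<Rightarrow> ('a \<Rightarrow> real) \<Rightarrow> bool" where
  "has_ito_integral M F W T f J \<longleftrightarrow>
     square_integrable_process M F T f \<and> J \<in> borel_measurable M \<and>
     (\<exists>k \<tau> \<xi>. (\<forall>l::nat. step_coefficients M F T (k l) (\<tau> l) (\<xi> l)) \<and>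
       (\<lambda>l. \<integral>\<^sup>+w. (\<integral>\<^sup>+s\<in>{0..T}. ennreal ((f s w - step_process (k l) (\<tau> l) (\<xi> l) s w)\<^sup>2) \<partial>lborel) \<partial>M)
         \<longlonglongrightarrow> 0 \<and>
       (\<lambda>l. \<integral>\<^sup>+w. ennreal ((J w - step_integral W (k l) (\<tau> l) (\<xi> l) w)\<^sup>2) \<partial>M) \<longlonglongrightarrow> 0)"


section \<open>Linear stochastic differential equations\<close>

text \<open>Strong solutions of \<open>dx = A x dt + C x dW\<close>, \<open>x(0) = x0\<close> in \<open>\<real>\<^sup>n\<close>: continuous, adapted,
  locally square-integrable processes satisfying the integral equation component by component.\<close>

definition linear_sde_solution ::
  "'a measure \<Rightarrow> (real \<Rightarrow> 'a measure) \<Rightarrow> (real \<Rightarrow> 'a \<Rightarrow> real) \<Rightarrow> nat \<Rightarrow> real mat \<Rightarrow> real mat \<Rightarrow>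
   real vec \<Rightarrow> (real \<Rightarrow> 'a \<Rightarrow> real vec) \<Rightarrow> bool" where
  "linear_sde_solution M F W n A C x0 x \<longleftrightarrow>
     (\<forall>t\<ge>0. \<forall>w\<in>space M. x t w \<in> carrier_vec n) \<and>
     (\<forall>i<n. AE w in M. continuous_on {0..} (\<lambda>t. x t w $ i)) \<and>
     (\<forall>i<n. \<forall>T\<ge>0. square_integrable_process M F T (\<lambda>t w. x t w $ i)) \<and>
     (\<forall>i<n. \<forall>t\<ge>0. \<exists>J. has_ito_integral M F W t (\<lambda>s w. (C *\<^sub>v x s w) $ i) J \<and>
        (AE w in M. x t w $ i = x0 $ i + (LINT s:{0..t}|lborel. (A *\<^sub>v x s w) $ i) + J w))"

text \<open>Solutions exist and are unique up to indistinguishability, so \<open>\<exists>x\<close> refers to the solution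
  with initial value \<open>x0\<close>. The expectation is taken in \<open>[0, \<infinity>]\<close>.\<close>

definition mean_square_stable ::
  "'a measure \<Rightarrow> (real \<Rightarrow> 'a measure) \<Rightarrow> (real \<Rightarrow> 'a \<Rightarrow> real) \<Rightarrow> nat \<Rightarrow> real mat \<Rightarrow> real mat \<Rightarrow> bool" where
  "mean_square_stable M F W n A C \<longleftrightarrow>
     (\<forall>x0\<in>carrier_vec n. \<exists>x. linear_sde_solution M F W n A C x0 x \<and>
        ((\<lambda>t. \<integral>\<^sup>+w. ennreal (x t w \<bullet> x t w) \<partial>M) \<longlongrightarrow> 0) at_top)"


section \<open>The game\<close>

text \<open>\<open>closed_loop n N A B K\<close> is the closed-loop drift matrix; with \<open>C\<close>, \<open>D\<close> in place of \<open>A\<close>, \<open>B\<close>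
  it is the closed-loop diffusion matrix.\<close>

definition closed_loop ::
  "nat \<Rightarrow> nat \<Rightarrow> real mat \<Rightarrow> (nat \<Rightarrow> real mat) \<Rightarrow> (nat \<Rightarrow> real mat) \<Rightarrow> real mat" where
  "closed_loop n N A B K = A - mat_sum n n (\<lambda>j. B j * K j) {1..N}"

definition stabilizing_gains ::
  "'a measure \<Rightarrow> (real \<Rightarrow> 'a measure) \<Rightarrow> (real \<Rightarrow> 'a \<Rightarrow> real) \<Rightarrow> nat \<Rightarrow> nat \<Rightarrow> (nat \<Rightarrow> nat) \<Rightarrow>
   real mat \<Rightarrow> (nat \<Rightarrow> real mat) \<Rightarrow> real mat \<Rightarrow> (nat \<Rightarrow> real mat) \<Rightarrow> (nat \<Rightarrow> real mat) set" where
  "stabilizing_gains M F W n N m A B C D =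
     {K. (\<forall>j\<in>{1..N}. K j \<in> carrier_mat (m j) n) \<and>
         mean_square_stable M F W n (closed_loop n N A B K) (closed_loop n N C D K)}"

definition mean_square_stabilizable ::
  "'a measure \<Rightarrow> (real \<Rightarrow> 'a measure) \<Rightarrow> (real \<Rightarrow> 'a \<Rightarrow> real) \<Rightarrow> nat \<Rightarrow> nat \<Rightarrow> (nat \<Rightarrow> nat) \<Rightarrow>
   real mat \<Rightarrow> (nat \<Rightarrow> real mat) \<Rightarrow> real mat \<Rightarrow> (nat \<Rightarrow> real mat) \<Rightarrow> bool" where
  "mean_square_stabilizable M F W n N m A B C D \<longleftrightarrow> stabilizing_gains M F W n N m A B C D \<noteq> {}"

definition theta_vec :: "nat \<Rightarrow> real mat \<Rightarrow> (nat \<Rightarrow> real mat) \<Rightarrow> real vec" where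
  "theta_vec N Q R = vectorize Q @\<^sub>v foldr (\<lambda>j v. vectorize (R j) @\<^sub>v v) [1..<Suc N] (0\<^sub>v 0)"

definition S_mat ::
  "nat \<Rightarrow> nat \<Rightarrow> (nat \<Rightarrow> nat) \<Rightarrow> real mat \<Rightarrow> (nat \<Rightarrow> real mat) \<Rightarrow> real mat \<Rightarrow> (nat \<Rightarrow> real mat) \<Rightarrow>
   (nat \<Rightarrow> real mat) \<Rightarrow> nat \<Rightarrow> real mat" where
  "S_mat n N m A B C D K i =
     (let Acl = closed_loop n N A B K; Ccl = closed_loop n N C D K in
      (1\<^sub>m n \<otimes>\<^sub>K transpose_mat (B i) + transpose_mat C \<otimes>\<^sub>K transpose_mat (D i)
        - mat_sum (n * m i) (n * n)
            (\<lambda>k. (transpose_mat (K k) * transpose_mat (D k)) \<otimes>\<^sub>K transpose_mat (D i)) {1..N})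
      * mat_inv (transpose_mat Acl \<otimes>\<^sub>K 1\<^sub>m n + 1\<^sub>m n \<otimes>\<^sub>K transpose_mat Acl
                 + transpose_mat Ccl \<otimes>\<^sub>K transpose_mat Ccl))"

definition M_mat ::
  "nat \<Rightarrow> nat \<Rightarrow> (nat \<Rightarrow> nat) \<Rightarrow> real mat \<Rightarrow> (nat \<Rightarrow> real mat) \<Rightarrow> real mat \<Rightarrow> (nat \<Rightarrow> real mat) \<Rightarrow>
   (nat \<Rightarrow> real mat) \<Rightarrow> nat \<Rightarrow> real mat" where
  "M_mat n N m A B C D K i =
     (let S = S_mat n N m A B C D K i;
          block = (\<lambda>j. let SK = S * (transpose_mat (K j) \<otimes>\<^sub>K transpose_mat (K j))
                       in if j = i then transpose_mat (K i) \<otimes>\<^sub>K 1\<^sub>m (m i) + SK else SK)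
      in S @\<^sub>c foldr (\<lambda>j X. block j @\<^sub>c X) [1..<Suc N] (0\<^sub>m (n * m i) 0))"

end

theory Submission
  imports Defs "Jordan_Normal_Form.Determinant"
begin

text \<open>Let \<open>x\<close> and \<open>y\<close> be two solutions of \<open>dx = A x dt + C x dW\<close>. The Ito isometry and the martingale
  property of the Ito integral give an integrated product formula for \<open>E (x y\<^sup>T)\<close>, namely
  \<open>\<langle>G, E (x\<^sub>t y\<^sub>t\<^sup>T)\<rangle> = \<langle>G, x\<^sub>0 y\<^sub>0\<^sup>T\<rangle> + \<integral>\<^sub>0\<^sup>t \<langle>\<L> G, E (x\<^sub>s y\<^sub>s\<^sup>T)\<rangle> ds\<close> for every matrix \<open>G\<close>, where
  \<open>\<L> G = G A + A\<^sup>T G + C\<^sup>T G C\<close>. Under mean-square stability the left-hand side tends to 0. Hence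
  \<open>\<L> G = 0\<close> forces \<open>x\<^sub>0\<^sup>T G y\<^sub>0 = 0\<close> for all initial values, so \<open>\<L>\<close> is injective (on all matrices, not only
  the symmetric ones, because \<open>x\<close> and \<open>y\<close> may differ), and \<open>\<L> P = - Q\<close> with \<open>Q > 0\<close> gives
  \<open>x\<^sub>0\<^sup>T P x\<^sub>0 = \<integral>\<^sub>0\<^sup>\<infinity> E (x\<^sub>s\<^sup>T Q x\<^sub>s) ds > 0\<close>.

  So the Lyapunov equation has exactly one solution \<open>P\<close>, and \<open>P\<close> is positive definite. The matrix inverted
  in \<open>S\<^sub>i\<close> represents \<open>\<L>\<close> under vectorization, whence \<open>M\<^sub>i \<theta>\<^sub>i = vec (R\<^sub>i\<^sub>i K\<^sub>i - \<Gamma>)\<close> where \<open>\<Gamma>\<close> is the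
  matrix for which the gain equation reads \<open>R\<^sub>i\<^sub>i K\<^sub>i = \<Gamma>\<close> after clearing the inverse.\<close>

section \<open>Square-integrable functions\<close>

text \<open>The product formula comes from expanding x_t y_t into initial values, drift integrals
  and stochastic integrals, and evaluating each product in expectation. The delicate product is
  drift times stochastic integral. A solution supplies, for each t separately, some version of the
  Ito integral: joint measurability in t is not given, and the exceptional null sets depend on t.
  Statements about the stochastic integral are therefore made at one fixed time. Its martingale
  property is put weakly, by testing against square-integrable variables known at time s: such a
  test cannot distinguish the integral up to t from the integral up to s. All time integrals are
  taken over the single product of \<open>M\<close> and \<open>lborel\<close>, with the horizon
  encoded by an indicator, so that t varies while the measure stays fixed. The moment identity is
  used in integrated form, as a relation between the moments at time t and the accumulated moments
  up to t. The solutions to which it is applied are those that the existential in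
  \<open>mean_square_stable\<close> provides.\<close>

definition sq_integrable :: "'b measure \<Rightarrow> ('b \<Rightarrow> real) \<Rightarrow> bool" where
  "sq_integrable N f \<longleftrightarrow> f \<in> borel_measurable N \<and> integrable N (\<lambda>x. (f x)\<^sup>2)"

lemma sq_integrable_square: "sq_integrable N f \<Longrightarrow> integrable N (\<lambda>x. (f x)\<^sup>2)"
  by (simp add: sq_integrable_def)

lemma sq_integrable_mult:
  assumes f: "sq_integrable N f" and g: "sq_integrable N g"
  shows "integrable N (\<lambda>x. f x * g x)"
proof (rule Bochner_Integration.integrable_bound)
  show "integrable N (\<lambda>x. (f x)\<^sup>2 + (g x)\<^sup>2)"
    using f g by (auto simp: sq_integrable_def)
  show "(\<lambda>x. f x * g x) \<in> borel_measurable N"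
    using f g by (auto simp: sq_integrable_def)
  have "\<bar>u * v\<bar> \<le> u\<^sup>2 + v\<^sup>2" for u v :: real
  proof -
    have "0 \<le> \<bar>u\<bar> * \<bar>v\<bar>" by simp
    then show ?thesis
      using sum_squares_bound[of "\<bar>u\<bar>" "\<bar>v\<bar>"] unfolding power2_abs abs_mult by linarith
  qed
  then show "AE x in N. norm (f x * g x) \<le> norm ((f x)\<^sup>2 + (g x)\<^sup>2)"
    by (intro AE_I2) auto
qed

lemma sq_integrable_zero [simp]: "sq_integrable N (\<lambda>_. 0)"
  by (simp add: sq_integrable_def)

lemma sq_integrable_scale: "sq_integrable N f \<Longrightarrow> sq_integrable N (\<lambda>x. c * f x)"
  by (auto simp: sq_integrable_def power_mult_distrib)

lemma sq_integrable_add: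
  assumes f: "sq_integrable N f" and g: "sq_integrable N g"
  shows "sq_integrable N (\<lambda>x. f x + g x)"
  using assms sq_integrable_mult[OF assms]
  by (auto simp: sq_integrable_def power2_sum mult.assoc)

lemma sq_integrable_diff:
  assumes f: "sq_integrable N f" and g: "sq_integrable N g"
  shows "sq_integrable N (\<lambda>x. f x - g x)"
  using sq_integrable_add[OF f sq_integrable_scale[OF g, of "-1"]] by simp

lemma sq_integrable_sum:
  "(\<And>i. i \<in> I \<Longrightarrow> sq_integrable N (f i)) \<Longrightarrow> sq_integrable N (\<lambda>x. \<Sum>i\<in>I. f i x)"
  by (induction I rule: infinite_finite_induct) (auto intro: sq_integrable_add)

lemma sq_integrable_cong_AE:
  assumes "sq_integrable N f" "g \<in> borel_measurable N" "AE x in N. f x = g x"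
  shows "sq_integrable N g"
proof -
  have "integrable N (\<lambda>x. (g x)\<^sup>2)"
    using assms by (subst integrable_cong_AE[where g="\<lambda>x. (f x)\<^sup>2"]) (auto simp: sq_integrable_def)
  then show ?thesis using assms by (simp add: sq_integrable_def)
qed

lemma sq_integrable_bound:
  assumes "sq_integrable N f" "g \<in> borel_measurable N" "AE x in N. \<bar>g x\<bar> \<le> \<bar>f x\<bar>"
  shows "sq_integrable N g"
  unfolding sq_integrable_def
proof
  show "integrable N (\<lambda>x. (g x)\<^sup>2)"
  proof (rule Bochner_Integration.integrable_bound[OF sq_integrable_square[OF assms(1)]])
    show "(\<lambda>x. (g x)\<^sup>2) \<in> borel_measurable N" using assms(2) by simp
    show "AE x in N. norm ((g x)\<^sup>2) \<le> norm ((f x)\<^sup>2)"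
      using assms(3) by (simp add: abs_le_square_iff[symmetric])
  qed
qed fact

text \<open>Discriminant argument for the nonnegative binary form \<open>quad\<close>. The case of a
  vanishing leading coefficient is separate because the final division is by
  \<open>a\<close>.\<close>

lemma integral_Cauchy_Schwarz:
  assumes f: "sq_integrable N f" and g: "sq_integrable N g"
  shows "(\<integral>x. f x * g x \<partial>N)\<^sup>2 \<le> (\<integral>x. (f x)\<^sup>2 \<partial>N) * (\<integral>x. (g x)\<^sup>2 \<partial>N)"
proof -
  define a b c where "a = (\<integral>x. (f x)\<^sup>2 \<partial>N)" and "b = (\<integral>x. f x * g x \<partial>N)" and "c = (\<integral>x. (g x)\<^sup>2 \<partial>N)"
  note int = sq_integrable_square[OF f] sq_integrable_square[OF g] sq_integrable_mult[OF f g]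
  have quad: "0 \<le> s\<^sup>2 * a + 2 * s * t * b + t\<^sup>2 * c" for s t
  proof -
    have "0 \<le> (\<integral>x. (s * f x + t * g x)\<^sup>2 \<partial>N)"
      by (rule integral_nonneg_AE) simp
    also have "(\<lambda>x. (s * f x + t * g x)\<^sup>2) =
        (\<lambda>x. s\<^sup>2 * (f x)\<^sup>2 + 2 * s * t * (f x * g x) + t\<^sup>2 * (g x)\<^sup>2)"
      by (auto simp: power2_eq_square algebra_simps)
    also have "integral\<^sup>L N \<dots> = s\<^sup>2 * a + 2 * s * t * b + t\<^sup>2 * c"
      unfolding a_def b_def c_def using int by simp
    finally show ?thesis .
  qed
  have a: "0 \<le> a" and c: "0 \<le> c" unfolding a_def c_def by (auto intro: integral_nonneg_AE)
  have "b\<^sup>2 \<le> a * c"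
  proof (cases "a = 0")
    case True
    have "b = 0"
    proof (rule ccontr)
      assume "b \<noteq> 0"
      \<comment> \<open>With \<open>a = 0\<close> and \<open>t = 1\<close> the form is
        \<open>2 * s * b + c\<close>; this choice of \<open>s\<close> gives it the value -1.\<close>
      with quad[of "-(c + 1) / (2 * b)" 1] True c show False by (simp add: field_simps)
    qed
    then show ?thesis using True by simp
  next
    case False
    then have "a > 0" using a by simp
    have "0 \<le> a * (a * c - b\<^sup>2)" using quad[of "- b" a]
      by (simp add: power2_eq_square algebra_simps)
    then show ?thesis using \<open>a > 0\<close> by (simp add: zero_le_mult_iff)
  qed
  then show ?thesis by (simp add: a_def b_def c_def)
qed

text \<open>Square integrability of all terms and of the limit is built in, so the Bochner integral
  is a true squared distance and never the default value 0 of a non-integrable function.\<close>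

definition tends_L2 :: "'b measure \<Rightarrow> (nat \<Rightarrow> 'b \<Rightarrow> real) \<Rightarrow> ('b \<Rightarrow> real) \<Rightarrow> bool" where
  "tends_L2 N f g \<longleftrightarrow> (\<forall>l. sq_integrable N (f l)) \<and> sq_integrable N g \<and>
     (\<lambda>l. \<integral>x. (g x - f l x)\<^sup>2 \<partial>N) \<longlonglongrightarrow> 0"

lemma tends_L2_const: "sq_integrable N f \<Longrightarrow> tends_L2 N (\<lambda>_. f) f"
  by (simp add: tends_L2_def)

text \<open>Continuity of the inner product: in terms of the errors \<open>F\<close> and
  \<open>G\<close>, the product differs from its limit by three terms, each of which vanishes by
  Cauchy-Schwarz. The isometry and the martingale identities pass from step processes to general
  integrands through this lemma.\<close>

lemma tends_L2_inner:
  assumes f: "tends_L2 N f f'" and g: "tends_L2 N g g'"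
  shows "(\<lambda>l. \<integral>x. f l x * g l x \<partial>N) \<longlonglongrightarrow> (\<integral>x. f' x * g' x \<partial>N)"
proof -
  have sq: "sq_integrable N (f l)" "sq_integrable N (g l)" "sq_integrable N f'" "sq_integrable N g'" for l
    using f g by (auto simp: tends_L2_def)
  define F G where "F l x = f' x - f l x" and "G l x = g' x - g l x" for l x
  have sqd: "sq_integrable N (F l)" "sq_integrable N (G l)" for l
    unfolding F_def G_def by (intro sq_integrable_diff sq)+
  have F: "(\<lambda>l. \<integral>x. (F l x)\<^sup>2 \<partial>N) \<longlonglongrightarrow> 0" and G: "(\<lambda>l. \<integral>x. (G l x)\<^sup>2 \<partial>N) \<longlonglongrightarrow> 0"
    using f g by (auto simp: tends_L2_def F_def G_def)
  have CS: "(\<lambda>l. \<integral>x. u l x * v l x \<partial>N) \<longlonglongrightarrow> 0"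
    if "\<And>l. sq_integrable N (u l)" "\<And>l. sq_integrable N (v l)"
      "(\<lambda>l. (\<integral>x. (u l x)\<^sup>2 \<partial>N) * (\<integral>x. (v l x)\<^sup>2 \<partial>N)) \<longlonglongrightarrow> 0" for u v
  proof -
    have "(\<lambda>l. (\<integral>x. u l x * v l x \<partial>N)\<^sup>2) \<longlonglongrightarrow> 0"
      by (rule tendsto_sandwich[OF _ _ tendsto_const that(3)])
        (auto intro!: always_eventually integral_Cauchy_Schwarz that)
    from tendsto_real_sqrt[OF this] show ?thesis by (simp add: tendsto_rabs_zero_iff)
  qed
  have 1: "(\<lambda>l. \<integral>x. F l x * G l x \<partial>N) \<longlonglongrightarrow> 0"
    by (rule CS[OF sqd]) (use tendsto_mult[OF F G] in simp)
  have 2: "(\<lambda>l. \<integral>x. f' x * G l x \<partial>N) \<longlonglongrightarrow> 0"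
    by (rule CS[OF sq(3) sqd(2)]) (use tendsto_mult[OF tendsto_const G] in simp)
  have 3: "(\<lambda>l. \<integral>x. F l x * g' x \<partial>N) \<longlonglongrightarrow> 0"
    by (rule CS[OF sqd(1) sq(4)]) (use tendsto_mult[OF F tendsto_const] in simp)
  have "(\<lambda>l. (\<integral>x. F l x * G l x \<partial>N) - (\<integral>x. f' x * G l x \<partial>N) - (\<integral>x. F l x * g' x \<partial>N)
      + (\<integral>x. f' x * g' x \<partial>N)) \<longlonglongrightarrow> 0 - 0 - 0 + (\<integral>x. f' x * g' x \<partial>N)"
    by (intro tendsto_intros 1 2 3)
  moreover have "(\<integral>x. f l x * g l x \<partial>N) = (\<integral>x. F l x * G l x \<partial>N) - (\<integral>x. f' x * G l x \<partial>N)
      - (\<integral>x. F l x * g' x \<partial>N) + (\<integral>x. f' x * g' x \<partial>N)" for l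
  proof -
    have "(\<lambda>x. f l x * g l x) = (\<lambda>x. F l x * G l x - f' x * G l x - F l x * g' x + f' x * g' x)"
      by (auto simp: F_def G_def algebra_simps)
    then show ?thesis using sq sqd by (simp add: sq_integrable_mult)
  qed
  ultimately show ?thesis by simp
qed

lemma sq_integrable_bounded_mult:
  assumes "sq_integrable N f" "c \<in> borel_measurable N" "\<And>x. x \<in> space N \<Longrightarrow> \<bar>c x\<bar> \<le> B"
  shows "sq_integrable N (\<lambda>x. c x * f x)"
proof (rule sq_integrable_bound)
  show "sq_integrable N (\<lambda>x. B * f x)" using assms(1) by (rule sq_integrable_scale)
  show "(\<lambda>x. c x * f x) \<in> borel_measurable N" using assms by (auto simp: sq_integrable_def)
  show "AE x in N. \<bar>c x * f x\<bar> \<le> \<bar>B * f x\<bar>"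
    using assms(3) by (intro AE_I2) (force simp: abs_mult intro!: mult_right_mono)
qed

lemma (in finite_measure) sq_integrable_bounded:
  assumes "c \<in> borel_measurable M" "\<And>x. x \<in> space M \<Longrightarrow> \<bar>c x\<bar> \<le> B"
  shows "sq_integrable M c"
  using sq_integrable_bounded_mult[of M "\<lambda>_. 1" c B] assms by (simp add: sq_integrable_def)

lemma (in finite_measure) sq_integrable_integrable: "sq_integrable M f \<Longrightarrow> integrable M f"
  using sq_integrable_mult[of M f "\<lambda>_. 1"] by (simp add: sq_integrable_def)

text \<open>Fubini on the square, split along the diagonal. For two drift integrals this is
  integration by parts: each drift is paired with the running integral of the other.\<close>

lemma lborel_integral_product_triangle:
  fixes u v :: "real \<Rightarrow> real"
  assumes u: "integrable lborel u" and v: "integrable lborel v"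
  shows "(\<integral>s. u s \<partial>lborel) * (\<integral>r. v r \<partial>lborel) =
    (\<integral>s. u s * (\<integral>r. v r * indicator {..s} r \<partial>lborel) \<partial>lborel)
    + (\<integral>r. v r * (\<integral>s. u s * indicator {..r} s \<partial>lborel) \<partial>lborel)"
proof -
  have m[measurable]: "u \<in> borel_measurable borel" "v \<in> borel_measurable borel"
    using u v by auto
  have uv: "integrable (lborel \<Otimes>\<^sub>M lborel) (\<lambda>(s, r). u s * v r)"
  proof (rule lborel_pair.Fubini_integrable)
    show "integrable lborel (\<lambda>x. \<integral>y. norm (case (x, y) of (s, r) \<Rightarrow> u s * v r) \<partial>lborel)"
      using u by (simp add: abs_mult)
  qed (use v in auto)
  have uv1: "integrable (lborel \<Otimes>\<^sub>M lborel) (\<lambda>(s, r). u s * (v r * indicator {..s} r))"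
    by (rule Bochner_Integration.integrable_bound[OF uv])
      (simp add: indicator_def, auto simp: abs_mult split: split_indicator intro!: AE_I2)
  have uv2: "integrable (lborel \<Otimes>\<^sub>M lborel) (\<lambda>(s, r). v r * (u s * indicator {..<r} s))"
    by (rule Bochner_Integration.integrable_bound[OF uv])
      (simp add: indicator_def, auto simp: abs_mult split: split_indicator intro!: AE_I2)
  have "(\<integral>s. u s \<partial>lborel) * (\<integral>r. v r \<partial>lborel) = (\<integral>s. (\<integral>r. u s * v r \<partial>lborel) \<partial>lborel)"
    by simp
  also have "\<dots> = (\<integral>p. (case p of (s, r) \<Rightarrow> u s * v r) \<partial>(lborel \<Otimes>\<^sub>M lborel))"
    using lborel_pair.integral_fst'[OF uv] by simp
  also have "(\<lambda>p. case p of (s, r) \<Rightarrow> u s * v r) =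
      (\<lambda>p. (case p of (s, r) \<Rightarrow> u s * (v r * indicator {..s} r)) + (case p of (s, r) \<Rightarrow> v r * (u s * indicator {..<r} s)))"
    by (auto simp: fun_eq_iff split: split_indicator)
  also have "integral\<^sup>L (lborel \<Otimes>\<^sub>M lborel) \<dots> =
      (\<integral>s. (\<integral>r. u s * (v r * indicator {..s} r) \<partial>lborel) \<partial>lborel)
      + (\<integral>r. (\<integral>s. v r * (u s * indicator {..<r} s) \<partial>lborel) \<partial>lborel)"
    using lborel_pair.integral_fst'[OF uv1] lborel_pair.integral_snd[OF uv2]
      Bochner_Integration.integral_add[OF uv1 uv2] by simp
  \<comment> \<open>The split gives the diagonal to the first triangle. Closing the second one adds
    a single point to each section, a null set.\<close>
  also have "(\<integral>s. u s * indicator {..<r} s \<partial>lborel) = (\<integral>s. u s * indicator {..r} s \<partial>lborel)" for r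
    using AE_lborel_singleton[of r]
    by (intro integral_cong_AE) (auto simp: indicator_def elim!: eventually_mono)
  ultimately show ?thesis by simp
qed

text \<open>The process on \<open>[0, T]\<close>, extended by 0 to a function on the whole product
  space. The arguments are swapped so that sample points come first, matching the order of the
  product measure.\<close>

definition cutoff :: "real \<Rightarrow> (real \<Rightarrow> 'a \<Rightarrow> real) \<Rightarrow> 'a \<times> real \<Rightarrow> real" where
  "cutoff T f p = f (snd p) (fst p) * indicator {0..T} (snd p)"

lemma cutoff_Pair [simp]: "cutoff T f (w, s) = f s w * indicator {0..T} s"
  by (simp add: cutoff_def)

lemma integrable_indicator_Icc: "integrable lborel (indicator {a..b} :: real \<Rightarrow> real)"
  by (rule integrable_real_indicator) (simp_all add: emeasure_lborel_Icc_eq)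

lemma
  fixes c :: "'i \<Rightarrow> real" and f :: "'i \<Rightarrow> 'b \<Rightarrow> real"
  assumes "\<And>k. k \<in> I \<Longrightarrow> integrable N (f k)"
  shows integrable_linear_combination: "integrable N (\<lambda>p. \<Sum>k\<in>I. c k * f k p)"
    and integral_linear_combination: "(\<integral>p. (\<Sum>k\<in>I. c k * f k p) \<partial>N) = (\<Sum>k\<in>I. c k * (\<integral>p. f k p \<partial>N))"
  using assms by (auto simp: Bochner_Integration.integral_sum)

text \<open>Translates the limits in \<open>[0, \<infinity>]\<close> used to define the Ito
  integral. The limit is square-integrable because at some index the squared distance is below 1,
  hence finite, and \<open>g\<close> is that difference plus \<open>f l\<close>.\<close>

lemma tends_L2I:
  assumes f: "\<And>l. sq_integrable N (f l)" and g: "g \<in> borel_measurable N"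
    and lim: "(\<lambda>l. \<integral>\<^sup>+x. ennreal ((g x - f l x)\<^sup>2) \<partial>N) \<longlonglongrightarrow> 0"
  shows "tends_L2 N f g"
proof -
  have "eventually (\<lambda>l. (\<integral>\<^sup>+x. ennreal ((g x - f l x)\<^sup>2) \<partial>N) < 1) sequentially"
    using lim by (rule order_tendstoD) simp
  then obtain l where l: "(\<integral>\<^sup>+x. ennreal ((g x - f l x)\<^sup>2) \<partial>N) < 1"
    by (auto simp: eventually_sequentially)
  have fm: "f l \<in> borel_measurable N" for l using f by (simp add: sq_integrable_def)
  have "(\<integral>\<^sup>+x. ennreal ((g x - f l x)\<^sup>2) \<partial>N) < \<infinity>"
    by (rule less_trans[OF l]) simp
  then have "integrable N (\<lambda>x. (g x - f l x)\<^sup>2)"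
    using g fm by (intro integrableI_nonneg) auto
  then have "sq_integrable N (\<lambda>x. g x - f l x)" using g fm by (simp add: sq_integrable_def)
  from sq_integrable_add[OF this f[of l]] have g2: "sq_integrable N g" by simp
  have "(\<integral>\<^sup>+x. ennreal ((g x - f l x)\<^sup>2) \<partial>N) = ennreal (\<integral>x. (g x - f l x)\<^sup>2 \<partial>N)" for l
    by (intro nn_integral_eq_integral sq_integrable_square sq_integrable_diff g2 f) simp
  with lim have "(\<lambda>l. ennreal (\<integral>x. (g x - f l x)\<^sup>2 \<partial>N)) \<longlonglongrightarrow> ennreal 0" by simp
  then have "(\<lambda>l. \<integral>x. (g x - f l x)\<^sup>2 \<partial>N) \<longlonglongrightarrow> 0"
    by (subst (asm) tendsto_ennreal_iff) (auto intro!: always_eventually integral_nonneg_AE)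
  then show ?thesis using f g2 by (simp add: tends_L2_def)
qed

lemma tends_L2_cong:
  assumes "tends_L2 N f g" "\<And>x. x \<in> space N \<Longrightarrow> g x = h x"
  shows "tends_L2 N f h"
proof -
  have "(\<integral>x. (h x - f l x)\<^sup>2 \<partial>N) = (\<integral>x. (g x - f l x)\<^sup>2 \<partial>N)" for l
    by (rule Bochner_Integration.integral_cong) (simp_all add: assms(2))
  moreover have "sq_integrable N g \<longleftrightarrow> sq_integrable N h"
    unfolding sq_integrable_def
    by (intro conj_cong measurable_cong Bochner_Integration.integrable_cong) (simp_all add: assms(2))
  ultimately show ?thesis using assms(1) by (simp add: tends_L2_def)
qed

section \<open>Bilinear forms\<close>

lemma sum_swap3:
  "(\<Sum>i\<in>A. \<Sum>j\<in>B. \<Sum>k\<in>C. f i j k) = (\<Sum>k\<in>C. \<Sum>i\<in>A. \<Sum>j\<in>B. f i j k)"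
proof -
  have "(\<Sum>j\<in>B. \<Sum>k\<in>C. f i j k) = (\<Sum>k\<in>C. \<Sum>j\<in>B. f i j k)" for i by (rule sum.swap)
  then have "(\<Sum>i\<in>A. \<Sum>j\<in>B. \<Sum>k\<in>C. f i j k) = (\<Sum>i\<in>A. \<Sum>k\<in>C. \<Sum>j\<in>B. f i j k)" by simp
  also have "\<dots> = (\<Sum>k\<in>C. \<Sum>i\<in>A. \<Sum>j\<in>B. f i j k)" by (rule sum.swap)
  finally show ?thesis .
qed

lemma sum_swap4:
  "(\<Sum>i\<in>A. \<Sum>j\<in>B. \<Sum>k\<in>C. \<Sum>l\<in>D. f i j k l) = (\<Sum>k\<in>C. \<Sum>l\<in>D. \<Sum>i\<in>A. \<Sum>j\<in>B. f i j k l)"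
  unfolding sum_swap3[where C=C] by (rule sum.cong[OF refl]) (rule sum_swap3)

lemma quadratic_form_sum:
  fixes P :: "real mat"
  assumes "P \<in> carrier_mat n n" "u \<in> carrier_vec n"
  shows "u \<bullet> (P *\<^sub>v u) = (\<Sum>i = 0..<n. \<Sum>j = 0..<n. P $$ (i, j) * (u $ i * u $ j))"
  using assms by (auto simp: scalar_prod_def sum_distrib_left mult.left_commute intro!: sum.cong)

text \<open>The right-hand side has exactly the shape in which \<open>bilinear_moment_eq\<close>
  produces the coefficients of the accumulated moments.\<close>

lemma lyapunov_operator_index:
  assumes "G \<in> carrier_mat n n" "A \<in> carrier_mat n n" "C \<in> carrier_mat n n" "k < n" "l < n"
  shows "(G * A + transpose_mat A * G + transpose_mat C * G * C) $$ (k, l) =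
    (\<Sum>i = 0..<n. A $$ (i, k) * G $$ (i, l)) + (\<Sum>j = 0..<n. G $$ (k, j) * A $$ (j, l))
       + (\<Sum>i = 0..<n. \<Sum>j = 0..<n. C $$ (i, k) * G $$ (i, j) * C $$ (j, l))"
proof -
  have "(transpose_mat C * G * C) $$ (k, l) = (\<Sum>i = 0..<n. \<Sum>j = 0..<n. C $$ (i, k) * G $$ (i, j) * C $$ (j, l))"
    using assms by (auto simp: scalar_prod_def sum_distrib_left mult.assoc intro!: sum.cong)
  moreover have "(G * A) $$ (k, l) = (\<Sum>j = 0..<n. G $$ (k, j) * A $$ (j, l))"
    "(transpose_mat A * G) $$ (k, l) = (\<Sum>i = 0..<n. A $$ (i, k) * G $$ (i, l))"
    using assms by (auto simp: scalar_prod_def intro!: sum.cong)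
  ultimately show ?thesis using assms by (simp add: add.commute)
qed

section \<open>The Ito integral and the product formula\<close>

context wiener_process
begin

interpretation MB: pair_sigma_finite M lborel ..

section \<open>Moments of Wiener increments\<close>

lemma F_measurable_M: "f \<in> borel_measurable (F t) \<Longrightarrow> f \<in> borel_measurable M"
  using subalgebra_F measurable_from_subalg by blast

lemma F_measurable_mono: "f \<in> borel_measurable (F s) \<Longrightarrow> s \<le> t \<Longrightarrow> f \<in> borel_measurable (F t)"
  using sets_F_mono[of s t] space_F by (metis measurable_from_subalg subalgebra_def)

lemma W_measurable: "0 \<le> t \<Longrightarrow> W t \<in> borel_measurable M"
  using adapted F_measurable_M by blast

lemma
  assumes "0 \<le> s" "s \<le> t"
  shows sq_integrable_increment: "sq_integrable M (\<lambda>w. W t w - W s w)"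
    and expectation_increment: "expectation (\<lambda>w. W t w - W s w) = 0"
    and expectation_increment_square: "expectation (\<lambda>w. (W t w - W s w)\<^sup>2) = t - s"
proof -
  let ?D = "\<lambda>w. W t w - W s w"
  have "sq_integrable M ?D \<and> expectation ?D = 0 \<and> expectation (\<lambda>w. (?D w)\<^sup>2) = t - s"
  proof (cases "s = t")
    case False
    then have st: "s < t" using assms by simp
    have D: "distributed M lborel ?D (normal_density 0 (sqrt (t - s)))"
      by (rule normal_increments[OF assms(1) st])
    have pos: "0 < sqrt (t - s)" using st by simp
    have m: "?D \<in> borel_measurable M" using W_measurable assms by simp
    have "integrable lborel (\<lambda>x. normal_density 0 (sqrt (t - s)) x * x\<^sup>2)"
      using integrable_normal_moment[OF pos, of 0 2] by simp
    then have int: "integrable M (\<lambda>w. (?D w)\<^sup>2)"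
      using distributed_integrable[OF D, of "\<lambda>x. x\<^sup>2"] by simp
    have E: "expectation ?D = 0" using normal_distributed_expectation[OF pos D] .
    have "variance ?D = (sqrt (t - s))\<^sup>2" using normal_distributed_variance[OF pos D] .
    then have "expectation (\<lambda>w. (?D w)\<^sup>2) = t - s" using E st by simp
    then show ?thesis using m int E unfolding sq_integrable_def by blast
  qed simp
  then show "sq_integrable M ?D" "expectation ?D = 0" "expectation (\<lambda>w. (?D w)\<^sup>2) = t - s" by auto
qed

text \<open>\<open>indep_var\<close> speaks of generated sigma-algebras. The preimages under the
  increment already form one, and the one generated by \<open>Y\<close> lies inside
  \<open>F s\<close>, so the independence axiom applies directly.\<close>

lemma indep_var_increment:
  assumes "0 \<le> s" "s < t" "Y \<in> borel_measurable (F s)"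
  shows "indep_var borel Y borel (\<lambda>w. W t w - W s w)"
proof -
  let ?D = "\<lambda>w. W t w - W s w"
  have m: "?D \<in> borel_measurable M" "Y \<in> borel_measurable M"
    using W_measurable assms F_measurable_M by auto
  have "{Y -` U \<inter> space M | U. U \<in> sets borel} \<subseteq> sets (F s)"
    using measurable_sets[OF assms(3)] by (auto simp: space_F)
  then have Y: "sigma_sets (space M) {Y -` U \<inter> space M | U. U \<in> sets borel} \<subseteq> sets (F s)"
    using sets.sigma_sets_subset[of _ "F s"] by (simp add: space_F)
  have "sigma_sets (space M) {?D -` U \<inter> space M | U. U \<in> sets borel} = sets (vimage_algebra (space M) ?D borel)"
    by (simp add: sets_vimage_algebra)
  also have "\<dots> = {?D -` U \<inter> space M | U. U \<in> sets borel}"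
    by (rule sets_vimage_algebra2) simp
  finally have D: "sigma_sets (space M) {?D -` U \<inter> space M | U. U \<in> sets borel}
      = {?D -` U \<inter> space M | U. U \<in> sets borel}" .
  have "indep_set (sigma_sets (space M) {Y -` U \<inter> space M | U. U \<in> sets borel})
      (sigma_sets (space M) {?D -` U \<inter> space M | U. U \<in> sets borel})"
    unfolding D indep_set_def
    by (rule indep_sets_mono_sets[OF indep_increments[OF assms(1,2), unfolded indep_set_def]])
      (use Y in \<open>simp split: bool.splits\<close>)
  then show ?thesis
    using m unfolding indep_var_eq by blast
qed

text \<open>Independence factors both expectations, and the increment has mean 0 and second moment
  \<open>t - s\<close>. The first identity yields the martingale property, the second the
  isometry.\<close>

lemma
  assumes "0 \<le> s" "s \<le> t" "Y \<in> borel_measurable (F s)" "integrable M Y"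
  shows integrable_mult_increment: "integrable M (\<lambda>w. Y w * (W t w - W s w))"
    and expectation_mult_increment: "expectation (\<lambda>w. Y w * (W t w - W s w)) = 0"
    and integrable_mult_increment_square: "integrable M (\<lambda>w. Y w * (W t w - W s w)\<^sup>2)"
    and expectation_mult_increment_square:
      "expectation (\<lambda>w. Y w * (W t w - W s w)\<^sup>2) = expectation Y * (t - s)"
proof -
  let ?D = "\<lambda>w. W t w - W s w"
  note D = sq_integrable_increment[OF assms(1,2)] expectation_increment[OF assms(1,2)]
    expectation_increment_square[OF assms(1,2)]
  have int1: "integrable M ?D"
    using sq_integrable_mult[OF D(1), of "\<lambda>_. 1"] by (simp add: sq_integrable_def)
  have int2: "integrable M (\<lambda>w. (?D w)\<^sup>2)" using D(1) by (rule sq_integrable_square)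
  have "integrable M (\<lambda>w. Y w * ?D w) \<and> expectation (\<lambda>w. Y w * ?D w) = 0 \<and>
    integrable M (\<lambda>w. Y w * (?D w)\<^sup>2) \<and> expectation (\<lambda>w. Y w * (?D w)\<^sup>2) = expectation Y * (t - s)"
  proof (cases "s = t")
    case False
    then have st: "s < t" using assms by simp
    have ind: "indep_var borel Y borel ?D" by (rule indep_var_increment[OF assms(1) st assms(3)])
    have ind2: "indep_var borel Y borel (\<lambda>w. (?D w)\<^sup>2)"
      using indep_var_compose[OF ind measurable_id, of "\<lambda>x. x\<^sup>2" borel] by (simp add: comp_def)
    show ?thesis
      by (intro conjI indep_var_integrable[OF ind assms(4) int1] indep_var_integrable[OF ind2 assms(4) int2])
        (simp_all add: D indep_var_lebesgue_integral[OF ind assms(4) int1] indep_var_lebesgue_integral[OF ind2 assms(4) int2])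
  qed simp
  then show "integrable M (\<lambda>w. Y w * ?D w)" "expectation (\<lambda>w. Y w * ?D w) = 0"
    "integrable M (\<lambda>w. Y w * (?D w)\<^sup>2)" "expectation (\<lambda>w. Y w * (?D w)\<^sup>2) = expectation Y * (t - s)"
    by auto
qed

text \<open>The isometry for a pair of single terms whose intervals may overlap arbitrarily, the
  first starting no later than the second. If the intervals are disjoint, the later increment is
  independent of all other factors.\<close>

lemma expectation_increments_mult_aux:
  assumes ab: "0 \<le> a" "a \<le> b" and cd: "c \<le> d" and ac: "a \<le> c"
    and \<xi>: "\<xi> \<in> borel_measurable (F a)" "\<And>w. w \<in> space M \<Longrightarrow> \<bar>\<xi> w\<bar> \<le> B"
    and \<eta>: "\<eta> \<in> borel_measurable (F c)" "\<And>w. w \<in> space M \<Longrightarrow> \<bar>\<eta> w\<bar> \<le> B'"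
  shows "expectation (\<lambda>w. (\<xi> w * (W b w - W a w)) * (\<eta> w * (W d w - W c w)))
    = expectation (\<lambda>w. \<xi> w * \<eta> w) * measure lborel ({a<..b} \<inter> {c<..d})"
proof -
  have c0: "0 \<le> c" using ab ac by simp
  have \<xi>c: "\<xi> \<in> borel_measurable (F c)" using F_measurable_mono[OF \<xi>(1) ac] .
  define z where "z w = \<xi> w * \<eta> w" for w
  have zc: "z \<in> borel_measurable (F c)" unfolding z_def using \<xi>c \<eta>(1) by simp
  have zM: "z \<in> borel_measurable M" using F_measurable_M zc by blast
  have zB: "\<bar>z w\<bar> \<le> B * B'" if "w \<in> space M" for w
    unfolding z_def abs_mult using \<xi>(2)[OF that] \<eta>(2)[OF that] by (intro mult_mono') auto
  have zint: "integrable M z" by (rule sq_integrable_integrable[OF sq_integrable_bounded[OF zM zB]])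
  have incr: "integrable M (\<lambda>w. z w * (W t w - W s w))" if "0 \<le> s" "s \<le> t" for s t
    by (rule sq_integrable_integrable[OF sq_integrable_bounded_mult[OF sq_integrable_increment[OF that] zM zB]])
  have W: "W t \<in> borel_measurable (F s)" if "0 \<le> t" "t \<le> s" for s t
    using F_measurable_mono[OF adapted] that by blast
  show ?thesis
  proof (cases "b \<le> c")
    case True
    let ?Y = "\<lambda>w. z w * (W b w - W a w)"
    have "?Y \<in> borel_measurable (F c)" using zc W[of b c] W[of a c] ab ac True by simp
    from expectation_mult_increment[OF c0 cd this incr[OF ab]]
    have "expectation (\<lambda>w. ?Y w * (W d w - W c w)) = 0" .
    moreover have "{a<..b} \<inter> {c<..d} = {}" using True by auto
    ultimately show ?thesis by (simp only: z_def measure_empty mult_zero_right mult_ac)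
  next
    case False
    then have cb: "c \<le> b" by simp
    \<comment> \<open>\<open>{c<..e}\<close> is the overlap of the two intervals, whichever of them
      ends first.\<close>
    define e where "e = min b d"
    have e: "c \<le> e" "0 \<le> e" "e \<le> b" "e \<le> d" using cb cd c0 by (auto simp: e_def)
    let ?Y1 = "\<lambda>w. z w * (W c w - W a w)" and ?Y2 = "\<lambda>w. z w * (W e w - W c w)"
    have m1: "?Y1 \<in> borel_measurable (F c)" using zc W[of c c] W[of a c] ab ac by simp
    have m2: "?Y2 \<in> borel_measurable (F e)"
      using F_measurable_mono[OF zc e(1)] W[of c e] W[of e e] c0 e by simp
    \<comment> \<open>Splitting at the ends of the overlap leaves a square over the overlap and two
      products whose later increment is independent of the other factors. Only the square
      contributes to the expectation.\<close>
    have A: "(\<xi> w * (W b w - W a w)) * (\<eta> w * (W d w - W c w)) =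
      ?Y1 w * (W d w - W c w) + (z w * (W e w - W c w)\<^sup>2
        + ?Y2 w * (W (max b d) w - W e w))" for w
      unfolding z_def e_def by (cases "b \<le> d") (auto simp: max_def min_def power2_eq_square algebra_simps)
    have em: "e \<le> max b d" by (auto simp: e_def)
    note E = expectation_mult_increment[OF c0 cd m1 incr[OF ab(1) ac]]
      expectation_mult_increment[OF e(2) em m2 incr[OF c0 e(1)]]
      expectation_mult_increment_square[OF c0 e(1) zc zint]
    note I = integrable_mult_increment[OF c0 cd m1 incr[OF ab(1) ac]]
      integrable_mult_increment[OF e(2) em m2 incr[OF c0 e(1)]]
      integrable_mult_increment_square[OF c0 e(1) zc zint]
    have "expectation (\<lambda>w. (\<xi> w * (W b w - W a w)) * (\<eta> w * (W d w - W c w))) = expectation z * (e - c)"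
      unfolding A by (simp only: Bochner_Integration.integral_add Bochner_Integration.integrable_add I E add_0_left add_0_right)
    moreover have "{a<..b} \<inter> {c<..d} = {c<..e}" using ac by (auto simp: e_def)
    ultimately show ?thesis using e by (simp add: z_def[abs_def])
  qed
qed

lemma expectation_increments_mult:
  assumes ab: "0 \<le> a" "a \<le> b" and cd: "0 \<le> c" "c \<le> d"
    and \<xi>: "\<xi> \<in> borel_measurable (F a)" "\<And>w. w \<in> space M \<Longrightarrow> \<bar>\<xi> w\<bar> \<le> B"
    and \<eta>: "\<eta> \<in> borel_measurable (F c)" "\<And>w. w \<in> space M \<Longrightarrow> \<bar>\<eta> w\<bar> \<le> B'"
  shows "expectation (\<lambda>w. (\<xi> w * (W b w - W a w)) * (\<eta> w * (W d w - W c w)))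
    = expectation (\<lambda>w. \<xi> w * \<eta> w) * measure lborel ({a<..b} \<inter> {c<..d})"
proof (cases "a \<le> c")
  case True
  show ?thesis by (rule expectation_increments_mult_aux[OF ab cd(2) True \<xi> \<eta>])
next
  case False
  then have "c \<le> a" by simp
  from expectation_increments_mult_aux[OF cd ab(2) this \<eta> \<xi>]
  show ?thesis by (simp add: mult_ac Int_commute)
qed

section \<open>Step processes: isometry and stopping\<close>

text \<open>A step process, as a function on \<open>\<Omega> \<times> \<real>\<close>, together with its stochastic integral.\<close>

inductive step_pair :: "('a \<times> real \<Rightarrow> real) \<Rightarrow> ('a \<Rightarrow> real) \<Rightarrow> bool" where
  zero: "step_pair (\<lambda>_. 0) (\<lambda>_. 0)"
| add: "step_pair \<phi> I \<Longrightarrow> 0 \<le> a \<Longrightarrow> a \<le> b \<Longrightarrow> \<xi> \<in> borel_measurable (F a) \<Longrightarrow>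
    (\<And>w. w \<in> space M \<Longrightarrow> \<bar>\<xi> w\<bar> \<le> B) \<Longrightarrow>
    step_pair (\<lambda>p. \<phi> p + \<xi> (fst p) * indicator {a<..b} (snd p)) (\<lambda>w. I w + \<xi> w * (W b w - W a w))"

lemma sq_integrable_term:
  assumes "\<xi> \<in> borel_measurable M" "\<And>w. w \<in> space M \<Longrightarrow> \<bar>\<xi> w\<bar> \<le> B" 
  shows "sq_integrable (M \<Otimes>\<^sub>M lborel) (\<lambda>p. \<xi> (fst p) * indicator {a<..b::real} (snd p))"
proof (rule sq_integrable_bounded_mult)
  have fin: "emeasure (M \<Otimes>\<^sub>M lborel) (space M \<times> {a<..b}) < \<infinity>"
    by (cases "a \<le> b") (simp_all add: lborel.emeasure_pair_measure_Times emeasure_space_1)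
  have m: "(\<lambda>p. indicator {a<..b} (snd p) :: real) \<in> borel_measurable (M \<Otimes>\<^sub>M lborel)" by measurable
  have "integrable (M \<Otimes>\<^sub>M lborel) (\<lambda>p. indicator {a<..b} (snd p) :: real)"
    by (rule integrableI_bounded_set[where A="space M \<times> {a<..b}" and B=1])
      (use m fin in \<open>auto simp: space_pair_measure intro!: AE_I2 pair_measureI split: split_indicator\<close>)
  moreover have "(indicator {a<..b} x)\<^sup>2 = (indicator {a<..b} x :: real)" for x
    by (auto split: split_indicator)
  ultimately show "sq_integrable (M \<Otimes>\<^sub>M lborel) (\<lambda>p. indicator {a<..b} (snd p) :: real)"
    using m by (simp add: sq_integrable_def)
  show "(\<lambda>p. \<xi> (fst p)) \<in> borel_measurable (M \<Otimes>\<^sub>M lborel)" using assms(1) by measurable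
  show "\<And>p. p \<in> space (M \<Otimes>\<^sub>M lborel) \<Longrightarrow> \<bar>\<xi> (fst p)\<bar> \<le> B" using assms(2) by (auto simp: space_pair_measure)
qed

lemma sq_integrable_mult_bounded_increment:
  assumes "0 \<le> a" "a \<le> b" "\<xi> \<in> borel_measurable (F a)" "\<And>w. w \<in> space M \<Longrightarrow> \<bar>\<xi> w\<bar> \<le> B"
  shows "sq_integrable M (\<lambda>w. \<xi> w * (W b w - W a w))"
  by (rule sq_integrable_bounded_mult[OF sq_integrable_increment])
    (use assms F_measurable_M in auto)

lemma step_pair_sq_integrable:
  assumes "step_pair \<phi> I"
  shows "sq_integrable (M \<Otimes>\<^sub>M lborel) \<phi>" "sq_integrable M I"
  using assms
  by (induction, auto intro!: sq_integrable_add sq_integrable_term sq_integrable_mult_bounded_increment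
      intro: F_measurable_M)

lemma integral_terms_mult:
  assumes \<xi>: "\<xi> \<in> borel_measurable M" "\<And>w. w \<in> space M \<Longrightarrow> \<bar>\<xi> w\<bar> \<le> B"
    and \<eta>: "\<eta> \<in> borel_measurable M" "\<And>w. w \<in> space M \<Longrightarrow> \<bar>\<eta> w\<bar> \<le> B'"
  shows "(\<integral>p. (\<xi> (fst p) * indicator {a<..b} (snd p)) * (\<eta> (fst p) * indicator {c<..d::real} (snd p)) \<partial>(M \<Otimes>\<^sub>M lborel))
    = expectation (\<lambda>w. \<xi> w * \<eta> w) * measure lborel ({a<..b} \<inter> {c<..d})"
proof -
  have eq: "(\<xi> (fst p) * indicator {a<..b} (snd p)) * (\<eta> (fst p) * indicator {c<..d} (snd p))
    = (\<xi> (fst p) * \<eta> (fst p)) * indicator ({a<..b} \<inter> {c<..d}) (snd p)" for p :: "'a \<times> real"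
    by (simp split: split_indicator)
  have "integrable (M \<Otimes>\<^sub>M lborel) (\<lambda>p. (\<xi> (fst p) * indicator {a<..b} (snd p)) * (\<eta> (fst p) * indicator {c<..d} (snd p)))"
    by (rule sq_integrable_mult[OF sq_integrable_term[OF \<xi>] sq_integrable_term[OF \<eta>]])
  from MB.integral_fst'[OF this] show ?thesis
    unfolding eq by simp
qed

text \<open>Induction on each argument in turn: \<open>one\<close> treats a single term against all
  of \<open>J\<close>, and the outer induction adds up the terms of \<open>I\<close>. Since
  \<open>expectation_increments_mult\<close> allows any two intervals, the two step processes can be
  compared without a common refinement of their nodes.\<close>

lemma step_pair_isometry:
  assumes "step_pair \<phi> I" "step_pair \<psi> J"
  shows "expectation (\<lambda>w. I w * J w) = (\<integral>p. \<phi> p * \<psi> p \<partial>(M \<Otimes>\<^sub>M lborel))"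
proof -
  have one: "expectation (\<lambda>w. (\<xi> w * (W b w - W a w)) * J w) =
      (\<integral>p. (\<xi> (fst p) * indicator {a<..b} (snd p)) * \<psi> p \<partial>(M \<Otimes>\<^sub>M lborel))"
    if ab: "0 \<le> a" "a \<le> b" and \<xi>: "\<xi> \<in> borel_measurable (F a)" "\<And>w. w \<in> space M \<Longrightarrow> \<bar>\<xi> w\<bar> \<le> B"
    for a b \<xi> B
    using assms(2)
  proof induction
    case (add \<psi> J c d \<eta> B')
    note sq = step_pair_sq_integrable[OF add(1)]
    note t1 = sq_integrable_term[OF F_measurable_M[OF \<xi>(1)] \<xi>(2)]
    note t2 = sq_integrable_term[OF F_measurable_M[OF add(4)] add(5)]
    note i1 = sq_integrable_mult_bounded_increment[OF ab \<xi>]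
    note i2 = sq_integrable_mult_bounded_increment[OF add(2-5)]
    show ?case
      unfolding distrib_left
      using sq_integrable_mult[OF i1 sq(2)] sq_integrable_mult[OF i1 i2]
        sq_integrable_mult[OF t1 sq(1)] sq_integrable_mult[OF t1 t2]
      by (subst (1 2) Bochner_Integration.integral_add)
        (simp_all only: add(6) expectation_increments_mult[OF ab add(2,3) \<xi> add(4,5)]
          integral_terms_mult[OF F_measurable_M[OF \<xi>(1)] \<xi>(2) F_measurable_M[OF add(4)] add(5)])
  qed simp
  note sqJ = step_pair_sq_integrable[OF assms(2)]
  show ?thesis
    using assms(1)
  proof induction
    case (add \<phi> I a b \<xi> B)
    note sq = step_pair_sq_integrable[OF add(1)]
    note t = sq_integrable_term[OF F_measurable_M[OF add(4)] add(5)]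
    note i = sq_integrable_mult_bounded_increment[OF add(2-5)]
    show ?case
      unfolding distrib_right
      using sq_integrable_mult[OF i sqJ(2)] sq_integrable_mult[OF sq(2) sqJ(2)]
        sq_integrable_mult[OF t sqJ(1)] sq_integrable_mult[OF sq(1) sqJ(1)]
      by (subst (1 2) Bochner_Integration.integral_add) (simp_all only: add(6) one[OF add(2-5)])
  qed simp
qed

lemma step_pair_expectation: "step_pair \<phi> I \<Longrightarrow> expectation I = 0"
proof (induction rule: step_pair.induct)
  case (add \<phi> I a b \<xi> B)
  have "integrable M \<xi>"
    by (rule sq_integrable_integrable[OF sq_integrable_bounded[OF F_measurable_M[OF add(4)] add(5)]])
  from integrable_mult_increment[OF add(2-4) this] expectation_mult_increment[OF add(2-4) this]
    sq_integrable_integrable[OF step_pair_sq_integrable(2)[OF add(1)]] add(6)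
  show ?case by simp
qed simp

text \<open>The martingale property in weak form. Truncating every term at \<open>s\<close> discards
  increments that start at or after \<open>s\<close>, and these are orthogonal to whatever is known
  at time \<open>s\<close>. One \<open>I'\<close> serves all test variables
  \<open>Y\<close>.\<close>

lemma step_pair_stopped:
  assumes "step_pair \<phi> I" "0 \<le> s"
  shows "\<exists>I'. step_pair (\<lambda>p. \<phi> p * indicator {0..s} (snd p)) I' \<and>
    (\<forall>Y. Y \<in> borel_measurable (F s) \<longrightarrow> sq_integrable M Y \<longrightarrow>
      expectation (\<lambda>w. Y w * I w) = expectation (\<lambda>w. Y w * I' w))"
  using assms(1)
proof induction
  case zero
  show ?case using step_pair.zero by (intro exI[of _ "\<lambda>_. 0"]) simp
next
  case (add \<phi> I a b \<xi> B)
  then obtain I' where I': "step_pair (\<lambda>p. \<phi> p * indicator {0..s} (snd p)) I'"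
    "\<And>Y. Y \<in> borel_measurable (F s) \<Longrightarrow> sq_integrable M Y \<Longrightarrow>
      expectation (\<lambda>w. Y w * I w) = expectation (\<lambda>w. Y w * I' w)" by blast
  have orth: "expectation (\<lambda>w. Y w * (\<xi> w * (W t w - W r w))) = 0"
    if "0 \<le> r" "a \<le> r" "s \<le> r" "r \<le> t" "Y \<in> borel_measurable (F s)" "sq_integrable M Y" for Y r t
  proof -
    have 1: "(\<lambda>w. Y w * \<xi> w) \<in> borel_measurable (F r)"
      using F_measurable_mono that add(4) by (intro borel_measurable_times) blast+
    have 2: "integrable M (\<lambda>w. Y w * \<xi> w)"
      by (rule sq_integrable_mult[OF that(6) sq_integrable_bounded[OF F_measurable_M[OF add(4)] add(5)]])
    from expectation_mult_increment[OF that(1,4) 1 2] show ?thesis by (simp add: mult.assoc)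
  qed
  note sq = step_pair_sq_integrable(2)[OF add(1)] step_pair_sq_integrable(2)[OF I'(1)]
  show ?case
  proof (cases "s < a")
    \<comment> \<open>The new term lies entirely beyond \<open>s\<close>: it drops out of the
      stopped integrand and pairs to 0 with \<open>Y\<close>, so the previous \<open>I'\<close> is
      kept.\<close>
    case True
    have "(\<lambda>p. (\<phi> p + \<xi> (fst p) * indicator {a<..b} (snd p)) * indicator {0..s} (snd p)) =
      (\<lambda>p. \<phi> p * indicator {0..s} (snd p))"
      using True by (auto split: split_indicator)
    moreover have "expectation (\<lambda>w. Y w * (I w + \<xi> w * (W b w - W a w))) = expectation (\<lambda>w. Y w * I' w)"
      if Y: "Y \<in> borel_measurable (F s)" "sq_integrable M Y" for Y
      unfolding distrib_left
      using sq_integrable_mult[OF Y(2) sq(1)] orth[of a b, OF _ _ _ _ Y] add(2,3) True I'(2)[OF Y]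
        sq_integrable_mult[OF Y(2) sq_integrable_mult_bounded_increment[OF add(2-5)]]
      by (subst Bochner_Integration.integral_add) auto
    ultimately show ?thesis using I'(1) by auto
  next
    case False
    \<comment> \<open>The stopped term lives on \<open>(a, e]\<close>. If the discarded interval
      \<open>(e, b]\<close> is nonempty, then \<open>e = s\<close>, so its increment starts late
      enough for \<open>orth\<close>.\<close>
    define e where "e = min b s"
    have e: "a \<le> e" "0 \<le> e" "e \<le> b" "e \<le> s" "e < b \<Longrightarrow> s \<le> e" using False add(2,3) by (auto simp: e_def)
    have "(\<lambda>p. (\<phi> p + \<xi> (fst p) * indicator {a<..b} (snd p)) * indicator {0..s} (snd p)) =
      (\<lambda>p. \<phi> p * indicator {0..s} (snd p) + \<xi> (fst p) * indicator {a<..e} (snd p))"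
      using add(2) by (auto split: split_indicator simp: e_def)
    moreover have "expectation (\<lambda>w. Y w * (I w + \<xi> w * (W b w - W a w))) =
        expectation (\<lambda>w. Y w * (I' w + \<xi> w * (W e w - W a w)))"
      if Y: "Y \<in> borel_measurable (F s)" "sq_integrable M Y" for Y
    proof -
      note iI = sq_integrable_mult[OF Y(2) sq(1)] sq_integrable_mult[OF Y(2) sq(2)]
      note ib = sq_integrable_mult[OF Y(2) sq_integrable_mult_bounded_increment[OF add(2-5)]]
      note ie = sq_integrable_mult[OF Y(2) sq_integrable_mult_bounded_increment[OF add(2) e(1) add(4,5)]]
      have "expectation (\<lambda>w. Y w * (\<xi> w * (W b w - W a w))) - expectation (\<lambda>w. Y w * (\<xi> w * (W e w - W a w)))
        = expectation (\<lambda>w. Y w * (\<xi> w * (W b w - W e w)))"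
        by (subst Bochner_Integration.integral_diff[OF ib ie, symmetric])
          (auto intro!: Bochner_Integration.integral_cong simp: algebra_simps)
      also have "\<dots> = 0"
        using orth[of e b, OF _ _ _ _ Y] e by (cases "e = b") auto
      finally show ?thesis
        using iI ib ie I'(2)[OF Y] by (simp add: distrib_left)
    qed
    ultimately show ?thesis
      using step_pair.add[OF I'(1) add(2) e(1) add(4,5)]
      by (intro exI[of _ "\<lambda>w. I' w + \<xi> w * (W e w - W a w)"]) auto
  qed
qed

section \<open>Extension to mean-square limits\<close>

text \<open>The closure of \<open>step_pair\<close> under joint mean-square convergence of integrand
  and integral. It is a relation and not a function because the integral is determined only up to
  null sets.\<close>

definition ito_pair :: "('a \<times> real \<Rightarrow> real) \<Rightarrow> ('a \<Rightarrow> real) \<Rightarrow> bool" where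
  "ito_pair f J \<longleftrightarrow> (\<exists>\<phi> I. (\<forall>l. step_pair (\<phi> l) (I l)) \<and> tends_L2 (M \<Otimes>\<^sub>M lborel) \<phi> f \<and> tends_L2 M I J)"

lemma ito_pair_sq_integrable:
  "ito_pair f J \<Longrightarrow> sq_integrable (M \<Otimes>\<^sub>M lborel) f" "ito_pair f J \<Longrightarrow> sq_integrable M J"
  by (auto simp: ito_pair_def tends_L2_def)

lemma ito_pair_step: "step_pair \<phi> I \<Longrightarrow> ito_pair \<phi> I"
  unfolding ito_pair_def
  by (intro exI[of _ "\<lambda>_. \<phi>"] exI[of _ "\<lambda>_. I"]) (auto intro: tends_L2_const step_pair_sq_integrable)

lemma ito_isometry:
  assumes "ito_pair f J" "ito_pair g H"
  shows "expectation (\<lambda>w. J w * H w) = (\<integral>p. f p * g p \<partial>(M \<Otimes>\<^sub>M lborel))"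
proof -
  obtain \<phi> I where 1: "\<And>l. step_pair (\<phi> l) (I l)" "tends_L2 (M \<Otimes>\<^sub>M lborel) \<phi> f" "tends_L2 M I J"
    using assms(1) by (auto simp: ito_pair_def)
  obtain \<psi> I' where 2: "\<And>l. step_pair (\<psi> l) (I' l)" "tends_L2 (M \<Otimes>\<^sub>M lborel) \<psi> g" "tends_L2 M I' H"
    using assms(2) by (auto simp: ito_pair_def)
  show ?thesis
    by (rule LIMSEQ_unique[OF tends_L2_inner[OF 1(3) 2(3), unfolded step_pair_isometry[OF 1(1) 2(1)]]
          tends_L2_inner[OF 1(2) 2(2)]])
qed

lemma ito_pair_expectation:
  assumes "ito_pair f J"
  shows "expectation J = 0"
proof -
  obtain \<phi> I where 1: "\<And>l. step_pair (\<phi> l) (I l)" "tends_L2 M I J"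
    using assms by (auto simp: ito_pair_def)
  have "(\<lambda>l. expectation (\<lambda>w. I l w * 1)) \<longlonglongrightarrow> expectation (\<lambda>w. J w * 1)"
    by (rule tends_L2_inner[OF 1(2) tends_L2_const]) (simp add: sq_integrable_def)
  then show ?thesis using step_pair_expectation[OF 1(1)] by (simp add: LIMSEQ_const_iff)
qed

text \<open>\<open>J'\<close> is an arbitrary version of the integral of the stopped integrand. The
  stopped step integrals \<open>I' l\<close> converge to it because the isometry turns their
  distance into that of the integrands, and stopping only decreases the latter. Then the identity
  for step processes passes to the limit.\<close>

lemma ito_pair_stopped:
  assumes f: "ito_pair f J" and fs: "ito_pair (\<lambda>p. f p * indicator {0..s} (snd p)) J'" and s: "0 \<le> s"
    and Y: "Y \<in> borel_measurable (F s)" "sq_integrable M Y"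
  shows "expectation (\<lambda>w. Y w * J w) = expectation (\<lambda>w. Y w * J' w)"
proof -
  obtain \<phi> I where 1: "\<And>l. step_pair (\<phi> l) (I l)" "tends_L2 (M \<Otimes>\<^sub>M lborel) \<phi> f" "tends_L2 M I J"
    using f by (auto simp: ito_pair_def)
  have "\<exists>I'. step_pair (\<lambda>p. \<phi> l p * indicator {0..s} (snd p)) I' \<and>
    expectation (\<lambda>w. Y w * I l w) = expectation (\<lambda>w. Y w * I' w)" for l
    using step_pair_stopped[OF 1(1)[of l] s] Y by auto
  then have "\<forall>l. \<exists>I'. step_pair (\<lambda>p. \<phi> l p * indicator {0..s} (snd p)) I' \<and>
    expectation (\<lambda>w. Y w * I l w) = expectation (\<lambda>w. Y w * I' w)" ..
  from choice[OF this] obtain I' where "\<forall>l. step_pair (\<lambda>p. \<phi> l p * indicator {0..s} (snd p)) (I' l) \<and>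
    expectation (\<lambda>w. Y w * I l w) = expectation (\<lambda>w. Y w * I' l w)" ..
  then have I': "\<And>l. step_pair (\<lambda>p. \<phi> l p * indicator {0..s} (snd p)) (I' l)"
    "\<And>l. expectation (\<lambda>w. Y w * I l w) = expectation (\<lambda>w. Y w * I' l w)" by auto
  let ?P = "M \<Otimes>\<^sub>M lborel :: ('a \<times> real) measure"
  let ?i = "\<lambda>p::'a \<times> real. indicator {0..s} (snd p) :: real"
  have sq: "sq_integrable M (I' l)" "sq_integrable ?P (\<lambda>p. \<phi> l p * ?i p)"
      "sq_integrable M J'" "sq_integrable ?P (\<lambda>p. f p * ?i p)" "sq_integrable ?P f" "sq_integrable ?P (\<phi> l)" for l
    using step_pair_sq_integrable[OF I'(1)] ito_pair_sq_integrable[OF fs] ito_pair_sq_integrable[OF f]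
      step_pair_sq_integrable[OF 1(1)] by auto
  \<comment> \<open>The isometry for a difference, read off from three inner products, each of them
    an instance of \<open>ito_isometry\<close>.\<close>
  have eq: "expectation (\<lambda>w. (J' w - I' l w)\<^sup>2) = (\<integral>p. (f p * ?i p - \<phi> l p * ?i p)\<^sup>2 \<partial>?P)" for l
  proof -
    have exp: "(\<integral>x. (u x - v x)\<^sup>2 \<partial>N) = (\<integral>x. u x * u x \<partial>N) - 2 * (\<integral>x. u x * v x \<partial>N) + (\<integral>x. v x * v x \<partial>N)"
      if "sq_integrable N u" "sq_integrable N v" for N :: "'c measure" and u v
    proof -
      have "(\<lambda>x. (u x - v x)\<^sup>2) = (\<lambda>x. u x * u x - 2 * (u x * v x) + v x * v x)"
        by (auto simp: power2_eq_square algebra_simps)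
      then show ?thesis using that by (simp add: sq_integrable_mult)
    qed
    show ?thesis
      unfolding exp[OF sq(3) sq(1)] exp[OF sq(4) sq(2)]
      by (simp only: ito_isometry[OF fs fs] ito_isometry[OF fs ito_pair_step[OF I'(1)]]
          ito_isometry[OF ito_pair_step[OF I'(1)] ito_pair_step[OF I'(1)]])
  qed
  have le: "(\<integral>p. (f p * ?i p - \<phi> l p * ?i p)\<^sup>2 \<partial>?P) \<le> (\<integral>p. (f p - \<phi> l p)\<^sup>2 \<partial>?P)" for l
    using sq by (intro integral_mono sq_integrable_square sq_integrable_diff) (auto split: split_indicator)
  have "(\<lambda>l. expectation (\<lambda>w. (J' w - I' l w)\<^sup>2)) \<longlonglongrightarrow> 0"
  proof (rule tendsto_sandwich[OF _ _ tendsto_const])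
    show "(\<lambda>l. \<integral>p. (f p - \<phi> l p)\<^sup>2 \<partial>?P) \<longlonglongrightarrow> 0"
      using 1(2) by (simp add: tends_L2_def)
  qed (use eq le in \<open>auto intro!: always_eventually integral_nonneg_AE\<close>)
  then have "tends_L2 M I' J'" using sq by (simp add: tends_L2_def)
  from tends_L2_inner[OF tends_L2_const[OF Y(2)] this]
  show ?thesis
    by (rule LIMSEQ_unique[OF tends_L2_inner[OF tends_L2_const[OF Y(2)] 1(3), unfolded I'(2)]])
qed

section \<open>From progressively measurable processes and their Ito integrals to
  \<open>ito_pair\<close>\<close>

lemma cutoff_measurable:
  assumes "0 \<le> T" "(\<lambda>(s, w). f s w) \<in> borel_measurable (restrict_space borel {0..T} \<Otimes>\<^sub>M F T)"
  shows "cutoff T f \<in> borel_measurable (M \<Otimes>\<^sub>M lborel)"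
proof -
  let ?P = "M \<Otimes>\<^sub>M lborel :: ('a \<times> real) measure" and ?A = "space M \<times> {0..T}"
  have A: "?A \<inter> space ?P \<in> sets ?P" by (auto simp: space_pair_measure)
  have id: "(\<lambda>w. w) \<in> measurable M (F T)"
    by (rule measurable_from_subalg[OF subalgebra_F measurable_id])
  have "(\<lambda>p. (snd p, fst p)) \<in> measurable (restrict_space ?P ?A) (restrict_space borel {0..T} \<Otimes>\<^sub>M F T)"
  proof (rule measurable_Pair)
    show "snd \<in> measurable (restrict_space ?P ?A) (restrict_space borel {0..T})"
      by (rule measurable_restrict_space2)
        (auto simp: space_restrict_space intro!: measurable_restrict_space1)
    have "fst \<in> measurable ?P (F T)"
      by (rule measurable_compose[OF measurable_fst id])
    then show "fst \<in> measurable (restrict_space ?P ?A) (F T)" by (rule measurable_restrict_space1)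
  qed
  from measurable_comp[OF this assms(2)]
  have "(\<lambda>p. f (snd p) (fst p)) \<in> borel_measurable (restrict_space ?P ?A)" by (simp add: comp_def)
  then have "(\<lambda>p. indicator ?A p *\<^sub>R f (snd p) (fst p)) \<in> borel_measurable ?P"
    by (rule iffD1[OF borel_measurable_restrict_space_iff[OF A]])
  also have "?this \<longleftrightarrow> ?thesis"
    by (rule measurable_cong) (auto simp: cutoff_def space_pair_measure split: split_indicator)
  finally show ?thesis .
qed

lemma nn_integral_cutoff:
  assumes "g \<in> borel_measurable (M \<Otimes>\<^sub>M lborel)" "\<And>w s. g (w, s) = h s w * indicator {0..T} s"
  shows "(\<integral>\<^sup>+w. (\<integral>\<^sup>+s\<in>{0..T}. ennreal ((h s w)\<^sup>2) \<partial>lborel) \<partial>M) = (\<integral>\<^sup>+p. ennreal ((g p)\<^sup>2) \<partial>(M \<Otimes>\<^sub>M lborel))"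
proof -
  have "(\<integral>\<^sup>+p. ennreal ((g p)\<^sup>2) \<partial>(M \<Otimes>\<^sub>M lborel)) = (\<integral>\<^sup>+w. (\<integral>\<^sup>+s. ennreal ((g (w, s))\<^sup>2) \<partial>lborel) \<partial>M)"
    by (rule lborel.nn_integral_fst[symmetric]) (use assms(1) in measurable)
  also have "\<dots> = (\<integral>\<^sup>+w. (\<integral>\<^sup>+s\<in>{0..T}. ennreal ((h s w)\<^sup>2) \<partial>lborel) \<partial>M)"
    by (intro nn_integral_cong) (auto simp: assms(2) split: split_indicator)
  finally show ?thesis ..
qed

lemma sq_integrable_cutoff:
  assumes "square_integrable_process M F T f" "0 \<le> T"
  shows "sq_integrable (M \<Otimes>\<^sub>M lborel) (cutoff T f)"
proof -
  have m: "cutoff T f \<in> borel_measurable (M \<Otimes>\<^sub>M lborel)"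
    using assms by (auto intro!: cutoff_measurable simp: square_integrable_process_def)
  have "(\<integral>\<^sup>+p. ennreal ((cutoff T f p)\<^sup>2) \<partial>(M \<Otimes>\<^sub>M lborel)) < \<infinity>"
    using assms(1) by (subst nn_integral_cutoff[OF m, symmetric, of f T])
      (auto simp: square_integrable_process_def)
  then have "integrable (M \<Otimes>\<^sub>M lborel) (\<lambda>p. (cutoff T f p)\<^sup>2)"
    using m by (intro integrableI_nonneg) auto
  then show ?thesis using m by (simp add: sq_integrable_def)
qed

lemma square_integrable_process_adapted:
  assumes "square_integrable_process M F t f" "0 \<le> t"
  shows "f t \<in> borel_measurable (F t)"
proof -
  have "(\<lambda>(s, w). f s w) \<in> borel_measurable (restrict_space borel {0..t} \<Otimes>\<^sub>M F t)"
    using assms by (auto simp: square_integrable_process_def)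
  from measurable_comp[OF measurable_Pair1' this, of t] assms(2)
  show ?thesis by (simp add: comp_def space_restrict_space)
qed

text \<open>Induction on the number of steps; monotone nodes starting at or after 0 give the order
  conditions of \<open>step_pair\<close>. By the second claim the support lies in
  \<open>[0, T]\<close>, so a cutoff at \<open>T\<close> leaves a step process unchanged.\<close>

lemma step_pair_process:
  assumes "step_coefficients M F T k \<tau> \<xi>" 
  shows "step_pair (\<lambda>p. step_process k \<tau> \<xi> (snd p) (fst p)) (step_integral W k \<tau> \<xi>)"
    and "s \<notin> {0..T} \<Longrightarrow> step_process k \<tau> \<xi> s w = 0"
proof -
  have mono: "\<tau> i \<le> \<tau> j" if "i \<le> j" "j \<le> k" for i j
    using that
  proof (induction rule: dec_induct)
    case (step j)
    then show ?case using assms by (force simp: step_coefficients_def Suc_le_eq)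
  qed simp
  have nonneg: "0 \<le> \<tau> j" if "j \<le> k" for j
    using mono[of 0 j] that assms by (auto simp: step_coefficients_def)
  have "step_pair (\<lambda>p. step_process j \<tau> \<xi> (snd p) (fst p)) (step_integral W j \<tau> \<xi>)" if "j \<le> k" for j
    using that
  proof (induction j)
    case 0
    show ?case using step_pair.zero by (simp add: step_process_def step_integral_def[abs_def])
  next
    case (Suc j)
    have "\<exists>c. \<forall>w\<in>space M. \<bar>\<xi> j w\<bar> \<le> c" "\<xi> j \<in> borel_measurable (F (\<tau> j))"
      using assms Suc.prems by (auto simp: step_coefficients_def Suc_le_eq)
    then obtain B where B: "\<And>w. w \<in> space M \<Longrightarrow> \<bar>\<xi> j w\<bar> \<le> B" and \<xi>: "\<xi> j \<in> borel_measurable (F (\<tau> j))"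
      by blast
    have j: "j \<le> k" "j \<le> Suc j" using Suc.prems by auto
    from step_pair.add[OF Suc.IH[OF j(1)] nonneg[OF j(1)] mono[OF j(2) Suc.prems] \<xi> B]
    show ?case
      unfolding step_process_def step_integral_def[abs_def] sum.lessThan_Suc .
  qed
  then show "step_pair (\<lambda>p. step_process k \<tau> \<xi> (snd p) (fst p)) (step_integral W k \<tau> \<xi>)" by simp
  assume s: "s \<notin> {0..T}"
  have "indicator {\<tau> j<..\<tau> (Suc j)} s = (0::real)" if "j < k" for j
  proof -
    have "\<tau> (Suc j) \<le> T" using mono[of "Suc j" k] that assms by (auto simp: step_coefficients_def)
    then show ?thesis using s nonneg[of j] that by (auto split: split_indicator)
  qed
  then show "step_process k \<tau> \<xi> s w = 0" by (simp add: step_process_def)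
qed

text \<open>The iterated integral in the definition is an integral over the product space by
  Tonelli, after which \<open>tends_L2I\<close> applies to the integrands and to the
  integrals.\<close>

lemma has_ito_integral_ito_pair:
  assumes J: "has_ito_integral M F W T f J" and T: "0 \<le> T"
  shows "ito_pair (cutoff T f) J"
proof -
  obtain k \<tau> \<xi> where *: "\<forall>l::nat. step_coefficients M F T (k l) (\<tau> l) (\<xi> l)"
    and 1: "(\<lambda>l. \<integral>\<^sup>+w. (\<integral>\<^sup>+s\<in>{0..T}. ennreal ((f s w - step_process (k l) (\<tau> l) (\<xi> l) s w)\<^sup>2) \<partial>lborel) \<partial>M)
         \<longlonglongrightarrow> 0"
    and 2: "(\<lambda>l. \<integral>\<^sup>+w. ennreal ((J w - step_integral W (k l) (\<tau> l) (\<xi> l) w)\<^sup>2) \<partial>M) \<longlonglongrightarrow> 0"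
    using J unfolding has_ito_integral_def by (elim conjE exE) (rule that)
  have sc: "step_coefficients M F T (k l) (\<tau> l) (\<xi> l)" for l using * ..
  let ?\<phi> = "\<lambda>l p. step_process (k l) (\<tau> l) (\<xi> l) (snd p) (fst p)"
  let ?I = "\<lambda>l. step_integral W (k l) (\<tau> l) (\<xi> l)"
  have sq: "sq_integrable (M \<Otimes>\<^sub>M lborel) (cutoff T f)"
    using J T by (intro sq_integrable_cutoff) (auto simp: has_ito_integral_def)
  have sp: "step_pair (?\<phi> l) (?I l)" for l by (rule step_pair_process[OF sc])
  note sps = step_pair_sq_integrable[OF sp]
  have "(\<integral>\<^sup>+w. (\<integral>\<^sup>+s\<in>{0..T}. ennreal ((f s w - step_process (k l) (\<tau> l) (\<xi> l) s w)\<^sup>2) \<partial>lborel) \<partial>M)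
    = (\<integral>\<^sup>+p. ennreal ((cutoff T f p - ?\<phi> l p)\<^sup>2) \<partial>(M \<Otimes>\<^sub>M lborel))" for l
  proof (rule nn_integral_cutoff)
    show "(\<lambda>p. cutoff T f p - ?\<phi> l p) \<in> borel_measurable (M \<Otimes>\<^sub>M lborel)"
      using sq sps(1)[of l] by (auto simp: sq_integrable_def)
    show "cutoff T f (w, s) - ?\<phi> l (w, s) = (f s w - step_process (k l) (\<tau> l) (\<xi> l) s w) * indicator {0..T} s"
      for w s using step_pair_process(2)[OF sc, of s] by (auto split: split_indicator)
  qed
  with 1 have "tends_L2 (M \<Otimes>\<^sub>M lborel) ?\<phi> (cutoff T f)"
    using sq sps(1) by (intro tends_L2I) (auto simp: sq_integrable_def)
  moreover have "tends_L2 M ?I J"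
    using 2 sps(2) J by (intro tends_L2I) (auto simp: has_ito_integral_def)
  ultimately show ?thesis
    unfolding ito_pair_def using sp by (intro exI[of _ ?\<phi>] exI[of _ ?I] conjI allI)
qed

lemma sq_integrable_fst_mult_indicator:
  assumes "sq_integrable M Y"
  shows "sq_integrable (M \<Otimes>\<^sub>M lborel) (\<lambda>p. Y (fst p) * indicator {0..T::real} (snd p))"
proof -
  have m[measurable]: "Y \<in> borel_measurable M" using assms by (simp add: sq_integrable_def)
  have eq: "(Y w * indicator {0..T} s)\<^sup>2 = (Y w)\<^sup>2 * indicator {0..T} s" for w s
    by (simp split: split_indicator)
  have "integrable (M \<Otimes>\<^sub>M lborel) (\<lambda>p. (Y (fst p) * indicator {0..T} (snd p))\<^sup>2)"
  proof (rule MB.Fubini_integrable)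
    show "integrable M (\<lambda>w. \<integral>s. norm ((Y (fst (w, s)) * indicator {0..T} (snd (w, s)))\<^sup>2) \<partial>lborel)"
      using sq_integrable_square[OF assms] by (simp add: eq)
    show "AE w in M. integrable lborel (\<lambda>s. (Y (fst (w, s)) * indicator {0..T} (snd (w, s)))\<^sup>2)"
      by (simp add: eq integrable_indicator_Icc)
  qed measurable
  then show ?thesis by (simp add: sq_integrable_def)
qed

text \<open>On almost every path Cauchy-Schwarz against the indicator of \<open>{0..T}\<close>
  bounds the squared time integral by the length of the interval times the integral of the square.
  The second claim is Fubini, made legitimate by \<open>prod\<close>.\<close>

lemma
  fixes f :: "'a \<times> real \<Rightarrow> real"
  assumes f: "sq_integrable (M \<Otimes>\<^sub>M lborel) f" and supp: "\<And>w s. s \<notin> {0..T} \<Longrightarrow> f (w, s) = 0"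
  shows sq_integrable_time_integral: "sq_integrable M (\<lambda>w. \<integral>s. f (w, s) \<partial>lborel)"
    and expectation_mult_time_integral: "\<And>Y. sq_integrable M Y \<Longrightarrow>
      expectation (\<lambda>w. Y w * (\<integral>s. f (w, s) \<partial>lborel)) = (\<integral>p. Y (fst p) * f p \<partial>(M \<Otimes>\<^sub>M lborel))"
    and AE_integrable_time: "AE w in M. integrable lborel (\<lambda>s. f (w, s))"
proof -
  have fm[measurable]: "f \<in> borel_measurable (M \<Otimes>\<^sub>M lborel)" using f by (simp add: sq_integrable_def)
  define V where "V w = (\<integral>s. f (w, s) \<partial>lborel)" for w
  have Vm: "V \<in> borel_measurable M"
    unfolding V_def by (rule lborel.borel_measurable_lebesgue_integral) simp
  have prod: "integrable (M \<Otimes>\<^sub>M lborel) (\<lambda>p. Y (fst p) * f p)" if "sq_integrable M Y" for Y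
  proof -
    have eq: "(Y (fst p) * indicator {0..T} (snd p)) * f p = Y (fst p) * f p" for p
      using supp[of "snd p" "fst p"] by (auto split: split_indicator)
    show ?thesis
      using sq_integrable_mult[OF sq_integrable_fst_mult_indicator[OF that, of T] f] unfolding eq .
  qed
  have one: "sq_integrable M (\<lambda>_. 1)" by (simp add: sq_integrable_def)
  show AE: "AE w in M. integrable lborel (\<lambda>s. f (w, s))"
    using MB.AE_integrable_fst'[OF prod[OF one]] by simp
  have AE2: "AE w in M. integrable lborel (\<lambda>s. (f (w, s))\<^sup>2)"
    using MB.AE_integrable_fst'[OF sq_integrable_square[OF f]] .
  have "integrable M (\<lambda>w. (V w)\<^sup>2)"
  proof (rule Bochner_Integration.integrable_bound)
    \<comment> \<open>The length of \<open>{0..T}\<close> is at most \<open>\<bar>T\<bar>\<close>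
      for either sign of \<open>T\<close>.\<close>
    show "integrable M (\<lambda>w. \<bar>T\<bar> * (\<integral>s. (f (w, s))\<^sup>2 \<partial>lborel))"
      using MB.integrable_fst'[OF sq_integrable_square[OF f]] by simp
    show "(\<lambda>w. (V w)\<^sup>2) \<in> borel_measurable M" using Vm by simp
    show "AE w in M. norm ((V w)\<^sup>2) \<le> norm (\<bar>T\<bar> * (\<integral>s. (f (w, s))\<^sup>2 \<partial>lborel))"
      using AE2 AE_space
    proof eventually_elim
      fix w assume int: "integrable lborel (\<lambda>s. (f (w, s))\<^sup>2)" and w: "w \<in> space M"
      have sq: "sq_integrable lborel (\<lambda>s. f (w, s))"
        using int w by (simp add: sq_integrable_def)
      have i2: "(indicator {0..T} s)\<^sup>2 = (indicator {0..T} s :: real)" for s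
        by (simp split: split_indicator)
      have sqi: "sq_integrable lborel (\<lambda>s. indicator {0..T} s)"
        by (simp add: sq_integrable_def i2 integrable_indicator_Icc)
      have "(V w)\<^sup>2 = (\<integral>s. indicator {0..T} s * f (w, s) \<partial>lborel)\<^sup>2"
      proof -
        have "(indicator {0..T} s) * f (w, s) = f (w, s)" for s
          using supp[of s w] by (auto split: split_indicator)
        then show ?thesis by (simp only: V_def)
      qed
      also have "\<dots> \<le> (\<integral>s. (indicator {0..T} s)\<^sup>2 \<partial>lborel) * (\<integral>s. (f (w, s))\<^sup>2 \<partial>lborel)"
        by (rule integral_Cauchy_Schwarz[OF sqi sq])
      also have "\<dots> \<le> \<bar>T\<bar> * (\<integral>s. (f (w, s))\<^sup>2 \<partial>lborel)"
        unfolding i2 by (intro mult_right_mono integral_nonneg_AE) (auto simp: measure_def emeasure_lborel_Icc_eq)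
      finally show "norm ((V w)\<^sup>2) \<le> norm (\<bar>T\<bar> * (\<integral>s. (f (w, s))\<^sup>2 \<partial>lborel))" by (simp add: abs_mult)
    qed
  qed
  then show "sq_integrable M (\<lambda>w. \<integral>s. f (w, s) \<partial>lborel)" using Vm by (simp add: sq_integrable_def V_def[abs_def])
  show "expectation (\<lambda>w. Y w * (\<integral>s. f (w, s) \<partial>lborel)) = (\<integral>p. Y (fst p) * f p \<partial>(M \<Otimes>\<^sub>M lborel))"
    if "sq_integrable M Y" for Y
    using MB.integral_fst'[OF prod[OF that]] by simp
qed

section \<open>Ito processes and the product formula\<close>

text \<open>The process \<open>dx = a dt + c dW\<close> with initial value \<open>x0\<close>.\<close>

definition ito_process ::
  "(real \<Rightarrow> 'a \<Rightarrow> real) \<Rightarrow> real \<Rightarrow> (real \<Rightarrow> 'a \<Rightarrow> real) \<Rightarrow> (real \<Rightarrow> 'a \<Rightarrow> real) \<Rightarrow> bool" where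
  "ito_process x x0 a c \<longleftrightarrow>
     (\<forall>t\<ge>0. sq_integrable (M \<Otimes>\<^sub>M lborel) (cutoff t x) \<and> sq_integrable (M \<Otimes>\<^sub>M lborel) (cutoff t a) \<and>
       x t \<in> borel_measurable M \<and> a t \<in> borel_measurable (F t) \<and> sq_integrable M (a t) \<and>
       (\<exists>J. ito_pair (cutoff t c) J \<and> (AE w in M. x t w = x0 + (\<integral>s. cutoff t a (w, s) \<partial>lborel) + J w)))"

lemma cutoff_mult_indicator: "0 \<le> s \<Longrightarrow> s \<le> t \<Longrightarrow> cutoff t f p * indicator {0..s} (snd p) = cutoff s f p"
  by (auto simp: cutoff_def split: split_indicator)

lemma cutoff_atMost: "s \<le> t \<Longrightarrow> cutoff t f (w, r) * indicator {..s} r = cutoff s f (w, r)"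
  by (auto simp: cutoff_def split: split_indicator)

text \<open>On almost every path the running integral is dominated by the full integral of the
  absolute value, which is constant in time on \<open>[0, t]\<close> and square-integrable in the
  sample point.\<close>

lemma sq_integrable_running_integral:
  fixes f :: "'a \<times> real \<Rightarrow> real" and t :: real
  assumes f: "sq_integrable (M \<Otimes>\<^sub>M lborel) f" and supp: "\<And>w s. s \<notin> {0..t} \<Longrightarrow> f (w, s) = 0"
  shows "sq_integrable (M \<Otimes>\<^sub>M lborel)
    (\<lambda>p. (\<integral>r. f (fst p, r) * indicator {..snd p} r \<partial>lborel) * indicator {0..t} (snd p))"
proof -
  let ?U = "\<lambda>p. (\<integral>r. f (fst p, r) * indicator {..snd p} r \<partial>lborel) * indicator {0..t} (snd p)"
  let ?B = "\<lambda>p. (\<integral>r. \<bar>f (fst p, r)\<bar> \<partial>lborel) * indicator {0..t} (snd p)"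
  have m[measurable]: "f \<in> borel_measurable (M \<Otimes>\<^sub>M lborel)" using f by (simp add: sq_integrable_def)
  have abs: "sq_integrable (M \<Otimes>\<^sub>M lborel) (\<lambda>p. \<bar>f p\<bar>)"
    using f by (simp add: sq_integrable_def)
  have B: "sq_integrable (M \<Otimes>\<^sub>M lborel) ?B"
    by (intro sq_integrable_fst_mult_indicator sq_integrable_time_integral[where T=t] abs) (simp add: supp)
  have "(\<lambda>p. \<integral>r. f (fst p, r) * indicator {..snd p} r \<partial>lborel) \<in> borel_measurable (M \<Otimes>\<^sub>M lborel)"
    by (rule lborel.borel_measurable_lebesgue_integral) (simp add: indicator_def atMost_def)
  then have U: "?U \<in> borel_measurable (M \<Otimes>\<^sub>M lborel)" by simp
  have bound: "\<bar>?U (w, s)\<bar> \<le> \<bar>?B (w, s)\<bar>" if int: "integrable lborel (\<lambda>r. f (w, r))" for w s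
  proof -
    have "integrable lborel (\<lambda>r. f (w, r) * indicator {..s} r)"
      using int by (rule integrable_real_mult_indicator[rotated]) simp
    then have "(\<integral>r. \<bar>f (w, r) * indicator {..s} r\<bar> \<partial>lborel) \<le> (\<integral>r. \<bar>f (w, r)\<bar> \<partial>lborel)"
      using int by (intro integral_mono integrable_abs) (auto split: split_indicator)
    then have "\<bar>\<integral>r. f (w, r) * indicator {..s} r \<partial>lborel\<bar> \<le> \<bar>\<integral>r. \<bar>f (w, r)\<bar> \<partial>lborel\<bar>"
      using integral_abs_bound[of lborel "\<lambda>r. f (w, r) * indicator {..s} r"] by linarith
    then show ?thesis by (simp split: split_indicator)
  qed
  have "AE w in M. integrable lborel (\<lambda>r. f (w, r))"
    by (rule AE_integrable_time[where T=t, OF f supp])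
  then have "AE w in M. AE s in lborel. \<bar>?U (w, s)\<bar> \<le> \<bar>?B (w, s)\<bar>"
    by (rule eventually_mono) (intro AE_I2 bound)
  moreover have "{p \<in> space (M \<Otimes>\<^sub>M lborel). \<bar>?U p\<bar> \<le> \<bar>?B p\<bar>} \<in> sets (M \<Otimes>\<^sub>M lborel)"
    by (rule borel_measurable_le) (use U B in \<open>auto simp: sq_integrable_def\<close>)
  ultimately have "AE p in M \<Otimes>\<^sub>M lborel. \<bar>?U p\<bar> \<le> \<bar>?B p\<bar>"
    by (rule MB.AE_pair_measure[rotated])
  with B U show ?thesis by (rule sq_integrable_bound)
qed

lemma integral_time_expectation:
  fixes f :: "'a \<times> real \<Rightarrow> real"
  shows "integrable (M \<Otimes>\<^sub>M lborel) f \<Longrightarrow>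
    (\<integral>p. f p \<partial>(M \<Otimes>\<^sub>M lborel)) = (\<integral>s. expectation (\<lambda>w. f (w, s)) \<partial>lborel)"
  using MB.integral_snd[of "\<lambda>w s. f (w, s)"] by simp

lemma ito_processD:
  assumes "ito_process x x0 a c" "0 \<le> t"
  shows "sq_integrable (M \<Otimes>\<^sub>M lborel) (cutoff t x)" "sq_integrable (M \<Otimes>\<^sub>M lborel) (cutoff t a)"
    "x t \<in> borel_measurable M" "a t \<in> borel_measurable (F t)" "sq_integrable M (a t)"
    "\<exists>J. ito_pair (cutoff t c) J \<and> (AE w in M. x t w = x0 + (\<integral>s. cutoff t a (w, s) \<partial>lborel) + J w)"
  using assms by (auto simp: ito_process_def)

lemma cutoff_outside: "s \<notin> {0..t} \<Longrightarrow> cutoff t f (w, s) = 0"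
  by (simp add: cutoff_def)

lemma sq_integrable_drift_martingale:
  assumes "sq_integrable (M \<Otimes>\<^sub>M lborel) (cutoff t a)" "sq_integrable M J"
    and "X \<in> borel_measurable M" "AE w in M. X w = x0 + (\<integral>s. cutoff t a (w, s) \<partial>lborel) + J w"
  shows "sq_integrable M X"
proof -
  have V: "sq_integrable M (\<lambda>w. \<integral>s. cutoff t a (w, s) \<partial>lborel)"
    by (rule sq_integrable_time_integral[OF assms(1), of t]) (rule cutoff_outside)
  have "sq_integrable M (\<lambda>w. x0 + (\<integral>s. cutoff t a (w, s) \<partial>lborel) + J w)"
    by (intro sq_integrable_add V assms(2)) (simp add: sq_integrable_def)
  then show ?thesis
    by (rule sq_integrable_cong_AE) (use assms(3,4) in auto)
qed

text \<open>\<open>running_integral t b p\<close> is \<open>\<integral>\<^sub>0\<^sup>s b dr\<close> at \<open>p = (\<omega>, s)\<close> with \<open>s \<le> t\<close>, and vanishes for \<open>s > t\<close>.\<close>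

definition running_integral :: "real \<Rightarrow> (real \<Rightarrow> 'a \<Rightarrow> real) \<Rightarrow> 'a \<times> real \<Rightarrow> real" where
  "running_integral t b p =
     (\<integral>r. cutoff t b (fst p, r) * indicator {..snd p} r \<partial>lborel) * indicator {0..t} (snd p)"

lemma sq_integrable_running:
  "sq_integrable (M \<Otimes>\<^sub>M lborel) (cutoff t b) \<Longrightarrow> sq_integrable (M \<Otimes>\<^sub>M lborel) (running_integral t b)"
  unfolding running_integral_def[abs_def]
  by (rule sq_integrable_running_integral) (auto simp: cutoff_outside)

lemma running_integral_eq:
  "s \<in> {0..t} \<Longrightarrow> running_integral t b (w, s) = (\<integral>r. cutoff s b (w, r) \<partial>lborel)"
  unfolding running_integral_def by (simp add: cutoff_atMost del: cutoff_Pair)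

text \<open>Stopping replaces \<open>H\<close> by its value at time \<open>s\<close>, which is \<open>y\<^sub>s - y0 - \<integral>\<^sub>0\<^sup>s b dr\<close> and, unlike the chosen
  versions of the Ito integrals themselves, jointly measurable in \<open>(\<omega>, s)\<close>.\<close>

lemma expectation_drift_mult_martingale:
  assumes x: "ito_process x x0 a c" and y: "ito_process y y0 b d" and t: "0 \<le> t"
    and H: "ito_pair (cutoff t d) H"
  shows "expectation (\<lambda>w. (\<integral>s. cutoff t a (w, s) \<partial>lborel) * H w) =
    (\<integral>p. cutoff t a p * (cutoff t y p - y0 * indicator {0..t} (snd p) - running_integral t b p) \<partial>(M \<Otimes>\<^sub>M lborel))"
proof -
  let ?P = "M \<Otimes>\<^sub>M lborel :: ('a \<times> real) measure"
  let ?g = "\<lambda>p. cutoff t y p - y0 * indicator {0..t} (snd p) - running_integral t b p"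
  have sqH: "sq_integrable M H" using ito_pair_sq_integrable[OF H] by simp
  have sqa: "sq_integrable ?P (cutoff t a)" by (rule ito_processD[OF x t])
  have sqg: "sq_integrable ?P ?g"
    using ito_processD[OF y t] sq_integrable_fst_mult_indicator[of "\<lambda>_. y0" t]
    by (intro sq_integrable_diff sq_integrable_running) (auto simp: sq_integrable_def)
  have int1: "integrable ?P (\<lambda>p. H (fst p) * cutoff t a p)"
  proof -
    have eq: "(H (fst p) * indicator {0..t} (snd p)) * cutoff t a p = H (fst p) * cutoff t a p" for p
      by (simp add: cutoff_def split: split_indicator)
    show ?thesis
      using sq_integrable_mult[OF sq_integrable_fst_mult_indicator[OF sqH, of t] sqa] unfolding eq .
  qed
  have int2: "integrable ?P (\<lambda>p. cutoff t a p * ?g p)" by (rule sq_integrable_mult[OF sqa sqg])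
  \<comment> \<open>The decomposition of \<open>y s\<close> holds almost surely for each single
    \<open>s\<close>, with a null set that depends on \<open>s\<close>. The equality is therefore
    established for expectations at fixed time and integrated over time afterwards.\<close>
  have section_eq: "expectation (\<lambda>w. H w * cutoff t a (w, s)) = expectation (\<lambda>w. cutoff t a (w, s) * ?g (w, s))" for s
  proof (cases "s \<in> {0..t}")
    case False
    then show ?thesis by (simp add: cutoff_outside del: cutoff_Pair)
  next
    case True
    then have s: "0 \<le> s" "s \<le> t" by auto
    obtain H' where H': "ito_pair (cutoff s d) H'"
      "AE w in M. y s w = y0 + (\<integral>r. cutoff s b (w, r) \<partial>lborel) + H' w"
      using ito_processD(6)[OF y s(1)] by blast
    note as = ito_processD(4,5)[OF x s(1)]
    have st: "ito_pair (\<lambda>p. cutoff t d p * indicator {0..s} (snd p)) H'"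
      unfolding cutoff_mult_indicator[OF s] by (rule H')
    have "expectation (\<lambda>w. H w * cutoff t a (w, s)) = expectation (\<lambda>w. a s w * H w)"
      using s by (simp add: mult.commute)
    also have "\<dots> = expectation (\<lambda>w. a s w * H' w)"
      by (rule ito_pair_stopped[OF H st s(1) as])
    also have "\<dots> = expectation (\<lambda>w. a s w * (y s w - y0 - (\<integral>r. cutoff s b (w, r) \<partial>lborel)))"
    proof (rule integral_cong_AE)
      have V: "sq_integrable M (\<lambda>w. \<integral>r. cutoff s b (w, r) \<partial>lborel)"
        by (rule sq_integrable_time_integral[OF ito_processD(2)[OF y s(1)], of s]) (rule cutoff_outside)
      have [measurable]: "a s \<in> borel_measurable M" "H' \<in> borel_measurable M" "y s \<in> borel_measurable M"
        "(\<lambda>w. \<integral>r. cutoff s b (w, r) \<partial>lborel) \<in> borel_measurable M"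
        using as(2) ito_pair_sq_integrable(2)[OF H'(1)] ito_processD(3)[OF y s(1)] V
        by (auto simp: sq_integrable_def)
      show "(\<lambda>w. a s w * H' w) \<in> borel_measurable M" by measurable
      show "(\<lambda>w. a s w * (y s w - y0 - (\<integral>r. cutoff s b (w, r) \<partial>lborel))) \<in> borel_measurable M"
        by (intro borel_measurable_times borel_measurable_diff borel_measurable_const) fact+
      show "AE w in M. a s w * H' w = a s w * (y s w - y0 - (\<integral>r. cutoff s b (w, r) \<partial>lborel))"
        using H'(2) by eventually_elim simp
    qed
    also have "\<dots> = expectation (\<lambda>w. cutoff t a (w, s) * ?g (w, s))"
      unfolding running_integral_eq[OF True] using s by simp
    finally show ?thesis .
  qed
  have "expectation (\<lambda>w. (\<integral>s. cutoff t a (w, s) \<partial>lborel) * H w) =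
    expectation (\<lambda>w. H w * (\<integral>s. cutoff t a (w, s) \<partial>lborel))" by (simp add: mult.commute)
  also have "\<dots> = (\<integral>p. H (fst p) * cutoff t a p \<partial>?P)"
    by (rule expectation_mult_time_integral[OF sqa, of t, OF _ sqH]) (rule cutoff_outside)
  also have "\<dots> = (\<integral>s. expectation (\<lambda>w. H w * cutoff t a (w, s)) \<partial>lborel)"
    unfolding integral_time_expectation[OF int1] fst_conv ..
  also have "\<dots> = (\<integral>p. cutoff t a p * ?g p \<partial>?P)"
    unfolding integral_time_expectation[OF int2] section_eq ..
  finally show ?thesis .
qed

text \<open>Integration by parts on almost every path, by
  \<open>lborel_integral_product_triangle\<close>; both running integrals are square-integrable, so
  Fubini moves the result to the product space.\<close>

lemma expectation_drift_mult_drift: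
  assumes a: "sq_integrable (M \<Otimes>\<^sub>M lborel) (cutoff t a)" and b: "sq_integrable (M \<Otimes>\<^sub>M lborel) (cutoff t b)"
  shows "expectation (\<lambda>w. (\<integral>s. cutoff t a (w, s) \<partial>lborel) * (\<integral>s. cutoff t b (w, s) \<partial>lborel)) =
    (\<integral>p. cutoff t a p * running_integral t b p + cutoff t b p * running_integral t a p \<partial>(M \<Otimes>\<^sub>M lborel))"
proof -
  let ?P = "M \<Otimes>\<^sub>M lborel :: ('a \<times> real) measure"
  note i1 = sq_integrable_mult[OF a sq_integrable_running[OF b]]
  note i2 = sq_integrable_mult[OF b sq_integrable_running[OF a]]
  have run: "cutoff t f p * running_integral t g p =
      cutoff t f p * (\<integral>r. cutoff t g (fst p, r) * indicator {..snd p} r \<partial>lborel)" for f g p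
    by (simp add: running_integral_def cutoff_def split: split_indicator)
  have Va: "AE w in M. integrable lborel (\<lambda>s. cutoff t a (w, s))"
    by (rule AE_integrable_time[where T=t, OF a]) (rule cutoff_outside)
  have Vb: "AE w in M. integrable lborel (\<lambda>s. cutoff t b (w, s))"
    by (rule AE_integrable_time[where T=t, OF b]) (rule cutoff_outside)
  have sV: "sq_integrable M (\<lambda>w. \<integral>s. cutoff t a (w, s) \<partial>lborel)"
    by (rule sq_integrable_time_integral[where T=t, OF a]) (rule cutoff_outside)
  have sU: "sq_integrable M (\<lambda>w. \<integral>s. cutoff t b (w, s) \<partial>lborel)"
    by (rule sq_integrable_time_integral[where T=t, OF b]) (rule cutoff_outside)
  note j1 = MB.integrable_fst'[OF i1] note j2 = MB.integrable_fst'[OF i2]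
  have "expectation (\<lambda>w. (\<integral>s. cutoff t a (w, s) \<partial>lborel) * (\<integral>s. cutoff t b (w, s) \<partial>lborel)) =
    expectation (\<lambda>w. (\<integral>s. cutoff t a (w, s) * running_integral t b (w, s) \<partial>lborel)
      + (\<integral>s. cutoff t b (w, s) * running_integral t a (w, s) \<partial>lborel))"
  proof (rule integral_cong_AE)
    show "(\<lambda>w. (\<integral>s. cutoff t a (w, s) \<partial>lborel) * (\<integral>s. cutoff t b (w, s) \<partial>lborel)) \<in> borel_measurable M"
      by (rule borel_measurable_integrable[OF sq_integrable_mult[OF sV sU]])
    show "(\<lambda>w. (\<integral>s. cutoff t a (w, s) * running_integral t b (w, s) \<partial>lborel)
      + (\<integral>s. cutoff t b (w, s) * running_integral t a (w, s) \<partial>lborel)) \<in> borel_measurable M"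
      by (rule borel_measurable_integrable[OF Bochner_Integration.integrable_add[OF j1 j2]])
    show "AE w in M. (\<integral>s. cutoff t a (w, s) \<partial>lborel) * (\<integral>s. cutoff t b (w, s) \<partial>lborel) =
      (\<integral>s. cutoff t a (w, s) * running_integral t b (w, s) \<partial>lborel)
      + (\<integral>s. cutoff t b (w, s) * running_integral t a (w, s) \<partial>lborel)"
      using Va Vb unfolding run fst_conv snd_conv
      by eventually_elim (rule lborel_integral_product_triangle)
  qed
  also have "\<dots> = (\<integral>p. cutoff t a p * running_integral t b p \<partial>?P) + (\<integral>p. cutoff t b p * running_integral t a p \<partial>?P)"
    by (simp only: Bochner_Integration.integral_add[OF j1 j2] MB.integral_fst'[OF i1] MB.integral_fst'[OF i2])
  finally show ?thesis by (simp only: Bochner_Integration.integral_add[OF i1 i2])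
qed

lemma integral_cutoff:
  assumes a: "sq_integrable (M \<Otimes>\<^sub>M lborel) (cutoff t a)"
  shows "integrable (M \<Otimes>\<^sub>M lborel) (cutoff t a)"
    and "expectation (\<lambda>w. \<integral>s. cutoff t a (w, s) \<partial>lborel) = (\<integral>p. cutoff t a p \<partial>(M \<Otimes>\<^sub>M lborel))"
proof -
  have one: "sq_integrable M (\<lambda>_. 1)" by (simp add: sq_integrable_def)
  have eq: "(1 * indicator {0..t} (snd p)) * cutoff t a p = cutoff t a p" for p
    by (simp add: cutoff_def split: split_indicator)
  show i: "integrable (M \<Otimes>\<^sub>M lborel) (cutoff t a)"
    using sq_integrable_mult[OF sq_integrable_fst_mult_indicator[OF one, of t] a] unfolding eq .
  show "expectation (\<lambda>w. \<integral>s. cutoff t a (w, s) \<partial>lborel) = (\<integral>p. cutoff t a p \<partial>(M \<Otimes>\<^sub>M lborel))"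
    by (rule MB.integral_fst'[OF i])
qed

text \<open>Write \<open>x t = x0 + V + J\<close> and \<open>y t = y0 + U + H\<close>. The
  stochastic integrals have mean 0, their product gives the \<open>c\<close>-\<open>d\<close> term
  by the isometry, and each product of a drift with a stochastic integral brings in the other
  process minus its initial value and its running drift. The corrections cancel.\<close>

theorem ito_product_formula:
  assumes x: "ito_process x x0 a c" and y: "ito_process y y0 b d" and t: "0 \<le> t"
  shows "expectation (\<lambda>w. x t w * y t w) = x0 * y0 +
    (\<integral>p. cutoff t a p * cutoff t y p + cutoff t x p * cutoff t b p + cutoff t c p * cutoff t d p \<partial>(M \<Otimes>\<^sub>M lborel))"
proof -
  let ?P = "M \<Otimes>\<^sub>M lborel :: ('a \<times> real) measure"
  obtain J where J: "ito_pair (cutoff t c) J" "AE w in M. x t w = x0 + (\<integral>s. cutoff t a (w, s) \<partial>lborel) + J w"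
    using ito_processD(6)[OF x t] by blast
  obtain H where H: "ito_pair (cutoff t d) H" "AE w in M. y t w = y0 + (\<integral>s. cutoff t b (w, s) \<partial>lborel) + H w"
    using ito_processD(6)[OF y t] by blast
  define V U where "V w = (\<integral>s. cutoff t a (w, s) \<partial>lborel)" and "U w = (\<integral>s. cutoff t b (w, s) \<partial>lborel)" for w
  note a = ito_processD(2)[OF x t] and b = ito_processD(2)[OF y t]
  have V: "sq_integrable M V" unfolding V_def[abs_def]
    by (rule sq_integrable_time_integral[where T=t, OF a]) (rule cutoff_outside)
  have U: "sq_integrable M U" unfolding U_def[abs_def]
    by (rule sq_integrable_time_integral[where T=t, OF b]) (rule cutoff_outside)
  note sJ = ito_pair_sq_integrable(2)[OF J(1)] and sH = ito_pair_sq_integrable(2)[OF H(1)]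
  note int = sq_integrable_integrable[OF V] sq_integrable_integrable[OF U]
    sq_integrable_integrable[OF sJ] sq_integrable_integrable[OF sH]
    sq_integrable_mult[OF V U] sq_integrable_mult[OF V sH] sq_integrable_mult[OF U sJ] sq_integrable_mult[OF sJ sH]
  have m: "V \<in> borel_measurable M" "U \<in> borel_measurable M" "J \<in> borel_measurable M" "H \<in> borel_measurable M"
    using V U sJ sH by (auto simp: sq_integrable_def)
  have "expectation (\<lambda>w. x t w * y t w) = expectation (\<lambda>w. x0 * y0 + x0 * U w + x0 * H w + y0 * V w + y0 * J w
      + V w * U w + V w * H w + U w * J w + J w * H w)"
  proof (rule integral_cong_AE)
    show "AE w in M. x t w * y t w = x0 * y0 + x0 * U w + x0 * H w + y0 * V w + y0 * J w
      + V w * U w + V w * H w + U w * J w + J w * H w"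
      using J(2) H(2) by eventually_elim (simp add: V_def U_def algebra_simps)
  qed (use m ito_processD(3)[OF x t] ito_processD(3)[OF y t] in \<open>auto intro!: borel_measurable_times borel_measurable_add\<close>)
  also have "\<dots> = x0 * y0 + x0 * expectation U + x0 * expectation H + y0 * expectation V + y0 * expectation J
      + expectation (\<lambda>w. V w * U w) + expectation (\<lambda>w. V w * H w) + expectation (\<lambda>w. U w * J w) + expectation (\<lambda>w. J w * H w)"
    using int by (simp add: prob_space)
  also have "\<dots> = x0 * y0 + x0 * (\<integral>p. cutoff t b p \<partial>?P) + y0 * (\<integral>p. cutoff t a p \<partial>?P)
     + (\<integral>p. cutoff t a p * running_integral t b p + cutoff t b p * running_integral t a p \<partial>?P)
     + (\<integral>p. cutoff t a p * (cutoff t y p - y0 * indicator {0..t} (snd p) - running_integral t b p) \<partial>?P)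
     + (\<integral>p. cutoff t b p * (cutoff t x p - x0 * indicator {0..t} (snd p) - running_integral t a p) \<partial>?P)
     + (\<integral>p. cutoff t c p * cutoff t d p \<partial>?P)"
    unfolding ito_pair_expectation[OF J(1)] ito_pair_expectation[OF H(1)] ito_isometry[OF J(1) H(1)]
      expectation_drift_mult_martingale[OF x y t H(1), folded V_def]
      expectation_drift_mult_martingale[OF y x t J(1), folded U_def]
      expectation_drift_mult_drift[OF a b, folded V_def U_def]
      integral_cutoff(2)[OF a, folded V_def] integral_cutoff(2)[OF b, folded U_def] by simp
  also have "\<dots> = x0 * y0 +
    (\<integral>p. cutoff t a p * cutoff t y p + cutoff t x p * cutoff t b p + cutoff t c p * cutoff t d p \<partial>?P)"
  proof -
    \<comment> \<open>\<open>cutoff t f\<close> already carries the indicator. After this expansion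
      the running integrals cancel against those from \<open>V * U\<close>, and the initial values
      against the means of \<open>y0 * V\<close> and \<open>x0 * U\<close>.\<close>
    have ind: "cutoff t f p * (k - z * indicator {0..t} (snd p) - l) = cutoff t f p * k - z * cutoff t f p - cutoff t f p * l"
      for f p k l and z :: real
      by (simp add: cutoff_def algebra_simps split: split_indicator)
    note i = integral_cutoff(1)[OF a] integral_cutoff(1)[OF b]
      sq_integrable_mult[OF a sq_integrable_running[OF b]] sq_integrable_mult[OF b sq_integrable_running[OF a]]
      sq_integrable_mult[OF a ito_processD(1)[OF y t]] sq_integrable_mult[OF b ito_processD(1)[OF x t]]
      sq_integrable_mult[OF ito_pair_sq_integrable(1)[OF J(1)] ito_pair_sq_integrable(1)[OF H(1)]]
    show ?thesis
      unfolding ind mult.commute[of "cutoff t x _"] using i by simp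
  qed
  finally show ?thesis .
qed

section \<open>Second moments of linear systems\<close>

definition linear_ito_system ::
  "nat \<Rightarrow> (nat \<Rightarrow> nat \<Rightarrow> real) \<Rightarrow> (nat \<Rightarrow> nat \<Rightarrow> real) \<Rightarrow> (nat \<Rightarrow> real) \<Rightarrow> (nat \<Rightarrow> real \<Rightarrow> 'a \<Rightarrow> real) \<Rightarrow> bool" where
  "linear_ito_system n A C x0 X \<longleftrightarrow>
     (\<forall>i<n. ito_process (X i) (x0 i) (\<lambda>t w. \<Sum>k = 0..<n. A i k * X k t w) (\<lambda>t w. \<Sum>k = 0..<n. C i k * X k t w))"

text \<open>By Fubini, \<open>occupation X Y t k l\<close> is \<open>\<integral>\<^sub>0\<^sup>t E (X\<^sub>k Y\<^sub>l) ds\<close>.\<close>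

definition occupation :: "(nat \<Rightarrow> real \<Rightarrow> 'a \<Rightarrow> real) \<Rightarrow> (nat \<Rightarrow> real \<Rightarrow> 'a \<Rightarrow> real) \<Rightarrow> real \<Rightarrow> nat \<Rightarrow> nat \<Rightarrow> real" where
  "occupation X Y t k l = (\<integral>p. cutoff t (X k) p * cutoff t (Y l) p \<partial>(M \<Otimes>\<^sub>M lborel))"

lemma cutoff_sum: "cutoff t (\<lambda>s w. \<Sum>k\<in>I. c k * X k s w) p = (\<Sum>k\<in>I. c k * cutoff t (X k) p)"
  by (simp add: cutoff_def sum_distrib_right mult.assoc)

text \<open>With Z the matrix of \<open>occupation\<close> values, the last three terms are the
  entries of A Z, Z A^T and C Z C^T: the integrated moment equation, read off from the product
  formula for two components.\<close>

lemma second_moment_eq: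
  assumes X: "linear_ito_system n A C x0 X" and Y: "linear_ito_system n A C y0 Y"
    and t: "0 \<le> t" and ij: "i < n" "j < n"
  shows "expectation (\<lambda>w. X i t w * Y j t w) = x0 i * y0 j
    + (\<Sum>k = 0..<n. A i k * occupation X Y t k j) + (\<Sum>l = 0..<n. A j l * occupation X Y t i l)
    + (\<Sum>k = 0..<n. \<Sum>l = 0..<n. C i k * C j l * occupation X Y t k l)"
proof -
  let ?P = "M \<Otimes>\<^sub>M lborel :: ('a \<times> real) measure"
  have sq: "sq_integrable ?P (cutoff t (X k))" "sq_integrable ?P (cutoff t (Y k))" if "k < n" for k
    using X Y t that ito_processD(1) unfolding linear_ito_system_def by blast+
  have int: "integrable ?P (\<lambda>p. cutoff t (X k) p * cutoff t (Y l) p)" if "k < n" "l < n" for k l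
    by (rule sq_integrable_mult[OF sq(1)[OF that(1)] sq(2)[OF that(2)]])
  have "expectation (\<lambda>w. X i t w * Y j t w) = x0 i * y0 j +
    (\<integral>p. (\<Sum>k = 0..<n. A i k * (cutoff t (X k) p * cutoff t (Y j) p))
       + (\<Sum>l = 0..<n. A j l * (cutoff t (X i) p * cutoff t (Y l) p))
       + (\<Sum>k = 0..<n. \<Sum>l = 0..<n. C i k * C j l * (cutoff t (X k) p * cutoff t (Y l) p)) \<partial>?P)"
    using ito_product_formula[OF X[unfolded linear_ito_system_def, rule_format, OF ij(1)]
        Y[unfolded linear_ito_system_def, rule_format, OF ij(2)] t]
    unfolding cutoff_sum sum_product by (simp only: sum_distrib_left sum_distrib_right mult_ac)
  also have "(\<integral>p. (\<Sum>k = 0..<n. A i k * (cutoff t (X k) p * cutoff t (Y j) p))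
       + (\<Sum>l = 0..<n. A j l * (cutoff t (X i) p * cutoff t (Y l) p))
       + (\<Sum>k = 0..<n. \<Sum>l = 0..<n. C i k * C j l * (cutoff t (X k) p * cutoff t (Y l) p)) \<partial>?P)
    = (\<Sum>k = 0..<n. A i k * occupation X Y t k j) + (\<Sum>l = 0..<n. A j l * occupation X Y t i l)
    + (\<Sum>k = 0..<n. \<Sum>l = 0..<n. C i k * C j l * occupation X Y t k l)"
  proof -
    have i1: "integrable ?P (\<lambda>p. \<Sum>k = 0..<n. A i k * (cutoff t (X k) p * cutoff t (Y j) p))"
      "integrable ?P (\<lambda>p. \<Sum>l = 0..<n. A j l * (cutoff t (X i) p * cutoff t (Y l) p))"
      "\<And>k. k < n \<Longrightarrow> integrable ?P (\<lambda>p. \<Sum>l = 0..<n. C i k * C j l * (cutoff t (X k) p * cutoff t (Y l) p))"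
      using int ij by (auto intro!: integrable_linear_combination simp del: integrable_sum)
    have i2: "integrable ?P (\<lambda>p. \<Sum>k = 0..<n. \<Sum>l = 0..<n. C i k * C j l * (cutoff t (X k) p * cutoff t (Y l) p))"
      by (rule Bochner_Integration.integrable_sum, rule i1(3)) simp
    have "(\<integral>p. (\<Sum>k = 0..<n. \<Sum>l = 0..<n. C i k * C j l * (cutoff t (X k) p * cutoff t (Y l) p)) \<partial>?P) =
      (\<Sum>k = 0..<n. \<integral>p. (\<Sum>l = 0..<n. C i k * C j l * (cutoff t (X k) p * cutoff t (Y l) p)) \<partial>?P)"
      by (rule Bochner_Integration.integral_sum, rule i1(3)) simp
    also have "\<dots> = (\<Sum>k = 0..<n. \<Sum>l = 0..<n. C i k * C j l * occupation X Y t k l)"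
      unfolding occupation_def using int by (intro sum.cong refl integral_linear_combination) auto
    finally have 3: "(\<integral>p. (\<Sum>k = 0..<n. \<Sum>l = 0..<n. C i k * C j l * (cutoff t (X k) p * cutoff t (Y l) p)) \<partial>?P) =
      (\<Sum>k = 0..<n. \<Sum>l = 0..<n. C i k * C j l * occupation X Y t k l)" .
    have 1: "(\<integral>p. (\<Sum>k = 0..<n. A i k * (cutoff t (X k) p * cutoff t (Y j) p)) \<partial>?P) =
        (\<Sum>k = 0..<n. A i k * occupation X Y t k j)"
      and 2: "(\<integral>p. (\<Sum>l = 0..<n. A j l * (cutoff t (X i) p * cutoff t (Y l) p)) \<partial>?P) =
        (\<Sum>l = 0..<n. A j l * occupation X Y t i l)"
      unfolding occupation_def using int ij by (auto intro!: integral_linear_combination)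
    show ?thesis
      by (simp only: Bochner_Integration.integral_add Bochner_Integration.integrable_add i1(1,2) i2 1 2 3)
  qed
  finally show ?thesis by simp
qed

text \<open>The moment operator is moved onto \<open>G\<close>: with respect to the entrywise inner
  product, Z \<mapsto> A Z + Z A^T + C Z C^T has the adjoint G \<mapsto> A^T G + G A + C^T G C. The
  proof only reorders finite sums.\<close>

lemma bilinear_moment_eq:
  assumes X: "linear_ito_system n A C x0 X" and Y: "linear_ito_system n A C y0 Y" and t: "0 \<le> t"
  shows "(\<Sum>i = 0..<n. \<Sum>j = 0..<n. G i j * expectation (\<lambda>w. X i t w * Y j t w)) =
    (\<Sum>i = 0..<n. \<Sum>j = 0..<n. G i j * (x0 i * y0 j)) +
    (\<Sum>k = 0..<n. \<Sum>l = 0..<n. ((\<Sum>i = 0..<n. A i k * G i l) + (\<Sum>j = 0..<n. G k j * A j l)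
       + (\<Sum>i = 0..<n. \<Sum>j = 0..<n. C i k * G i j * C j l)) * occupation X Y t k l)"
proof -
  let ?Z = "occupation X Y t"
  have 1: "(\<Sum>i = 0..<n. \<Sum>j = 0..<n. G i j * (\<Sum>k = 0..<n. A i k * ?Z k j)) =
    (\<Sum>k = 0..<n. \<Sum>l = 0..<n. (\<Sum>i = 0..<n. A i k * G i l) * ?Z k l)"
  proof -
    have "(\<Sum>i = 0..<n. \<Sum>j = 0..<n. G i j * (\<Sum>k = 0..<n. A i k * ?Z k j)) =
      (\<Sum>i = 0..<n. \<Sum>k = 0..<n. \<Sum>j = 0..<n. A i k * G i j * ?Z k j)"
      unfolding sum_distrib_left by (subst sum.swap[of _ "{0..<n}"]) (simp add: mult_ac)
    also have "\<dots> = (\<Sum>k = 0..<n. \<Sum>i = 0..<n. \<Sum>j = 0..<n. A i k * G i j * ?Z k j)"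
      by (rule sum.swap)
    also have "\<dots> = (\<Sum>k = 0..<n. \<Sum>j = 0..<n. \<Sum>i = 0..<n. A i k * G i j * ?Z k j)"
      by (intro sum.cong refl sum.swap)
    finally show ?thesis unfolding sum_distrib_right .
  qed
  have 2: "(\<Sum>i = 0..<n. \<Sum>j = 0..<n. G i j * (\<Sum>l = 0..<n. A j l * ?Z i l)) =
    (\<Sum>k = 0..<n. \<Sum>l = 0..<n. (\<Sum>j = 0..<n. G k j * A j l) * ?Z k l)"
    unfolding sum_distrib_left sum_distrib_right
    by (rule sum.cong[OF refl], subst sum.swap, simp add: mult_ac)
  have 3: "(\<Sum>i = 0..<n. \<Sum>j = 0..<n. G i j * (\<Sum>k = 0..<n. \<Sum>l = 0..<n. C i k * C j l * ?Z k l)) =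
    (\<Sum>k = 0..<n. \<Sum>l = 0..<n. (\<Sum>i = 0..<n. \<Sum>j = 0..<n. C i k * G i j * C j l) * ?Z k l)"
    unfolding sum_distrib_left sum_distrib_right by (subst sum_swap4) (simp only: mult_ac)
  have "(\<Sum>i = 0..<n. \<Sum>j = 0..<n. G i j * expectation (\<lambda>w. X i t w * Y j t w)) =
    (\<Sum>i = 0..<n. \<Sum>j = 0..<n. G i j * (x0 i * y0 j)
      + G i j * (\<Sum>k = 0..<n. A i k * ?Z k j) + G i j * (\<Sum>l = 0..<n. A j l * ?Z i l)
      + G i j * (\<Sum>k = 0..<n. \<Sum>l = 0..<n. C i k * C j l * ?Z k l))"
    by (intro sum.cong refl) (simp only: second_moment_eq[OF X Y t] atLeastLessThan_iff distrib_left)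
  also have "\<dots> = (\<Sum>i = 0..<n. \<Sum>j = 0..<n. G i j * (x0 i * y0 j)) +
    (\<Sum>k = 0..<n. \<Sum>l = 0..<n. ((\<Sum>i = 0..<n. A i k * G i l) + (\<Sum>j = 0..<n. G k j * A j l)
       + (\<Sum>i = 0..<n. \<Sum>j = 0..<n. C i k * G i j * C j l)) * ?Z k l)"
    unfolding sum.distrib distrib_right 1 2 3 by simp
  finally show ?thesis .
qed

section \<open>Mean-square stable solutions and the Lyapunov operator\<close>

lemma linear_sde_solution_system:
  assumes sol: "linear_sde_solution M F W n A C x0 x"
    and A: "A \<in> carrier_mat n n" and C: "C \<in> carrier_mat n n"
  shows "linear_ito_system n (\<lambda>i j. A $$ (i, j)) (\<lambda>i j. C $$ (i, j)) (\<lambda>i. x0 $ i) (\<lambda>i t w. x t w $ i)"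
    and "\<And>i t. i < n \<Longrightarrow> 0 \<le> t \<Longrightarrow> sq_integrable M (\<lambda>w. x t w $ i)"
proof -
  let ?P = "M \<Otimes>\<^sub>M lborel :: ('a \<times> real) measure"
  let ?X = "\<lambda>i t w. x t w $ i"
  have dim: "x t w \<in> carrier_vec n" if "0 \<le> t" "w \<in> space M" for t w
    using sol that by (auto simp: linear_sde_solution_def)
  \<comment> \<open>A solution is known to have dimension \<open>n\<close> only at nonnegative times
    and sample points of the space; elsewhere this expansion may fail. The cutoff hides the negative
    times.\<close>
  have mult: "(B *\<^sub>v x t w) $ i = (\<Sum>k = 0..<n. B $$ (i, k) * ?X k t w)"
    if "B \<in> carrier_mat n n" "0 \<le> t" "w \<in> space M" "i < n" for B i t w
    using dim[OF that(2,3)] that by (simp add: scalar_prod_def)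
  have sqp: "square_integrable_process M F T (?X i)" if "i < n" "0 \<le> T" for i T
    using sol that by (auto simp: linear_sde_solution_def)
  have sq: "sq_integrable ?P (cutoff t (?X i))" if "i < n" "0 \<le> t" for i t
    by (rule sq_integrable_cutoff[OF sqp[OF that] that(2)])
  have sqs: "sq_integrable ?P (cutoff t (\<lambda>s w. \<Sum>k = 0..<n. B $$ (i, k) * ?X k s w))" if "0 \<le> t" for B i t
    unfolding cutoff_sum[abs_def] using that by (intro sq_integrable_sum sq_integrable_scale sq) auto
  have ad: "?X i t \<in> borel_measurable (F t)" if "i < n" "0 \<le> t" for i t
    by (rule square_integrable_process_adapted[OF sqp[OF that] that(2)])
  have J: "\<exists>J. ito_pair (cutoff t (\<lambda>s w. \<Sum>k = 0..<n. C $$ (i, k) * ?X k s w)) J \<and>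
      (AE w in M. ?X i t w = x0 $ i + (\<integral>s. cutoff t (\<lambda>s w. \<Sum>k = 0..<n. A $$ (i, k) * ?X k s w) (w, s) \<partial>lborel) + J w)"
    if it: "i < n" "0 \<le> t" for i t
  proof -
    obtain J where J: "has_ito_integral M F W t (\<lambda>s w. (C *\<^sub>v x s w) $ i) J"
      and eq: "AE w in M. x t w $ i = x0 $ i + (LINT s:{0..t}|lborel. (A *\<^sub>v x s w) $ i) + J w"
      using conjunct2[OF conjunct2[OF conjunct2[OF sol[unfolded linear_sde_solution_def]]], rule_format, OF it]
      by blast
    have "cutoff t (\<lambda>s w. (C *\<^sub>v x s w) $ i) p = cutoff t (\<lambda>s w. \<Sum>k = 0..<n. C $$ (i, k) * ?X k s w) p"
      if "p \<in> space ?P" for p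
      using mult[OF C _ _ \<open>i < n\<close>, of "snd p" "fst p"] that
      by (auto simp: cutoff_def space_pair_measure split: split_indicator)
    moreover obtain \<phi> I where "\<forall>l. step_pair (\<phi> l) (I l)" "tends_L2 ?P \<phi> (cutoff t (\<lambda>s w. (C *\<^sub>v x s w) $ i))" "tends_L2 M I J"
      using has_ito_integral_ito_pair[OF J it(2)] unfolding ito_pair_def by blast
    ultimately have "ito_pair (cutoff t (\<lambda>s w. \<Sum>k = 0..<n. C $$ (i, k) * ?X k s w)) J"
      unfolding ito_pair_def using tends_L2_cong[of ?P \<phi>] by blast
    moreover have "AE w in M. ?X i t w = x0 $ i + (\<integral>s. cutoff t (\<lambda>s w. \<Sum>k = 0..<n. A $$ (i, k) * ?X k s w) (w, s) \<partial>lborel) + J w"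
      using eq AE_space
    proof eventually_elim
      fix w assume w: "w \<in> space M"
        and *: "x t w $ i = x0 $ i + (LINT s:{0..t}|lborel. (A *\<^sub>v x s w) $ i) + J w"
      have "(LINT s:{0..t}|lborel. (A *\<^sub>v x s w) $ i) =
        (\<integral>s. cutoff t (\<lambda>s w. \<Sum>k = 0..<n. A $$ (i, k) * ?X k s w) (w, s) \<partial>lborel)"
        unfolding set_lebesgue_integral_def
        by (rule Bochner_Integration.integral_cong) (auto simp: mult[OF A _ w it(1)] split: split_indicator)
      with * show "?X i t w = x0 $ i + (\<integral>s. cutoff t (\<lambda>s w. \<Sum>k = 0..<n. A $$ (i, k) * ?X k s w) (w, s) \<partial>lborel) + J w"
        by simp
    qed
    ultimately show ?thesis by blast
  qed
  show sqM: "sq_integrable M (?X i t)" if it: "i < n" "0 \<le> t" for i t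
  proof -
    obtain J where "ito_pair (cutoff t (\<lambda>s w. \<Sum>k = 0..<n. C $$ (i, k) * ?X k s w)) J"
      "AE w in M. ?X i t w = x0 $ i + (\<integral>s. cutoff t (\<lambda>s w. \<Sum>k = 0..<n. A $$ (i, k) * ?X k s w) (w, s) \<partial>lborel) + J w"
      using J[OF it] by blast
    then show ?thesis
      by (intro sq_integrable_drift_martingale[OF sqs[OF it(2)] ito_pair_sq_integrable(2) F_measurable_M[OF ad[OF it]]])
  qed
  show "linear_ito_system n (\<lambda>i j. A $$ (i, j)) (\<lambda>i j. C $$ (i, j)) (\<lambda>i. x0 $ i) ?X"
    unfolding linear_ito_system_def ito_process_def
    using sq sqs F_measurable_M[OF ad] J
    by (intro allI impI conjI sq_integrable_sum sq_integrable_scale sqM borel_measurable_sum borel_measurable_times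
        borel_measurable_const ad) auto
qed

text \<open>The expected squared norm is the sum \<open>r t\<close> of the component moments, all
  nonnegative, so it dominates each of them. Finiteness of these moments carries the limit from
  \<open>[0, \<infinity>]\<close> to the reals.\<close>

lemma component_decay:
  assumes sol: "linear_sde_solution M F W n A C x0 x"
    and A: "A \<in> carrier_mat n n" and C: "C \<in> carrier_mat n n"
    and lim: "((\<lambda>t. \<integral>\<^sup>+w. ennreal (scalar_prod (x t w) (x t w)) \<partial>M) \<longlongrightarrow> 0) at_top"
    and i: "i < n"
  shows "((\<lambda>t. expectation (\<lambda>w. (x t w $ i)\<^sup>2)) \<longlongrightarrow> 0) at_top"
proof -
  note sq = linear_sde_solution_system(2)[OF sol A C]
  define r where "r t = (\<Sum>k = 0..<n. expectation (\<lambda>w. (x t w $ k)\<^sup>2))" for t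
  have E0: "0 \<le> expectation (\<lambda>w. (x t w $ k)\<^sup>2)" for t k by (rule integral_nonneg_AE) simp
  then have r0: "0 \<le> r t" for t unfolding r_def by (intro sum_nonneg)
  have eq: "(\<integral>\<^sup>+w. ennreal (scalar_prod (x t w) (x t w)) \<partial>M) = ennreal (r t)" if t: "0 \<le> t" for t
  proof -
    have int: "integrable M (\<lambda>w. (x t w $ k)\<^sup>2)" if "k \<in> {0..<n}" for k
      using sq[of k t] t that by (simp add: sq_integrable_def)
    have "(\<integral>\<^sup>+w. ennreal (scalar_prod (x t w) (x t w)) \<partial>M) = (\<integral>\<^sup>+w. ennreal (\<Sum>k = 0..<n. (x t w $ k)\<^sup>2) \<partial>M)"
    proof (rule nn_integral_cong)
      fix w assume "w \<in> space M"
      then have "x t w \<in> carrier_vec n" using sol t by (auto simp: linear_sde_solution_def)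
      then show "ennreal (scalar_prod (x t w) (x t w)) = ennreal (\<Sum>k = 0..<n. (x t w $ k)\<^sup>2)"
        by (simp add: scalar_prod_def power2_eq_square)
    qed
    also have "\<dots> = ennreal (expectation (\<lambda>w. \<Sum>k = 0..<n. (x t w $ k)\<^sup>2))"
      by (intro nn_integral_eq_integral Bochner_Integration.integrable_sum int AE_I2 sum_nonneg) auto
    also have "expectation (\<lambda>w. \<Sum>k = 0..<n. (x t w $ k)\<^sup>2) = r t"
      unfolding r_def by (rule Bochner_Integration.integral_sum) (rule int)
    finally show ?thesis .
  qed
  have "\<forall>\<^sub>F t in at_top. (\<integral>\<^sup>+w. ennreal (scalar_prod (x t w) (x t w)) \<partial>M) = ennreal (r t)"
    using eventually_ge_at_top[of 0] by eventually_elim (rule eq)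
  from Lim_transform_eventually[OF lim this]
  have "((\<lambda>t. ennreal (r t)) \<longlongrightarrow> ennreal 0) at_top" by simp
  then have rlim: "(r \<longlongrightarrow> 0) at_top"
    by (subst (asm) tendsto_ennreal_iff) (auto simp: r0)
  show ?thesis
  proof (rule tendsto_sandwich[OF _ _ tendsto_const rlim])
    show "\<forall>\<^sub>F t in at_top. expectation (\<lambda>w. (x t w $ i)\<^sup>2) \<le> r t"
      unfolding r_def by (rule always_eventually) (use i E0 in \<open>auto intro!: member_le_sum\<close>)
  qed (simp add: E0)
qed

text \<open>Cauchy-Schwarz extends the decay to mixed moments of two different solutions, as
  injectivity on nonsymmetric matrices requires.\<close>

lemma cross_moment_decay:
  assumes X: "\<And>t. 0 \<le> t \<Longrightarrow> sq_integrable M (X t)" and Y: "\<And>t. 0 \<le> t \<Longrightarrow> sq_integrable M (Y t)"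
    and Xlim: "((\<lambda>t. expectation (\<lambda>w. (X t w)\<^sup>2)) \<longlongrightarrow> 0) at_top"
    and Ylim: "((\<lambda>t. expectation (\<lambda>w. (Y t w)\<^sup>2)) \<longlongrightarrow> 0) at_top"
  shows "((\<lambda>t. expectation (\<lambda>w. X t w * Y t w)) \<longlongrightarrow> 0) (at_top :: real filter)"
proof -
  have "((\<lambda>t. (expectation (\<lambda>w. X t w * Y t w))\<^sup>2) \<longlongrightarrow> 0) at_top"
  proof (rule tendsto_sandwich[OF _ _ tendsto_const])
    show "((\<lambda>t. expectation (\<lambda>w. (X t w)\<^sup>2) * expectation (\<lambda>w. (Y t w)\<^sup>2)) \<longlongrightarrow> 0) at_top"
      using tendsto_mult[OF Xlim Ylim] by simp
    show "\<forall>\<^sub>F t in at_top. (expectation (\<lambda>w. X t w * Y t w))\<^sup>2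
        \<le> expectation (\<lambda>w. (X t w)\<^sup>2) * expectation (\<lambda>w. (Y t w)\<^sup>2)"
      using eventually_ge_at_top[of 0] by eventually_elim (intro integral_Cauchy_Schwarz X Y)
  qed simp
  from tendsto_real_sqrt[OF this] show ?thesis by (simp add: tendsto_rabs_zero_iff)
qed

lemma stable_solution:
  assumes "mean_square_stable M F W n A C" and A: "A \<in> carrier_mat n n" and C: "C \<in> carrier_mat n n"
    and v: "v \<in> carrier_vec n"
  obtains X where "linear_ito_system n (\<lambda>i j. A $$ (i, j)) (\<lambda>i j. C $$ (i, j)) (\<lambda>i. v $ i) X"
    and "\<And>i t. i < n \<Longrightarrow> 0 \<le> t \<Longrightarrow> sq_integrable M (X i t)"
    and "\<And>i. i < n \<Longrightarrow> ((\<lambda>t. expectation (\<lambda>w. (X i t w)\<^sup>2)) \<longlongrightarrow> 0) at_top"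
proof -
  obtain x where x: "linear_sde_solution M F W n A C v x"
    "((\<lambda>t. \<integral>\<^sup>+w. ennreal (scalar_prod (x t w) (x t w)) \<partial>M) \<longlongrightarrow> 0) at_top"
    using assms(1) v unfolding mean_square_stable_def by blast
  show ?thesis
    by (rule that[of "\<lambda>i t w. x t w $ i"])
      (use linear_sde_solution_system[OF x(1) A C] component_decay[OF x(1) A C x(2)] in auto)
qed

theorem lyapunov_operator_injective:
  assumes stable: "mean_square_stable M F W n A C"
    and A: "A \<in> carrier_mat n n" and C: "C \<in> carrier_mat n n" and G: "G \<in> carrier_mat n n"
    and zero: "G * A + transpose_mat A * G + transpose_mat C * G * C = 0\<^sub>m n n"
  shows "G = 0\<^sub>m n n"
proof (rule eq_matI)
  fix a b assume "a < dim_row (0\<^sub>m n n :: real mat)" "b < dim_col (0\<^sub>m n n :: real mat)"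
  then have ab: "a < n" "b < n" by auto
  \<comment> \<open>Starting from two unit vectors isolates the entry \<open>(a, b)\<close> of
    \<open>G\<close>: the pairing \<open>?Z\<close> keeps this value for all times and also tends to
    0.\<close>
  obtain X where X: "linear_ito_system n (\<lambda>i j. A $$ (i, j)) (\<lambda>i j. C $$ (i, j)) (\<lambda>i. unit_vec n a $ i) X"
    "\<And>i t. i < n \<Longrightarrow> 0 \<le> t \<Longrightarrow> sq_integrable M (X i t)"
    "\<And>i. i < n \<Longrightarrow> ((\<lambda>t. expectation (\<lambda>w. (X i t w)\<^sup>2)) \<longlongrightarrow> 0) at_top"
    using stable_solution[OF stable A C unit_vec_carrier[of n a]] by blast
  obtain Y where Y: "linear_ito_system n (\<lambda>i j. A $$ (i, j)) (\<lambda>i j. C $$ (i, j)) (\<lambda>i. unit_vec n b $ i) Y"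
    "\<And>i t. i < n \<Longrightarrow> 0 \<le> t \<Longrightarrow> sq_integrable M (Y i t)"
    "\<And>i. i < n \<Longrightarrow> ((\<lambda>t. expectation (\<lambda>w. (Y i t w)\<^sup>2)) \<longlongrightarrow> 0) at_top"
    using stable_solution[OF stable A C unit_vec_carrier[of n b]] by blast
  let ?Z = "\<lambda>t. \<Sum>i = 0..<n. \<Sum>j = 0..<n. G $$ (i, j) * expectation (\<lambda>w. X i t w * Y j t w)"
  have "?Z t = G $$ (a, b)" if t: "0 \<le> t" for t
  proof -
    have "?Z t = (\<Sum>i = 0..<n. \<Sum>j = 0..<n. G $$ (i, j) * (unit_vec n a $ i * unit_vec n b $ j))"
      using lyapunov_operator_index[OF G A C] zero
      by (subst bilinear_moment_eq[OF X(1) Y(1) t]) simp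
    also have "\<dots> = (\<Sum>i = 0..<n. if i = a then G $$ (a, b) else 0)"
      using ab by (intro sum.cong refl) (auto simp: if_distrib[of "\<lambda>z. _ * z"] cong: if_cong)
    finally show ?thesis using ab by simp
  qed
  then have "(?Z \<longlongrightarrow> G $$ (a, b)) at_top"
    by (intro tendsto_eventually eventually_mono[OF eventually_ge_at_top[of 0]]) 
  moreover have "(?Z \<longlongrightarrow> (\<Sum>i = 0..<n. \<Sum>j = 0..<n. G $$ (i, j) * 0)) at_top"
    using X(2,3) Y(2,3) by (intro tendsto_sum tendsto_mult tendsto_const cross_moment_decay) auto
  ultimately have "G $$ (a, b) = (\<Sum>i = 0..<n. \<Sum>j = 0..<n. G $$ (i, j) * 0)"
    by (rule tendsto_unique[OF trivial_limit_at_top_linorder])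
  then show "G $$ (a, b) = 0\<^sub>m n n $$ (a, b)" using ab by simp
qed (use G in auto)

text \<open>The improper integral is represented by the finite-horizon integrals \<open>I t\<close>
  and their limit. Monotonicity and nonnegativity alone would give a nonnegative value; the
  contradiction supplies strictness.\<close>

theorem lyapunov_solution_positive:
  assumes stable: "mean_square_stable M F W n A C"
    and A: "A \<in> carrier_mat n n" and C: "C \<in> carrier_mat n n" and P: "P \<in> carrier_mat n n"
    and Q: "Q \<in> sym_pos_def n"
    and eq: "P * A + transpose_mat A * P + transpose_mat C * P * C = - Q"
    and v: "v \<in> carrier_vec n" "v \<noteq> 0\<^sub>v n"
  shows "v \<bullet> (P *\<^sub>v v) > 0"
proof (rule ccontr)
  assume "\<not> v \<bullet> (P *\<^sub>v v) > 0"
  then have neg: "v \<bullet> (P *\<^sub>v v) \<le> 0" by simp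
  let ?P = "M \<Otimes>\<^sub>M lborel :: ('a \<times> real) measure"
  have Qc: "Q \<in> carrier_mat n n" using Q by (simp add: sym_pos_def_def)
  obtain X where X: "linear_ito_system n (\<lambda>i j. A $$ (i, j)) (\<lambda>i j. C $$ (i, j)) (\<lambda>i. v $ i) X"
    "\<And>i t. i < n \<Longrightarrow> 0 \<le> t \<Longrightarrow> sq_integrable M (X i t)"
    "\<And>i. i < n \<Longrightarrow> ((\<lambda>t. expectation (\<lambda>w. (X i t w)\<^sup>2)) \<longlongrightarrow> 0) at_top"
    using stable_solution[OF stable A C v(1)] by blast
  have sq: "sq_integrable ?P (cutoff t (X i))" if "i < n" "0 \<le> t" for i t
    using X(1) that ito_processD(1) unfolding linear_ito_system_def by blast
  \<comment> \<open>Built from cutoffs, \<open>u t\<close> vanishes outside \<open>[0, t]\<close>,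
    so the integrand \<open>q t\<close> is defined on the whole product space and increases with
    \<open>t\<close>.\<close>
  define u where "u t p = vec n (\<lambda>i. cutoff t (X i) p)" for t p
  define q where "q t p = u t p \<bullet> (Q *\<^sub>v u t p)" for t p
  have uc: "u t p \<in> carrier_vec n" for t p by (simp add: u_def)
  have q_sum: "q t p = (\<Sum>i = 0..<n. \<Sum>j = 0..<n. Q $$ (i, j) * (cutoff t (X i) p * cutoff t (X j) p))" for t p
    unfolding q_def quadratic_form_sum[OF Qc uc] by (simp add: u_def)
  have q_pos: "q t p > 0" if "u t p \<noteq> 0\<^sub>v n" for t p
    using Q uc that unfolding q_def by (simp add: sym_pos_def_def)
  have q_nonneg: "0 \<le> q t p" for t p
  proof (cases "u t p = 0\<^sub>v n")
    case True
    then show ?thesis using Qc by (simp add: q_def)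
  next
    case False
    from q_pos[OF this] show ?thesis by simp
  qed
  have q_mono: "q s p \<le> q t p" if "0 \<le> s" "s \<le> t" for s t p
  proof (cases "snd p \<in> {0..s}")
    case True
    then have "u s p = u t p" using that by (auto simp: u_def cutoff_def intro!: eq_vecI)
    then show ?thesis by (simp add: q_def)
  next
    case False
    then have "u s p = 0\<^sub>v n" by (auto simp: u_def cutoff_def intro!: eq_vecI)
    then have "q s p = 0" using Qc by (simp add: q_def)
    then show ?thesis using q_nonneg by simp
  qed
  have int: "integrable ?P (\<lambda>p. cutoff t (X i) p * cutoff t (X j) p)" if "i < n" "j < n" "0 \<le> t" for i j t
    by (intro sq_integrable_mult sq that)
  have q_inner: "integrable ?P (\<lambda>p. \<Sum>j = 0..<n. Q $$ (i, j) * (cutoff t (X i) p * cutoff t (X j) p))"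
    if "i < n" "0 \<le> t" for i t
    by (rule integrable_linear_combination, rule int) (use that in auto)
  have q_int: "integrable ?P (q t)" if "0 \<le> t" for t
    unfolding q_sum[abs_def] by (rule Bochner_Integration.integrable_sum, rule q_inner) (use that in auto)
  define I where "I t = (\<integral>p. q t p \<partial>?P)" for t
  have I_sum: "I t = (\<Sum>i = 0..<n. \<Sum>j = 0..<n. Q $$ (i, j) * occupation X X t i j)" if "0 \<le> t" for t
  proof -
    have "I t = (\<Sum>i = 0..<n. \<integral>p. (\<Sum>j = 0..<n. Q $$ (i, j) * (cutoff t (X i) p * cutoff t (X j) p)) \<partial>?P)"
      unfolding I_def q_sum by (rule Bochner_Integration.integral_sum, rule q_inner) (use that in auto)
    also have "\<dots> = (\<Sum>i = 0..<n. \<Sum>j = 0..<n. Q $$ (i, j) * occupation X X t i j)"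
      unfolding occupation_def
      by (rule sum.cong[OF refl], rule integral_linear_combination, rule int) (use that in auto)
    finally show ?thesis .
  qed
  have I_nonneg: "0 \<le> I t" for t unfolding I_def by (rule integral_nonneg_AE) (simp add: q_nonneg)
  let ?Z = "\<lambda>t. \<Sum>i = 0..<n. \<Sum>j = 0..<n. P $$ (i, j) * expectation (\<lambda>w. X i t w * X j t w)"
  have Z: "I t = v \<bullet> (P *\<^sub>v v) - ?Z t" if t: "0 \<le> t" for t
  proof -
    \<comment> \<open>\<open>bilinear_moment_eq\<close> is applied with both systems equal to
      \<open>X\<close>; the Lyapunov equation turns its coefficients into the entries of
      \<open>- Q\<close>.\<close>
    have "?Z t = v \<bullet> (P *\<^sub>v v) + (\<Sum>k = 0..<n. \<Sum>l = 0..<n. (- Q) $$ (k, l) * occupation X X t k l)"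
      unfolding bilinear_moment_eq[OF X(1) X(1) t] quadratic_form_sum[OF P v(1)]
      by (intro arg_cong2[of _ _ _ _ "(+)"] refl sum.cong)
        (simp add: eq[symmetric] lyapunov_operator_index[OF P A C])
    also have "\<dots> = v \<bullet> (P *\<^sub>v v) - I t"
      using Qc by (simp add: I_sum[OF t] sum_negf)
    finally show ?thesis by simp
  qed
  have "(?Z \<longlongrightarrow> (\<Sum>i = 0..<n. \<Sum>j = 0..<n. P $$ (i, j) * 0)) at_top"
    using X(2,3) by (intro tendsto_sum tendsto_mult tendsto_const cross_moment_decay) auto
  then have Zlim: "(?Z \<longlongrightarrow> 0) at_top" by simp
  have "((\<lambda>t. v \<bullet> (P *\<^sub>v v) - ?Z t) \<longlongrightarrow> v \<bullet> (P *\<^sub>v v) - 0) at_top"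
    by (intro tendsto_diff tendsto_const Zlim)
  moreover have "\<forall>\<^sub>F t in at_top. v \<bullet> (P *\<^sub>v v) - ?Z t = I t"
    using eventually_ge_at_top[of 0] by eventually_elim (rule Z[symmetric])
  ultimately have "(I \<longlongrightarrow> v \<bullet> (P *\<^sub>v v) - 0) at_top"
    by (rule Lim_transform_eventually)
  then have Ilim: "(I \<longlongrightarrow> v \<bullet> (P *\<^sub>v v)) at_top" by simp
  \<comment> \<open>\<open>I\<close> is nonnegative and increases to \<open>v \<bullet> P v \<le> 0\<close>, hence vanishes; then the solution is null and
    its second moments are constant, contradicting their decay unless \<open>v = 0\<close>.\<close>
  have I_zero: "I t = 0" if t: "0 \<le> t" for t
  proof -
    have "I t \<le> v \<bullet> (P *\<^sub>v v)"
    proof (rule tendsto_lowerbound[OF Ilim _ trivial_limit_at_top_linorder])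
      show "\<forall>\<^sub>F s in at_top. I t \<le> I s"
        using eventually_ge_at_top[of t]
      proof eventually_elim
        fix s assume "t \<le> s"
        then show "I t \<le> I s" unfolding I_def
          using t by (intro integral_mono q_int q_mono) auto
      qed
    qed
    then show ?thesis using neg I_nonneg[of t] by simp
  qed
  have occ: "occupation X X t i j = 0" if t: "0 \<le> t" and ij: "i < n" "j < n" for t i j
  proof -
    have "AE p in ?P. q t p = 0"
      using integral_nonneg_eq_0_iff_AE[OF q_int[OF t]] I_zero[OF t] q_nonneg by (simp add: I_def)
    then have "AE p in ?P. cutoff t (X i) p * cutoff t (X j) p = 0"
    proof eventually_elim
      fix p assume "q t p = 0"
      then have "u t p = 0\<^sub>v n" using q_pos[of t p] by (cases "u t p = 0\<^sub>v n") auto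
      then have "u t p $ i = 0" using ij by simp
      then show "cutoff t (X i) p * cutoff t (X j) p = 0" using ij by (simp add: u_def)
    qed
    then have "occupation X X t i j = (\<integral>p. 0 \<partial>?P)"
      unfolding occupation_def by (intro integral_cong_AE borel_measurable_integrable[OF int[OF ij t]]) auto
    then show ?thesis by simp
  qed
  have "v $ i = 0" if i: "i < n" for i
  proof -
    have "expectation (\<lambda>w. X i t w * X i t w) = v $ i * v $ i" if t: "0 \<le> t" for t
      unfolding second_moment_eq[OF X(1) X(1) t i i] using occ[OF t] i by simp
    then have "((\<lambda>t. expectation (\<lambda>w. X i t w * X i t w)) \<longlongrightarrow> v $ i * v $ i) at_top"
      by (intro tendsto_eventually eventually_mono[OF eventually_ge_at_top[of 0]])
    moreover have "((\<lambda>t. expectation (\<lambda>w. X i t w * X i t w)) \<longlongrightarrow> 0) at_top"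
      using X(3)[OF i] by (simp add: power2_eq_square)
    ultimately have "v $ i * v $ i = 0" by (rule tendsto_unique[OF trivial_limit_at_top_linorder])
    then show ?thesis by simp
  qed
  then have "v = 0\<^sub>v n" using v(1) by (intro eq_vecI) auto
  with v(2) show False ..
qed

end

section \<open>Linear algebra\<close>

text \<open>A trivial kernel means a nonzero determinant, hence a unit of the matrix ring; then
  \<open>mat_inverse\<close> returns \<open>Some\<close> and \<open>the\<close> in
  \<open>mat_inv\<close> is meaningful.\<close>

lemma mat_inv_inverse:
  fixes A :: "real mat"
  assumes A: "A \<in> carrier_mat n n"
    and ker: "\<And>v. v \<in> carrier_vec n \<Longrightarrow> A *\<^sub>v v = 0\<^sub>v n \<Longrightarrow> v = 0\<^sub>v n"
  shows "A * mat_inv A = 1\<^sub>m n" "mat_inv A * A = 1\<^sub>m n" "mat_inv A \<in> carrier_mat n n"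
proof -
  have "det A \<noteq> 0" using det_0_iff_vec_prod_zero_field[OF A] ker by blast
  then have "A \<in> Units (ring_mat TYPE(real) n ())" by (rule det_non_zero_imp_unit[OF A])
  then obtain B where "mat_inverse A = Some B"
    using mat_inverse(1)[OF A, where b="()"] by (cases "mat_inverse A") auto
  with mat_inverse(2)[OF A this]
  show "A * mat_inv A = 1\<^sub>m n" "mat_inv A * A = 1\<^sub>m n" "mat_inv A \<in> carrier_mat n n"
    by (simp_all add: mat_inv_def)
qed

text \<open>Division with remainder identifies the flat index with a pair, the form in which both
  Kronecker products and vectorizations are indexed.\<close>

lemma sum_div_mod:
  fixes g :: "nat \<Rightarrow> nat \<Rightarrow> 'b::comm_monoid_add"
  shows "(\<Sum>c = 0..<r * q. g (c div q) (c mod q)) = (\<Sum>d = 0..<r. \<Sum>e = 0..<q. g d e)"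
proof -
  have "(\<Sum>c = 0..<r * q. g (c div q) (c mod q)) = (\<Sum>d<r. \<Sum>c = d * q..<d * q + q. g (c div q) (c mod q))"
    by (simp add: sum.nat_group atLeast0LessThan)
  also have "\<dots> = (\<Sum>d<r. \<Sum>e = 0..<q. g d e)"
  proof (rule sum.cong[OF refl])
    fix d
    have "(\<Sum>c = d * q..<d * q + q. g (c div q) (c mod q)) = (\<Sum>e = 0..<q. g ((e + d * q) div q) ((e + d * q) mod q))"
      using sum.shift_bounds_nat_ivl[of "\<lambda>c. g (c div q) (c mod q)" 0 "d * q" q] by (simp add: add.commute)
    also have "\<dots> = (\<Sum>e = 0..<q. g d e)" by (rule sum.cong) auto
    finally show "(\<Sum>c = d * q..<d * q + q. g (c div q) (c mod q)) = (\<Sum>e = 0..<q. g d e)" .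
  qed
  finally show ?thesis by (simp add: atLeast0LessThan)
qed

lemma kronecker_carrier [simp]:
  "A \<in> carrier_mat a b \<Longrightarrow> B \<in> carrier_mat c d \<Longrightarrow> A \<otimes>\<^sub>K B \<in> carrier_mat (a * c) (b * d)"
  by (intro carrier_matI) auto

lemma vectorize_carrier [simp]: "A \<in> carrier_mat a b \<Longrightarrow> vectorize A \<in> carrier_vec (a * b)"
  by (intro carrier_vecI) auto

lemma mat_sum_carrier [simp]: "mat_sum nr nc f I \<in> carrier_mat nr nc"
  by (simp add: mat_sum_def)

lemma append_cols_carrier [simp]:
  "A \<in> carrier_mat r a \<Longrightarrow> B \<in> carrier_mat r b \<Longrightarrow> A @\<^sub>c B \<in> carrier_mat r (a + b)"
  by (intro carrier_matI) auto

lemma div_mod_less: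
  fixes k p s :: nat
  assumes "k < s * p"
  shows "k div p < s" "k mod p < p"
proof -
  have "0 < p" using assms by (cases p) auto
  then show "k mod p < p" by simp
  show "k div p < s" using assms by (rule less_mult_imp_div_less)
qed

text \<open>Column-wise storage makes \<open>k mod p\<close> the row and \<open>k div p\<close> the
  column of the result; in the summation index, likewise, \<open>c mod q\<close> is the row and
  \<open>c div q\<close> the column of \<open>X\<close>. Both sides are then the same double
  sum.\<close>

lemma kronecker_mult_vectorize:
  assumes A: "A \<in> carrier_mat p q" and X: "X \<in> carrier_mat q r" and B: "B \<in> carrier_mat r s"
  shows "(transpose_mat B \<otimes>\<^sub>K A) *\<^sub>v vectorize X = vectorize (A * X * B)"
proof (rule eq_vecI)
  fix k assume "k < dim_vec (vectorize (A * X * B))"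
  then have k: "k < s * p" using A B by (simp add: mult.commute)
  note b = div_mod_less[OF k]
  have "((transpose_mat B \<otimes>\<^sub>K A) *\<^sub>v vectorize X) $ k =
    (\<Sum>c = 0..<r * q. B $$ (c div q, k div p) * A $$ (k mod p, c mod q) * X $$ (c mod q, c div q))"
    using A B X k b div_mod_less[of _ r q]
    by (auto simp: scalar_prod_def kronecker_def vectorize_def mult.commute[of q r] intro!: sum.cong)
  also have "\<dots> = (\<Sum>d = 0..<r. \<Sum>e = 0..<q. B $$ (d, k div p) * A $$ (k mod p, e) * X $$ (e, d))"
    by (rule sum_div_mod[of "\<lambda>d e. B $$ (d, k div p) * A $$ (k mod p, e) * X $$ (e, d)"])
  also have "\<dots> = (\<Sum>d = 0..<r. (\<Sum>e = 0..<q. A $$ (k mod p, e) * X $$ (e, d)) * B $$ (d, k div p))"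
    by (simp only: sum_distrib_right) (simp add: mult_ac)
  also have "\<dots> = (A * X * B) $$ (k mod p, k div p)"
  proof -
    have "(A * X * B) $$ (k mod p, k div p) = (\<Sum>d = 0..<r. (A * X) $$ (k mod p, d) * B $$ (d, k div p))"
      using A X B b by (simp add: scalar_prod_def del: assoc_mult_mat)
    also have "\<dots> = (\<Sum>d = 0..<r. (\<Sum>e = 0..<q. A $$ (k mod p, e) * X $$ (e, d)) * B $$ (d, k div p))"
      using A X B b by (intro sum.cong refl) (simp add: scalar_prod_def)
    finally show ?thesis ..
  qed
  also have "\<dots> = vectorize (A * X * B) $ k"
    using A B k by (simp add: vectorize_def mult.commute)
  finally show "((transpose_mat B \<otimes>\<^sub>K A) *\<^sub>v vectorize X) $ k = vectorize (A * X * B) $ k" .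
qed (use A B in \<open>simp add: mult.commute\<close>)

lemma vectorize_add:
  "X \<in> carrier_mat a b \<Longrightarrow> Y \<in> carrier_mat a b \<Longrightarrow> vectorize (X + Y) = vectorize X + vectorize Y"
  using div_mod_less[of _ b a] by (intro eq_vecI) (auto simp: vectorize_def mult.commute[of a b])

lemma vectorize_minus:
  "X \<in> carrier_mat a b \<Longrightarrow> Y \<in> carrier_mat a b \<Longrightarrow> vectorize (X - Y) = vectorize X - vectorize Y"
  using div_mod_less[of _ b a] by (intro eq_vecI) (auto simp: vectorize_def mult.commute[of a b])

lemma vectorize_uminus: "X \<in> carrier_mat a b \<Longrightarrow> vectorize (- X) = - vectorize X"
  using div_mod_less[of _ b a] by (intro eq_vecI) (auto simp: vectorize_def mult.commute[of a b])

lemma vectorize_zero: "vectorize (0\<^sub>m a b) = 0\<^sub>v (a * b)"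
  using div_mod_less[of _ b a] by (intro eq_vecI) (auto simp: vectorize_def mult.commute[of a b])

text \<open>The common shape must be prescribed, because a vectorization remembers only the product
  of the dimensions.\<close>

lemma vectorize_inject:
  assumes X: "X \<in> carrier_mat a b" and Y: "Y \<in> carrier_mat a b" and eq: "vectorize X = vectorize Y"
  shows "X = Y"
proof (rule eq_matI)
  fix i j assume "i < dim_row Y" "j < dim_col Y"
  then have ij: "i < a" "j < b" using Y by auto
  have "j * a + i < Suc j * a" using ij by simp
  also have "\<dots> \<le> b * a" using ij by (intro mult_right_mono) auto
  finally have "j * a + i < a * b" by (simp add: mult.commute)
  with arg_cong[OF eq, of "\<lambda>v. v $ (j * a + i)"] X Y ij show "X $$ (i, j) = Y $$ (i, j)"
    by (simp add: vectorize_def)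
qed (use X Y in auto)

lemma vectorize_surj:
  assumes v: "v \<in> carrier_vec (a * b)"
  obtains X where "X \<in> carrier_mat a b" "vectorize X = v"
proof
  let ?X = "mat a b (\<lambda>(i, j). v $ (j * a + i))"
  show "?X \<in> carrier_mat a b" by simp
  show "vectorize ?X = v"
    using v div_mod_less[of _ b a] by (intro eq_vecI) (auto simp: vectorize_def mult.commute[of a b])
qed

lemma vectorize_mat_sum:
  assumes "\<And>j. j \<in> I \<Longrightarrow> f j \<in> carrier_mat a b" and "k < a * b"
  shows "vectorize (mat_sum a b f I) $ k = (\<Sum>j\<in>I. vectorize (f j) $ k)"
proof -
  have "vectorize (mat_sum a b f I) $ k = (\<Sum>j\<in>I. f j $$ (k mod a, k div a))"
    using assms(2) div_mod_less[of k b a] by (simp add: vectorize_def mat_sum_def mult.commute[of a b])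
  also have "\<dots> = (\<Sum>j\<in>I. vectorize (f j) $ k)"
  proof (rule sum.cong[OF refl])
    fix j assume "j \<in> I"
    from assms(1)[OF this] assms(2) show "f j $$ (k mod a, k div a) = vectorize (f j) $ k"
      by (simp add: vectorize_def)
  qed
  finally show ?thesis .
qed

lemma mat_sum_mult_vec:
  assumes f: "\<And>j. j \<in> I \<Longrightarrow> f j \<in> carrier_mat a b" and v: "v \<in> carrier_vec b" and k: "k < a"
  shows "(mat_sum a b f I *\<^sub>v v) $ k = (\<Sum>j\<in>I. (f j *\<^sub>v v) $ k)"
proof -
  have "(mat_sum a b f I *\<^sub>v v) $ k = (\<Sum>c = 0..<b. \<Sum>j\<in>I. f j $$ (k, c) * v $ c)"
    using v k by (simp add: scalar_prod_def mat_sum_def sum_distrib_right)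
  also have "\<dots> = (\<Sum>j\<in>I. \<Sum>c = 0..<b. f j $$ (k, c) * v $ c)" by (rule sum.swap)
  also have "\<dots> = (\<Sum>j\<in>I. (f j *\<^sub>v v) $ k)"
  proof (rule sum.cong[OF refl])
    fix j assume "j \<in> I"
    from f[OF this] show "(\<Sum>c = 0..<b. f j $$ (k, c) * v $ c) = (f j *\<^sub>v v) $ k"
      using v k by (simp add: scalar_prod_def)
  qed
  finally show ?thesis .
qed

section \<open>Block rows acting on stacked vectors\<close>

text \<open>A block row is a four-block matrix whose lower blocks have no rows, so the four-block
  product rule applies and its lower half is the empty vector.\<close>

lemma append_cols_mult_append_vec:
  assumes A: "A \<in> carrier_mat r a" and B: "B \<in> carrier_mat r b"
    and v: "v \<in> carrier_vec a" and w: "w \<in> carrier_vec b"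
  shows "(A @\<^sub>c B) *\<^sub>v (v @\<^sub>v w) = A *\<^sub>v v + B *\<^sub>v w"
proof -
  have "(A @\<^sub>c B) *\<^sub>v (v @\<^sub>v w) = (A *\<^sub>v v + B *\<^sub>v w) @\<^sub>v (0\<^sub>m 0 a *\<^sub>v v + 0\<^sub>m 0 b *\<^sub>v w)"
    unfolding append_cols_def
    using four_block_mat_mult_vec[OF A B _ _ v w, of "0\<^sub>m 0 (dim_col A)" 0 "0\<^sub>m 0 (dim_col B)"] A B by auto
  also have "\<dots> = A *\<^sub>v v + B *\<^sub>v w"
    using A B v w by (intro eq_vecI) auto
  finally show ?thesis .
qed

text \<open>The blocks may have different widths \<open>len j\<close>. The sum of the block products
  is taken component by component, since the zero vector depends on the dimension; the two carrier
  claims are needed to apply the induction hypothesis to the product.\<close>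

lemma foldr_append_cols_mult:
  fixes block :: "nat \<Rightarrow> real mat" and r :: "nat \<Rightarrow> real vec"
  assumes "\<And>j. j \<in> set js \<Longrightarrow> block j \<in> carrier_mat d (len j)"
    and "\<And>j. j \<in> set js \<Longrightarrow> r j \<in> carrier_vec (len j)"
  shows "foldr (\<lambda>j X. block j @\<^sub>c X) js (0\<^sub>m d 0) \<in> carrier_mat d (\<Sum>j\<leftarrow>js. len j)"
    and "foldr (\<lambda>j v. r j @\<^sub>v v) js (0\<^sub>v 0) \<in> carrier_vec (\<Sum>j\<leftarrow>js. len j)"
    and "foldr (\<lambda>j X. block j @\<^sub>c X) js (0\<^sub>m d 0) *\<^sub>v foldr (\<lambda>j v. r j @\<^sub>v v) js (0\<^sub>v 0) =
      vec d (\<lambda>a. \<Sum>j\<leftarrow>js. (block j *\<^sub>v r j) $ a)"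
  using assms
proof (induction js)
  case Nil
  { case 1 show ?case by simp next
    case 2 show ?case by simp next
    case 3 show ?case by (intro eq_vecI) (auto simp: scalar_prod_def) }
next
  case (Cons j js)
  { case 1 then show ?case using Cons.IH(1) by simp next
    case 2 then show ?case using Cons.IH(2) by simp next
    case 3
    then have b: "block j \<in> carrier_mat d (len j)" and r: "r j \<in> carrier_vec (len j)" by auto
    have p: "\<And>k. k \<in> set js \<Longrightarrow> block k \<in> carrier_mat d (len k)" "\<And>k. k \<in> set js \<Longrightarrow> r k \<in> carrier_vec (len k)"
      using 3 by auto
    note IH = Cons.IH(1)[OF p] Cons.IH(2)[OF p] Cons.IH(3)[OF p]
    have "foldr (\<lambda>j X. block j @\<^sub>c X) (j # js) (0\<^sub>m d 0) *\<^sub>v foldr (\<lambda>j v. r j @\<^sub>v v) (j # js) (0\<^sub>v 0)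
      = block j *\<^sub>v r j + vec d (\<lambda>a. \<Sum>j\<leftarrow>js. (block j *\<^sub>v r j) $ a)"
      by (simp only: foldr_Cons comp_apply append_cols_mult_append_vec[OF b IH(1) r IH(2)] IH(3))
    also have "\<dots> = vec d (\<lambda>a. \<Sum>j\<leftarrow>j # js. (block j *\<^sub>v r j) $ a)"
      using b by (intro eq_vecI) auto
    finally show ?case . }
qed

section \<open>Definite and semidefinite matrices\<close>

lemma sym_pos_def_imp_semidef: "P \<in> sym_pos_def k \<Longrightarrow> P \<in> sym_pos_semidef k"
proof -
  assume P: "P \<in> sym_pos_def k"
  have "v \<bullet> (P *\<^sub>v v) \<ge> 0" if "v \<in> carrier_vec k" for v
    using P that by (cases "v = 0\<^sub>v k") (auto simp: sym_pos_def_def intro: less_imp_le)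
  then show ?thesis using P by (simp add: sym_pos_def_def sym_pos_semidef_def)
qed

text \<open>The quadratic form at \<open>v\<close> is that of \<open>R\<close> at
  \<open>L *\<^sub>v v\<close>. It serves both for the control weights seen through the gains and
  for the diffusion term added to \<open>R i i\<close>.\<close>

lemma sym_pos_semidef_congruence:
  assumes R: "R \<in> sym_pos_semidef k" and L: "L \<in> carrier_mat k n"
  shows "transpose_mat L * R * L \<in> sym_pos_semidef n"
proof -
  have Rc: "R \<in> carrier_mat k k" and Rt: "transpose_mat R = R" using R by (auto simp: sym_pos_semidef_def)
  have "transpose_mat (transpose_mat L * R * L) = transpose_mat L * R * L"
  proof -
    have "transpose_mat (transpose_mat L * R) = R * L"
      using transpose_mult[of "transpose_mat L" n k R k] Rc L Rt by simp
    then show ?thesis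
      using transpose_mult[of "transpose_mat L * R" n k L n] Rc L by simp
  qed
  moreover have "v \<bullet> (transpose_mat L * R * L *\<^sub>v v) \<ge> 0" if v: "v \<in> carrier_vec n" for v
  proof -
    have "v \<bullet> (transpose_mat L * R * L *\<^sub>v v) = v \<bullet> (transpose_mat L *\<^sub>v (R *\<^sub>v (L *\<^sub>v v)))"
      using Rc L v by (simp add: assoc_mult_mat_vec[of "transpose_mat L" n k "R * L" n] assoc_mult_mat_vec[of R k k L n])
    also have "\<dots> = (L *\<^sub>v v) \<bullet> (R *\<^sub>v (L *\<^sub>v v))"
    proof -
      have y: "R *\<^sub>v (L *\<^sub>v v) \<in> carrier_vec k" using Rc L v by simp
      have Lv: "L *\<^sub>v v \<in> carrier_vec k" and Ly: "transpose_mat L *\<^sub>v (R *\<^sub>v (L *\<^sub>v v)) \<in> carrier_vec n"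
        using y L v by auto
      show ?thesis
        using comm_scalar_prod[OF v Ly] transpose_vec_mult_scalar[OF L v y] comm_scalar_prod[OF y Lv] by simp
    qed
    finally show ?thesis using R L v by (simp add: sym_pos_semidef_def)
  qed
  ultimately show ?thesis using Rc L by (auto simp: sym_pos_semidef_def)
qed

lemma sym_pos_semidef_mat_sum:
  assumes f: "\<And>j. j \<in> I \<Longrightarrow> f j \<in> sym_pos_semidef n"
  shows "mat_sum n n f I \<in> sym_pos_semidef n"
proof -
  have fc: "f j \<in> carrier_mat n n" and ft: "transpose_mat (f j) = f j" if "j \<in> I" for j
    using f[OF that] by (auto simp: sym_pos_semidef_def)
  have "transpose_mat (mat_sum n n f I) = mat_sum n n f I"
  proof (rule eq_matI)
    fix a b assume "a < dim_row (mat_sum n n f I)" "b < dim_col (mat_sum n n f I)"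
    then have ab: "a < n" "b < n" by auto
    have "f j $$ (b, a) = f j $$ (a, b)" if "j \<in> I" for j
      using fc[OF that] ab by (subst ft[OF that, symmetric]) simp
    then show "transpose_mat (mat_sum n n f I) $$ (a, b) = mat_sum n n f I $$ (a, b)"
      using ab by (simp add: mat_sum_def)
  qed auto
  moreover have "v \<bullet> (mat_sum n n f I *\<^sub>v v) \<ge> 0" if v: "v \<in> carrier_vec n" for v
  proof -
    have "v \<bullet> (mat_sum n n f I *\<^sub>v v) = (\<Sum>c = 0..<n. \<Sum>j\<in>I. v $ c * (f j *\<^sub>v v) $ c)"
      using mat_sum_mult_vec[OF fc v] by (auto simp: scalar_prod_def[of v "mat_sum n n f I *\<^sub>v v"] sum_distrib_left intro!: sum.cong)
    also have "\<dots> = (\<Sum>j\<in>I. \<Sum>c = 0..<n. v $ c * (f j *\<^sub>v v) $ c)" by (rule sum.swap)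
    also have "\<dots> = (\<Sum>j\<in>I. v \<bullet> (f j *\<^sub>v v))"
      using fc by (auto simp: scalar_prod_def[of v] intro!: sum.cong)
    also have "\<dots> \<ge> 0" by (rule sum_nonneg) (use f v in \<open>auto simp: sym_pos_semidef_def\<close>)
    finally show ?thesis .
  qed
  ultimately show ?thesis by (simp add: sym_pos_semidef_def)
qed

lemma sym_pos_def_add_semidef:
  assumes P: "P \<in> sym_pos_def n" and Q: "Q \<in> sym_pos_semidef n"
  shows "P + Q \<in> sym_pos_def n"
proof -
  have c: "P \<in> carrier_mat n n" "Q \<in> carrier_mat n n" using assms by (auto simp: sym_pos_def_def sym_pos_semidef_def)
  have "v \<bullet> ((P + Q) *\<^sub>v v) > 0" if v: "v \<in> carrier_vec n" "v \<noteq> 0\<^sub>v n" for v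
  proof -
    have "v \<bullet> ((P + Q) *\<^sub>v v) = v \<bullet> (P *\<^sub>v v) + v \<bullet> (Q *\<^sub>v v)"
      using c v by (simp add: add_mult_distrib_mat_vec[of _ n n] scalar_prod_add_distrib[of _ n])
    moreover have "v \<bullet> (P *\<^sub>v v) > 0" "v \<bullet> (Q *\<^sub>v v) \<ge> 0"
      using assms v by (auto simp: sym_pos_def_def sym_pos_semidef_def)
    ultimately show ?thesis by simp
  qed
  moreover have "transpose_mat (P + Q) = P + Q"
    using assms c by (simp add: transpose_add[of _ n n] sym_pos_def_def sym_pos_semidef_def)
  ultimately show ?thesis using c by (simp add: sym_pos_def_def)
qed

text \<open>Definiteness gives a trivial kernel: a kernel vector annihilates the quadratic
  form.\<close>

lemma sym_pos_def_mat_inv: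
  assumes P: "P \<in> sym_pos_def n"
  shows "P * mat_inv P = 1\<^sub>m n" "mat_inv P * P = 1\<^sub>m n" "mat_inv P \<in> carrier_mat n n"
proof -
  have c: "P \<in> carrier_mat n n" using P by (simp add: sym_pos_def_def)
  have "v = 0\<^sub>v n" if "v \<in> carrier_vec n" "P *\<^sub>v v = 0\<^sub>v n" for v
    using P that by (auto simp: sym_pos_def_def)
  from mat_inv_inverse[OF c this]
  show "P * mat_inv P = 1\<^sub>m n" "mat_inv P * P = 1\<^sub>m n" "mat_inv P \<in> carrier_mat n n" by auto
qed

section \<open>Vectorized Lyapunov, gain and weight maps\<close>

lemma lyapunov_kronecker:
  assumes A: "A \<in> carrier_mat n n" and C: "C \<in> carrier_mat n n" and P: "P \<in> carrier_mat n n"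
  shows "(transpose_mat A \<otimes>\<^sub>K 1\<^sub>m n + 1\<^sub>m n \<otimes>\<^sub>K transpose_mat A + transpose_mat C \<otimes>\<^sub>K transpose_mat C) *\<^sub>v vectorize P
    = vectorize (P * A + transpose_mat A * P + transpose_mat C * P * C)"
proof -
  have c: "transpose_mat A \<in> carrier_mat n n" "transpose_mat C \<in> carrier_mat n n"
    "P * A \<in> carrier_mat n n" "transpose_mat A * P \<in> carrier_mat n n" "transpose_mat C * P * C \<in> carrier_mat n n"
    using A C P by auto
  have k: "transpose_mat A \<otimes>\<^sub>K 1\<^sub>m n \<in> carrier_mat (n * n) (n * n)" "1\<^sub>m n \<otimes>\<^sub>K transpose_mat A \<in> carrier_mat (n * n) (n * n)"
    "transpose_mat C \<otimes>\<^sub>K transpose_mat C \<in> carrier_mat (n * n) (n * n)"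
    using c by auto
  have v: "vectorize P \<in> carrier_vec (n * n)" using P by simp
  have 1: "(transpose_mat A \<otimes>\<^sub>K 1\<^sub>m n) *\<^sub>v vectorize P = vectorize (P * A)"
    using kronecker_mult_vectorize[OF one_carrier_mat P A] P by simp
  have 2: "(1\<^sub>m n \<otimes>\<^sub>K transpose_mat A) *\<^sub>v vectorize P = vectorize (transpose_mat A * P)"
    using kronecker_mult_vectorize[OF c(1) P one_carrier_mat] right_mult_one_mat[OF c(4)] by simp
  have 3: "(transpose_mat C \<otimes>\<^sub>K transpose_mat C) *\<^sub>v vectorize P = vectorize (transpose_mat C * P * C)"
    by (rule kronecker_mult_vectorize[OF c(2) P C])
  show ?thesis
    using c k v by (simp only: add_mult_distrib_mat_vec[of _ "n * n" "n * n"] add_carrier_mat 1 2 3 vectorize_add[of _ n n])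
qed

text \<open>The matrix on the left is the first factor of \<open>S_mat\<close>. With
  \<open>I\<close> the set of all players, the map it represents is P \<mapsto> B^T P + D^T P C_cl
  with the sum in C_cl written out; the transposed products combine into the transpose of
  \<open>D' k * K k\<close>.\<close>

lemma gain_kronecker:
  assumes B: "B \<in> carrier_mat n m" and C: "C \<in> carrier_mat n n" and D: "D \<in> carrier_mat n m"
    and P: "P \<in> carrier_mat n n"
    and D': "\<And>k. k \<in> I \<Longrightarrow> D' k \<in> carrier_mat n (m' k)" and K: "\<And>k. k \<in> I \<Longrightarrow> K k \<in> carrier_mat (m' k) n"
  shows "(1\<^sub>m n \<otimes>\<^sub>K transpose_mat B + transpose_mat C \<otimes>\<^sub>K transpose_mat D
        - mat_sum (n * m) (n * n) (\<lambda>k. (transpose_mat (K k) * transpose_mat (D' k)) \<otimes>\<^sub>K transpose_mat D) I) *\<^sub>v vectorize P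
    = vectorize (transpose_mat B * P + transpose_mat D * P * C
        - mat_sum m n (\<lambda>k. transpose_mat D * P * D' k * K k) I)"
proof -
  let ?E = "\<lambda>k. (transpose_mat (K k) * transpose_mat (D' k)) \<otimes>\<^sub>K transpose_mat D"
  let ?F = "\<lambda>k. transpose_mat D * P * D' k * K k"
  have c: "transpose_mat B \<in> carrier_mat m n" "transpose_mat D \<in> carrier_mat m n"
    "transpose_mat B * P \<in> carrier_mat m n" "transpose_mat D * P * C \<in> carrier_mat m n"
    "transpose_mat D * P \<in> carrier_mat m n"
    using B C D P by auto
  have k: "1\<^sub>m n \<otimes>\<^sub>K transpose_mat B \<in> carrier_mat (n * m) (n * n)"
    "transpose_mat C \<otimes>\<^sub>K transpose_mat D \<in> carrier_mat (n * m) (n * n)"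
    using c C by auto
  have v: "vectorize P \<in> carrier_vec (n * n)" using P by simp
  have 1: "(1\<^sub>m n \<otimes>\<^sub>K transpose_mat B) *\<^sub>v vectorize P = vectorize (transpose_mat B * P)"
    using kronecker_mult_vectorize[OF c(1) P one_carrier_mat] right_mult_one_mat[OF c(3)] by simp
  have 2: "(transpose_mat C \<otimes>\<^sub>K transpose_mat D) *\<^sub>v vectorize P = vectorize (transpose_mat D * P * C)"
    by (rule kronecker_mult_vectorize[OF c(2) P C])
  have E: "?E k \<in> carrier_mat (n * m) (n * n)" and F: "?F k \<in> carrier_mat m n"
    and EF: "?E k *\<^sub>v vectorize P = vectorize (?F k)" if "k \<in> I" for k
  proof -
    have DK: "D' k * K k \<in> carrier_mat n n" using D'[OF that] K[OF that] by simp
    have t: "transpose_mat (K k) * transpose_mat (D' k) = transpose_mat (D' k * K k)"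
      using transpose_mult[OF D'[OF that] K[OF that]] by simp
    show "?E k \<in> carrier_mat (n * m) (n * n)" unfolding t using DK c(2) by simp
    show "?F k \<in> carrier_mat m n" using c(5) D'[OF that] K[OF that] by (meson mult_carrier_mat)
    have "?F k = transpose_mat D * P * (D' k * K k)"
      by (rule assoc_mult_mat[OF c(5) D'[OF that] K[OF that]])
    then show "?E k *\<^sub>v vectorize P = vectorize (?F k)"
      unfolding t using kronecker_mult_vectorize[OF c(2) P DK] by simp
  qed
  have 3: "mat_sum (n * m) (n * n) ?E I *\<^sub>v vectorize P = vectorize (mat_sum m n ?F I)"
  proof (rule eq_vecI)
    fix a assume "a < dim_vec (vectorize (mat_sum m n ?F I))"
    then have a: "a < m * n" "a < n * m" by (auto simp: mult.commute)
    have "(mat_sum (n * m) (n * n) ?E I *\<^sub>v vectorize P) $ a = (\<Sum>k\<in>I. (?E k *\<^sub>v vectorize P) $ a)"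
      by (rule mat_sum_mult_vec[OF E v a(2)])
    also have "\<dots> = (\<Sum>k\<in>I. vectorize (?F k) $ a)"
      by (rule sum.cong[OF refl]) (simp only: EF)
    also have "\<dots> = vectorize (mat_sum m n ?F I) $ a"
      by (rule vectorize_mat_sum[OF F a(1), symmetric])
    finally show "(mat_sum (n * m) (n * n) ?E I *\<^sub>v vectorize P) $ a = vectorize (mat_sum m n ?F I) $ a" .
  qed (simp add: mult.commute)
  show ?thesis
    using c k v by (simp only: minus_mult_distrib_mat_vec[of _ "n * m" "n * n"] add_mult_distrib_mat_vec[of _ "n * m" "n * n"]
        add_carrier_mat mat_sum_carrier 1 2 3 vectorize_add[of _ m n] vectorize_minus[of _ m n])
qed

lemma mult_vectorize_mat_sum:
  assumes S: "S \<in> carrier_mat d (a * b)" and f: "\<And>j. j \<in> I \<Longrightarrow> f j \<in> carrier_mat a b" and k: "k < d"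
  shows "(S *\<^sub>v vectorize (mat_sum a b f I)) $ k = (\<Sum>j\<in>I. (S *\<^sub>v vectorize (f j)) $ k)"
proof -
  have "(S *\<^sub>v vectorize (mat_sum a b f I)) $ k = (\<Sum>c = 0..<a * b. S $$ (k, c) * vectorize (mat_sum a b f I) $ c)"
    using S k by (simp add: scalar_prod_def)
  also have "\<dots> = (\<Sum>c = 0..<a * b. \<Sum>j\<in>I. S $$ (k, c) * vectorize (f j) $ c)"
    using f by (intro sum.cong refl) (simp add: vectorize_mat_sum sum_distrib_left)
  also have "\<dots> = (\<Sum>j\<in>I. \<Sum>c = 0..<a * b. S $$ (k, c) * vectorize (f j) $ c)" by (rule sum.swap)
  also have "\<dots> = (\<Sum>j\<in>I. (S *\<^sub>v vectorize (f j)) $ k)"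
  proof (rule sum.cong[OF refl])
    fix j assume "j \<in> I"
    from f[OF this] show "(\<Sum>c = 0..<a * b. S $$ (k, c) * vectorize (f j) $ c) = (S *\<^sub>v vectorize (f j)) $ k"
      using S k by (simp add: scalar_prod_def)
  qed
  finally show ?thesis .
qed

text \<open>Each block applies \<open>S\<close> to a vectorized weight term of the Lyapunov
  equation, and by linearity these recombine with \<open>Q\<close> under a single \<open>S\<close>.
  The extra Kronecker product in block \<open>i\<close> contributes
  \<open>vectorize (R i * K i)\<close>.\<close>

lemma M_mat_mult_theta_vec:
  assumes S: "S_mat n N m A B C D K i \<in> carrier_mat (n * m i) (n * n)"
    and K: "\<And>j. j \<in> {1..N} \<Longrightarrow> K j \<in> carrier_mat (m j) n" and i: "i \<in> {1..N}"
    and Q: "Q \<in> carrier_mat n n" and R: "\<And>j. j \<in> {1..N} \<Longrightarrow> R j \<in> carrier_mat (m j) (m j)"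
  shows "M_mat n N m A B C D K i *\<^sub>v theta_vec N Q R =
    S_mat n N m A B C D K i *\<^sub>v vectorize (Q + mat_sum n n (\<lambda>j. transpose_mat (K j) * R j * K j) {1..N})
    + vectorize (R i * K i)"
proof -
  define S where "S = S_mat n N m A B C D K i"
  note S = S[folded S_def]
  define block where "block j = (let SK = S * (transpose_mat (K j) \<otimes>\<^sub>K transpose_mat (K j))
    in if j = i then transpose_mat (K i) \<otimes>\<^sub>K 1\<^sub>m (m i) + SK else SK)" for j
  let ?f = "\<lambda>j. transpose_mat (K j) * R j * K j"
  let ?js = "[1..<Suc N]" and ?d = "n * m i"
  have js: "set ?js = {1..N}" "distinct ?js" by auto
  have KK: "transpose_mat (K j) \<otimes>\<^sub>K transpose_mat (K j) \<in> carrier_mat (n * n) (m j * m j)" if "j \<in> {1..N}" for j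
    using K[OF that] by simp
  have f: "?f j \<in> carrier_mat n n" if "j \<in> {1..N}" for j using K[OF that] R[OF that] by simp
  have block: "block j \<in> carrier_mat ?d (m j * m j)" if "j \<in> {1..N}" for j
    using mult_carrier_mat[OF S KK[OF that]] K[OF i] by (auto simp: block_def Let_def)
  have r: "vectorize (R j) \<in> carrier_vec (m j * m j)" if "j \<in> {1..N}" for j using R[OF that] by simp
  have block_mult: "block j *\<^sub>v vectorize (R j) =
      S *\<^sub>v vectorize (?f j) + (if j = i then vectorize (R i * K i) else 0\<^sub>v ?d)" if j: "j \<in> {1..N}" for j
  proof -
    have Kt: "transpose_mat (K j) \<in> carrier_mat n (m j)" using K[OF j] by simp
    have 1: "S * (transpose_mat (K j) \<otimes>\<^sub>K transpose_mat (K j)) *\<^sub>v vectorize (R j) = S *\<^sub>v vectorize (?f j)"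
      using assoc_mult_mat_vec[OF S KK[OF j] r[OF j]] kronecker_mult_vectorize[OF Kt R[OF j] K[OF j]] by simp
    have 2: "(transpose_mat (K i) \<otimes>\<^sub>K 1\<^sub>m (m i)) *\<^sub>v vectorize (R i) = vectorize (R i * K i)"
      using kronecker_mult_vectorize[OF one_carrier_mat R[OF i] K[OF i]] R[OF i] by simp
    have c: "transpose_mat (K i) \<otimes>\<^sub>K 1\<^sub>m (m i) \<in> carrier_mat ?d (m i * m i)" using K[OF i] by simp
    have v: "vectorize (R i * K i) \<in> carrier_vec ?d" using R[OF i] K[OF i] by (intro carrier_vecI) auto
    have w: "S *\<^sub>v vectorize (?f j) \<in> carrier_vec ?d" using S f[OF j] by simp
    show ?thesis
    proof (cases "j = i")
      case True
      then have "block j *\<^sub>v vectorize (R j) = vectorize (R i * K i) + S *\<^sub>v vectorize (?f i)"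
        using add_mult_distrib_mat_vec[OF c mult_carrier_mat[OF S KK[OF i]] r[OF i]] 1 2
        by (simp add: block_def Let_def)
      then show ?thesis using True v w comm_add_vec[of _ ?d] by simp
    next
      case False
      then show ?thesis using 1 w by (simp add: block_def Let_def)
    qed
  qed
  have vRK: "vectorize (R i * K i) \<in> carrier_vec ?d" using R[OF i] K[OF i] by (intro carrier_vecI) auto
  have dimRK: "dim_row (R i) * dim_col (K i) = ?d" using R[OF i] K[OF i] by (simp add: mult.commute)
  have Sf: "S *\<^sub>v vectorize (?f j) \<in> carrier_vec ?d" if "j \<in> {1..N}" for j using S f[OF that] by simp
  have vQ: "vectorize Q \<in> carrier_vec (n * n)" using Q by simp
  note fold = foldr_append_cols_mult[of ?js block ?d "\<lambda>j. m j * m j" "\<lambda>j. vectorize (R j)", unfolded js, OF block r]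
  have "M_mat n N m A B C D K i *\<^sub>v theta_vec N Q R =
      S *\<^sub>v vectorize Q + vec ?d (\<lambda>a. \<Sum>j\<leftarrow>?js. (block j *\<^sub>v vectorize (R j)) $ a)"
    using append_cols_mult_append_vec[OF S fold(1) vQ fold(2)] fold(3)
    unfolding M_mat_def theta_vec_def S_def[symmetric] block_def[abs_def] Let_def by simp
  also have "vec ?d (\<lambda>a. \<Sum>j\<leftarrow>?js. (block j *\<^sub>v vectorize (R j)) $ a) =
      S *\<^sub>v vectorize (mat_sum n n ?f {1..N}) + vectorize (R i * K i)"
  proof (rule eq_vecI)
    fix a assume "a < dim_vec (S *\<^sub>v vectorize (mat_sum n n ?f {1..N}) + vectorize (R i * K i))"
    then have a: "a < ?d" by (simp add: dimRK)
    have "(\<Sum>j\<leftarrow>?js. (block j *\<^sub>v vectorize (R j)) $ a) = (\<Sum>j\<in>{1..N}. (block j *\<^sub>v vectorize (R j)) $ a)"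
      using sum.distinct_set_conv_list[OF js(2), of "\<lambda>j. (block j *\<^sub>v vectorize (R j)) $ a"] js(1) by simp
    also have "\<dots> = (\<Sum>j\<in>{1..N}. (S *\<^sub>v vectorize (?f j)) $ a + (if j = i then vectorize (R i * K i) $ a else 0))"
      using a by (intro sum.cong refl) (simp add: block_mult dimRK)
    also have "\<dots> = (S *\<^sub>v vectorize (mat_sum n n ?f {1..N})) $ a + vectorize (R i * K i) $ a"
    proof -
      have "(S *\<^sub>v vectorize (mat_sum n n ?f {1..N})) $ a = (\<Sum>j\<in>{1..N}. (S *\<^sub>v vectorize (?f j)) $ a)"
        by (rule mult_vectorize_mat_sum[OF S f a])
      then show ?thesis unfolding sum.distrib using i by simp
    qed
    finally show "vec ?d (\<lambda>a. \<Sum>j\<leftarrow>?js. (block j *\<^sub>v vectorize (R j)) $ a) $ a =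
      (S *\<^sub>v vectorize (mat_sum n n ?f {1..N}) + vectorize (R i * K i)) $ a"
      using a by (simp add: dimRK del: upt_Suc)
  qed (simp add: dimRK del: upt_Suc)
  also have "S *\<^sub>v vectorize Q + (S *\<^sub>v vectorize (mat_sum n n ?f {1..N}) + vectorize (R i * K i)) =
      S *\<^sub>v vectorize (Q + mat_sum n n ?f {1..N}) + vectorize (R i * K i)"
    using S vQ vRK Q
    by (simp add: vectorize_add[of _ n n] mult_add_distrib_mat_vec[of _ ?d "n * n"] assoc_add_vec[of _ ?d])
  finally show ?thesis unfolding S_def .
qed

lemma mat_sum_remove:
  assumes "finite I" "i \<in> I" "f i \<in> carrier_mat a b"
  shows "mat_sum a b f I = f i + mat_sum a b f (I - {i})"
  using assms by (intro eq_matI) (auto simp: mat_sum_def sum.remove)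

text \<open>Meant for \<open>Y\<close> the summand of player \<open>i\<close>: it moves that summand
  from the side of the gain into the sum over the other players.\<close>

lemma mat_add_eq_minus_iff:
  fixes X Y U Z :: "real mat"
  assumes c: "X \<in> carrier_mat a b" "Y \<in> carrier_mat a b" "U \<in> carrier_mat a b" "Z \<in> carrier_mat a b"
  shows "X + Y = U - Z \<longleftrightarrow> X = U - (Y + Z)"
proof
  assume *: "X + Y = U - Z"
  show "X = U - (Y + Z)"
  proof (rule eq_matI)
    fix i j assume "i < dim_row (U - (Y + Z))" "j < dim_col (U - (Y + Z))"
    then show "X $$ (i, j) = (U - (Y + Z)) $$ (i, j)"
      using arg_cong[OF *, of "\<lambda>V. V $$ (i, j)"] c by simp
  qed (use c in auto)
next
  assume "X = U - (Y + Z)"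
  then show "X + Y = U - Z" using c by (intro eq_matI) auto
qed

lemma mult_mat_vec_uminus:
  fixes v :: "real vec"
  assumes "A \<in> carrier_mat r c" "v \<in> carrier_vec c"
  shows "A *\<^sub>v (- v) = - (A *\<^sub>v v)"
  using assms by (intro eq_vecI) (auto simp: scalar_prod_def sum_negf)

lemma uminus_add_vec:
  fixes u v :: "real vec"
  assumes "u \<in> carrier_vec d" "v \<in> carrier_vec d"
  shows "- u + v = v - u"
  using assms by (intro eq_vecI) auto

section \<open>Reduction of both conditions to one matrix equation\<close>

theorem lemma3:
  fixes M :: "'a measure" and F :: "real \<Rightarrow> 'a measure" and W :: "real \<Rightarrow> 'a \<Rightarrow> real"
    and n N i :: nat and m :: "nat \<Rightarrow> nat"
    and A C :: "real mat" and B D K Q :: "nat \<Rightarrow> real mat"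
    and R :: "nat \<Rightarrow> nat \<Rightarrow> real mat"
  assumes "wiener_process M F W"
    and "A \<in> carrier_mat n n" and "C \<in> carrier_mat n n"
    and "\<And>j. j \<in> {1..N} \<Longrightarrow> B j \<in> carrier_mat n (m j)"
    and "\<And>j. j \<in> {1..N} \<Longrightarrow> D j \<in> carrier_mat n (m j)"
    and "mean_square_stabilizable M F W n N m A B C D"
    and "K \<in> stabilizing_gains M F W n N m A B C D"
    and "i \<in> {1..N}"
    and "Q i \<in> sym_pos_def n"
    and "R i i \<in> sym_pos_def (m i)"
    and "\<And>j. j \<in> {1..N} - {i} \<Longrightarrow> R i j \<in> sym_pos_semidef (m j)"
  shows "(\<exists>P \<in> sym_pos_def n.
            0\<^sub>m n n =
              P * closed_loop n N A B K
              + transpose_mat (closed_loop n N A B K) * P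
              + transpose_mat (closed_loop n N C D K) * P * closed_loop n N C D K
              + Q i
              + mat_sum n n (\<lambda>j. transpose_mat (K j) * R i j * K j) {1..N}
            \<and> K i =
              mat_inv (R i i + transpose_mat (D i) * P * D i)
              * (transpose_mat (B i) * P + transpose_mat (D i) * P * C
                 - mat_sum (m i) n (\<lambda>k. transpose_mat (D i) * P * D k * K k) ({1..N} - {i})))
         \<longleftrightarrow> M_mat n N m A B C D K i *\<^sub>v theta_vec N (Q i) (R i) = 0\<^sub>v (n * m i)"
proof -
  interpret wiener_process M F W by fact
  define Acl where "Acl = closed_loop n N A B K"
  define Ccl where "Ccl = closed_loop n N C D K"
  have K: "K j \<in> carrier_mat (m j) n" if "j \<in> {1..N}" for j
    using assms(7) that by (auto simp: stabilizing_gains_def)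
  have stable: "mean_square_stable M F W n Acl Ccl"
    using assms(7) by (simp add: stabilizing_gains_def Acl_def Ccl_def)
  have Ac: "Acl \<in> carrier_mat n n" and Cc: "Ccl \<in> carrier_mat n n"
    using assms(2,3) by (auto simp: Acl_def Ccl_def closed_loop_def)
  note i = assms(8)
  note Bi = assms(4)[OF i] and Di = assms(5)[OF i] and Ki = K[OF i]
  have Rsemi: "R i j \<in> sym_pos_semidef (m j)" if "j \<in> {1..N}" for j
    using assms(10,11) that sym_pos_def_imp_semidef by (cases "j = i") auto
  have Rc: "R i j \<in> carrier_mat (m j) (m j)" if "j \<in> {1..N}" for j
    using Rsemi[OF that] by (simp add: sym_pos_semidef_def)
  have Qc: "Q i \<in> carrier_mat n n" using assms(9) by (simp add: sym_pos_def_def)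
  \<comment> \<open>All terms of the Lyapunov equation that are free of P. Its definiteness comes
    from \<open>Q i\<close>; the remaining summands are congruences of semidefinite weights.\<close>
  define Qbar where "Qbar = Q i + mat_sum n n (\<lambda>j. transpose_mat (K j) * R i j * K j) {1..N}"
  have Qbar: "Qbar \<in> sym_pos_def n" unfolding Qbar_def
    by (rule sym_pos_def_add_semidef[OF assms(9) sym_pos_semidef_mat_sum], rule sym_pos_semidef_congruence[OF Rsemi K])
  then have Qbarc: "Qbar \<in> carrier_mat n n" and Qbart: "transpose_mat Qbar = Qbar"
    by (auto simp: sym_pos_def_def)
  define lyap where "lyap P = P * Acl + transpose_mat Acl * P + transpose_mat Ccl * P * Ccl" for P
  have lyapc: "lyap P \<in> carrier_mat n n" if "P \<in> carrier_mat n n" for P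
    using that Ac Cc by (simp add: lyap_def)
  define L where "L = transpose_mat Acl \<otimes>\<^sub>K 1\<^sub>m n + 1\<^sub>m n \<otimes>\<^sub>K transpose_mat Acl + transpose_mat Ccl \<otimes>\<^sub>K transpose_mat Ccl"
  have Lc: "L \<in> carrier_mat (n * n) (n * n)" using Ac Cc by (simp add: L_def)
  have L: "L *\<^sub>v vectorize P = vectorize (lyap P)" if "P \<in> carrier_mat n n" for P
    unfolding L_def lyap_def by (rule lyapunov_kronecker[OF Ac Cc that])
  \<comment> \<open>An arbitrary vector of length \<open>n * n\<close> is the vectorization of a
    possibly nonsymmetric matrix, so injectivity is used on all square matrices here.\<close>
  have "v = 0\<^sub>v (n * n)" if "v \<in> carrier_vec (n * n)" "L *\<^sub>v v = 0\<^sub>v (n * n)" for v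
  proof -
    obtain P where P: "P \<in> carrier_mat n n" "vectorize P = v" using vectorize_surj[OF \<open>v \<in> carrier_vec (n * n)\<close>] .
    then have "vectorize (lyap P) = vectorize (0\<^sub>m n n)" using L[OF P(1)] that(2) P(2) by (simp add: vectorize_zero)
    then have "lyap P = 0\<^sub>m n n" by (rule vectorize_inject[OF lyapc[OF P(1)] zero_carrier_mat])
    then have "P = 0\<^sub>m n n" unfolding lyap_def by (rule lyapunov_operator_injective[OF stable Ac Cc P(1)])
    then show ?thesis using P(2) by (simp add: vectorize_zero)
  qed
  note inv = mat_inv_inverse[OF Lc this]
  define T where "T = 1\<^sub>m n \<otimes>\<^sub>K transpose_mat (B i) + transpose_mat C \<otimes>\<^sub>K transpose_mat (D i)
        - mat_sum (n * m i) (n * n)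
            (\<lambda>k. (transpose_mat (K k) * transpose_mat (D k)) \<otimes>\<^sub>K transpose_mat (D i)) {1..N}"
  have Tc: "T \<in> carrier_mat (n * m i) (n * n)" by (simp add: T_def minus_carrier_mat)
  have S: "S_mat n N m A B C D K i = T * mat_inv L"
    by (simp add: S_mat_def T_def L_def Acl_def Ccl_def Let_def)
  have Sc: "S_mat n N m A B C D K i \<in> carrier_mat (n * m i) (n * n)" unfolding S using Tc inv(3) by simp
  \<comment> \<open>The matrix \<Gamma> of the overview as a function of P. Its sum runs over all
    players, whereas the sum in the gain equation omits player \<open>i\<close>.\<close>
  define gain where "gain P = transpose_mat (B i) * P + transpose_mat (D i) * P * C
        - mat_sum (m i) n (\<lambda>k. transpose_mat (D i) * P * D k * K k) {1..N}" for P
  have gainc: "gain P \<in> carrier_mat (m i) n" for P by (simp add: gain_def minus_carrier_mat)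
  have T: "T *\<^sub>v vectorize P = vectorize (gain P)" if "P \<in> carrier_mat n n" for P
    unfolding T_def gain_def
    by (rule gain_kronecker[OF Bi assms(3) Di that assms(5) K])
  have RKc: "R i i * K i \<in> carrier_mat (m i) n" using Rc[OF i] Ki by simp
  have unique: "P = P'" if "P \<in> carrier_mat n n" "P' \<in> carrier_mat n n" "lyap P = lyap P'" for P P'
  proof -
    have "vectorize P = mat_inv L *\<^sub>v (L *\<^sub>v vectorize P)" if "P \<in> carrier_mat n n" for P
      using assoc_mult_mat_vec[OF inv(3) Lc, of "vectorize P"] that inv(2) by simp
    then have "vectorize P = vectorize P'" using that L by metis
    then show ?thesis by (rule vectorize_inject[OF that(1,2)])
  qed
  \<comment> \<open>The candidate is read off from the inverse in \<open>S_mat\<close>, which makes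
    the later evaluation of \<open>M_mat\<close> immediate.\<close>
  obtain P where P: "P \<in> carrier_mat n n" "vectorize P = mat_inv L *\<^sub>v vectorize (- Qbar)"
  proof -
    have "mat_inv L *\<^sub>v vectorize (- Qbar) \<in> carrier_vec (n * n)" using inv(3) Qbarc by simp
    from vectorize_surj[OF this] show ?thesis using that by blast
  qed
  have lyapP: "lyap P = - Qbar"
  proof (rule vectorize_inject[OF lyapc[OF P(1)]])
    have v: "vectorize (- Qbar) \<in> carrier_vec (n * n)" using Qbarc by simp
    have "vectorize (lyap P) = L *\<^sub>v (mat_inv L *\<^sub>v vectorize (- Qbar))" using L[OF P(1)] P(2) by simp
    also have "\<dots> = vectorize (- Qbar)"
      using assoc_mult_mat_vec[OF Lc inv(3) v] inv(1) v by simp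
    finally show "vectorize (lyap P) = vectorize (- Qbar)" .
  qed (use Qbarc in simp)
  \<comment> \<open>\<open>lyap\<close> commutes with transposition and \<open>Qbar\<close> is
    symmetric, so the transpose solves the same equation and uniqueness applies.\<close>
  have Psym: "transpose_mat P = P"
  proof (rule unique)
    have "transpose_mat (lyap P) = lyap (transpose_mat P)"
    proof -
      have "transpose_mat (P * Acl) = transpose_mat Acl * transpose_mat P"
        "transpose_mat (transpose_mat Acl * P) = transpose_mat P * Acl"
        "transpose_mat (transpose_mat Ccl * P * Ccl) = transpose_mat Ccl * transpose_mat P * Ccl"
        using transpose_mult[of P n n Acl n] transpose_mult[of "transpose_mat Acl" n n P n]
          transpose_mult[of "transpose_mat Ccl" n n P n] transpose_mult[of "transpose_mat Ccl * P" n n Ccl n] P(1) Ac Cc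
        by simp_all
      then show ?thesis
        unfolding lyap_def using P(1) Ac Cc
        by (simp add: transpose_add[of _ n n] comm_add_mat[of _ n n])
    qed
    then show "lyap (transpose_mat P) = lyap P"
      unfolding lyapP using Qbart Qbarc by (simp add: transpose_uminus)
  qed (use P(1) in auto)
  have Ppd: "P \<in> sym_pos_def n"
    using P(1) Psym lyapunov_solution_positive[OF stable Ac Cc P(1) Qbar lyapP[unfolded lyap_def]]
    by (simp add: sym_pos_def_def)
  \<comment> \<open>The Lyapunov half of condition (i) therefore holds for \<open>P\<close> and for
    no other matrix.\<close>
  have lyap_iff: "0\<^sub>m n n = lyap P' + Q i + mat_sum n n (\<lambda>j. transpose_mat (K j) * R i j * K j) {1..N} \<longleftrightarrow> P' = P"
    if P': "P' \<in> carrier_mat n n" for P'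
  proof -
    have "lyap P' + Q i + mat_sum n n (\<lambda>j. transpose_mat (K j) * R i j * K j) {1..N} = lyap P' + Qbar"
      unfolding Qbar_def by (rule assoc_add_mat[OF lyapc[OF P'] Qc mat_sum_carrier])
    moreover have "0\<^sub>m n n = lyap P' + Qbar \<longleftrightarrow> lyap P' = - Qbar"
    proof
      assume *: "0\<^sub>m n n = lyap P' + Qbar"
      show "lyap P' = - Qbar"
      proof (rule eq_matI)
        fix a b assume "a < dim_row (- Qbar)" "b < dim_col (- Qbar)"
        then show "lyap P' $$ (a, b) = (- Qbar) $$ (a, b)"
          using arg_cong[OF *, of "\<lambda>X. X $$ (a, b)"] lyapc[OF P'] Qbarc by simp
      qed (use lyapc[OF P'] Qbarc in auto)
    next
      assume "lyap P' = - Qbar"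
      then show "0\<^sub>m n n = lyap P' + Qbar" using Qbarc by simp
    qed
    moreover have "lyap P' = - Qbar \<longleftrightarrow> P' = P" using unique[OF P' P(1)] lyapP by auto
    ultimately show ?thesis by simp
  qed
  have gain_iff: "K i = mat_inv (R i i + transpose_mat (D i) * P * D i)
              * (transpose_mat (B i) * P + transpose_mat (D i) * P * C
                 - mat_sum (m i) n (\<lambda>k. transpose_mat (D i) * P * D k * K k) ({1..N} - {i}))
      \<longleftrightarrow> R i i * K i = gain P"
  proof -
    let ?D = "transpose_mat (D i) * P * D i" and ?X = "transpose_mat (B i) * P + transpose_mat (D i) * P * C"
    let ?f = "\<lambda>k. transpose_mat (D i) * P * D k * K k"
    define H where "H = R i i + ?D"
    define E where "E = ?X - mat_sum (m i) n ?f ({1..N} - {i})"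
    have Dc: "?D \<in> carrier_mat (m i) (m i)" using Di P(1) by simp
    have DKc: "?D * K i \<in> carrier_mat (m i) n" using Dc Ki by simp
    have Xc: "?X \<in> carrier_mat (m i) n" using Bi Di P(1) assms(3) by simp
    have Ec: "E \<in> carrier_mat (m i) n" by (simp add: E_def minus_carrier_mat)
    \<comment> \<open>\<open>P\<close> is already known to be positive definite; hence
      \<open>H\<close> is invertible, and multiplying by \<open>H\<close> or by
      \<open>mat_inv H\<close> clears the inverse in both directions.\<close>
    have H: "H \<in> sym_pos_def (m i)" unfolding H_def
      by (intro sym_pos_def_add_semidef assms(10) sym_pos_semidef_congruence[OF sym_pos_def_imp_semidef[OF Ppd] Di])
    then have Hc: "H \<in> carrier_mat (m i) (m i)" by (simp add: sym_pos_def_def)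
    note Hinv = sym_pos_def_mat_inv[OF H]
    have "K i = mat_inv H * E \<longleftrightarrow> H * K i = E"
    proof
      assume "K i = mat_inv H * E"
      then have "H * K i = H * mat_inv H * E" using assoc_mult_mat[OF Hc Hinv(3) Ec] by simp
      then show "H * K i = E" using Hinv(1) Ec by simp
    next
      assume "H * K i = E"
      then have "mat_inv H * E = mat_inv H * H * K i" using assoc_mult_mat[OF Hinv(3) Hc Ki] by simp
      then show "K i = mat_inv H * E" using Hinv(2) Ki by simp
    qed
    also have "H * K i = R i i * K i + ?D * K i"
      unfolding H_def by (rule add_mult_distrib_mat[OF Rc[OF i] Dc Ki])
    also have "R i i * K i + ?D * K i = E \<longleftrightarrow> R i i * K i = gain P"
    proof -
      \<comment> \<open>Splitting off player \<open>i\<close> exhibits \<open>?D * K i\<close>, the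
        very term that \<open>H * K i\<close> adds to \<open>R i i * K i\<close>.\<close>
      have g: "gain P = ?X - (?D * K i + mat_sum (m i) n ?f ({1..N} - {i}))"
        unfolding gain_def using mat_sum_remove[of "{1..N}" i ?f "m i" n] i DKc by simp
      show ?thesis unfolding g E_def
        by (rule mat_add_eq_minus_iff[OF RKc DKc Xc mat_sum_carrier])
    qed
    finally show ?thesis unfolding H_def E_def .
  qed
  have M: "M_mat n N m A B C D K i *\<^sub>v theta_vec N (Q i) (R i) = vectorize (R i i * K i - gain P)"
  proof -
    have Qv: "vectorize Qbar \<in> carrier_vec (n * n)" using Qbarc by simp
    \<comment> \<open>The sign comes from \<open>lyap P = - Qbar\<close>; it turns the contribution
      of \<open>S_mat\<close> into minus the vectorized gain.\<close>
    have "mat_inv L *\<^sub>v vectorize Qbar = - vectorize P"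
    proof -
      have "vectorize P = mat_inv L *\<^sub>v (- vectorize Qbar)" using P(2) vectorize_uminus[OF Qbarc] by simp
      also have "\<dots> = - (mat_inv L *\<^sub>v vectorize Qbar)" using inv(3) Qv by (rule mult_mat_vec_uminus)
      finally show ?thesis by simp
    qed
    then have "S_mat n N m A B C D K i *\<^sub>v vectorize Qbar = T *\<^sub>v (- vectorize P)"
      unfolding S using assoc_mult_mat_vec[OF Tc inv(3) Qv] by simp
    also have "\<dots> = - vectorize (gain P)"
      using mult_mat_vec_uminus[OF Tc, of "vectorize P"] T[OF P(1)] P(1) by simp
    finally have "M_mat n N m A B C D K i *\<^sub>v theta_vec N (Q i) (R i) = - vectorize (gain P) + vectorize (R i i * K i)"
      using M_mat_mult_theta_vec[OF Sc K i Qc Rc] by (simp add: Qbar_def)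
    also have "\<dots> = vectorize (R i i * K i - gain P)"
      unfolding vectorize_minus[OF RKc gainc]
      by (rule uminus_add_vec[OF vectorize_carrier[OF gainc] vectorize_carrier[OF RKc]])
    finally show ?thesis .
  qed
  have "M_mat n N m A B C D K i *\<^sub>v theta_vec N (Q i) (R i) = 0\<^sub>v (n * m i) \<longleftrightarrow> R i i * K i = gain P"
  proof
    assume "M_mat n N m A B C D K i *\<^sub>v theta_vec N (Q i) (R i) = 0\<^sub>v (n * m i)"
    then have "vectorize (R i i * K i - gain P) = vectorize (0\<^sub>m (m i) n)"
      unfolding M by (simp add: vectorize_zero mult.commute)
    then have *: "R i i * K i - gain P = 0\<^sub>m (m i) n"
      by (rule vectorize_inject[rotated 2]) (use RKc gainc[of P] in auto)
    show "R i i * K i = gain P"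
    proof (rule eq_matI)
      fix a b assume "a < dim_row (gain P)" "b < dim_col (gain P)"
      then show "(R i i * K i) $$ (a, b) = gain P $$ (a, b)"
        using arg_cong[OF *, of "\<lambda>X. X $$ (a, b)"] gainc[of P] RKc by simp
    qed (use RKc gainc[of P] in auto)
  next
    assume "R i i * K i = gain P"
    then show "M_mat n N m A B C D K i *\<^sub>v theta_vec N (Q i) (R i) = 0\<^sub>v (n * m i)"
      unfolding M using gainc[of P] by (simp add: vectorize_zero mult.commute)
  qed
  \<comment> \<open>With this, \<open>lyap_iff\<close> applies to every witness of (i) and
    identifies it with \<open>P\<close>. Since \<open>P\<close> is itself admissible, (i) reduces to
    the gain equation at \<open>P\<close>, which is also what (ii) says.\<close>
  moreover have "P' \<in> carrier_mat n n" if "P' \<in> sym_pos_def n" for P' using that by (simp add: sym_pos_def_def)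
  ultimately show ?thesis
    unfolding Acl_def[symmetric] Ccl_def[symmetric] lyap_def[symmetric]
    using lyap_iff gain_iff Ppd by blast
qed

end
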